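(* Let $\widehat{\mathbf M}=(\hat{\mathbb X},\hat{\mathbb U},\mathbb Y,\hat x_0,\hat{\mathbf t},\hat h)$ be a gMDP, $\psi$ an scLTL formula with DFA $\mathcal A_\psi=(Q,q_0,\Sigma,F,\tau)$, $\delta\ge0$, and $\mu$ a stationary Markov policy on $\widehat{\mathbf M}\otimes\mathcal A_\psi$. Define $$\mathcal S^\mu_\delta:=\max\{\mathbf 1_F(\bar q_0),V^\mu_\infty(\hat x_0,\bar q_0)\},\quad \bar q_0=\tau(q_0,\mathsf L(\hat h(\hat x_0))),\quad V^\mu_\infty=\lim_{l\to\infty}(\mathbf T^\mu_\delta)^l(0).$$ Then $\mathcal S^\mu_\delta$ is a $(0,\delta)$-robust satisfaction probability: for every gMDP $\mathbf M$ with the same metric output space $\mathbb Y$ such that $\widehat{\mathbf M}\preceq^\delta_0\mathbf M$, one can construct a control strategy $\mathbf C$ for $\mathbf M$ with $\mathbb P_{\mathbf C\times\mathbf M}(\boldsymbol\omega\models\psi)\ge\mathcal S^\mu_\delta$.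
   Context: A gMDP is a tuple $\mathbf M=(\mathbb X,\mathbb U,\mathbb Y,x_0,\mathbf t,h)$ with Polish state space $\mathbb X$, Polish input space $\mathbb U$, output space $\mathbb Y$ with metric $\mathbf d_{\mathbb Y}$, initial state $x_0$, conditional stochastic kernel $\mathbf t(\cdot\mid x,u)$ on $\mathbb X$, measurable output map $h:\mathbb X\to\mathbb Y$; executions satisfy $x_{t+1}\sim\mathbf t(\cdot\mid x_t,u_t)$, $y_t=h(x_t)$. A control strategy for $\mathbf M$ is a gMDP $\mathbf C$ with its own (memory) state space, input space $\mathbb X$ and output space $\mathcal P(\mathbb U)$ (universally measurable kernel and output map): it reads the current state of $\mathbf M$ and outputs a distribution from which the input of $\mathbf M$ is drawn; $\mathbb P_{\mathbf C\times\mathbf M}$ is the induced measure on closed-loop output traces. Specifications: $\mathsf{AP}$ finite, $\Sigma=2^{\mathsf{AP}}$, measurable labelling $\mathsf L:\mathbb Y\to\Sigma$, word $\boldsymbol\omega=\mathsf L(y_0)\mathsf L(y_1)\cdots$; $\psi$ is an scLTL formula (syntax $p\mid\neg p\mid\wedge\mid\vee\mid\bigcirc\mid\mathbin{\sf U}$, usual semantics) and $\mathcal A_\psi=(Q,q_0,\Sigma,F,\tau)$ a deterministic finite automaton with accepting set $F$ and transition $\tau:Q\times\Sigma\to Q$ accepting (via a finite run reaching $F$, $q_{i+1}=\tau(q_i,\omega_i)$) exactly the words satisfying $\psi$. The product $\widehat{\mathbf M}\otimes\mathcal A_\psi$ has states $\hat{\mathbb X}\times Q$, inputs $\hat{\mathbb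 U}$, kernel $\bar{\mathbf t}(d\hat x'\times\{q'\}\mid\hat x,q,u)=\mathbf 1_{\{q'\}}(\tau(q,\mathsf L(\hat h(\hat x'))))\hat{\mathbf t}(d\hat x'\mid\hat x,u)$. A stationary Markov policy is a universally measurable $\mu:\hat{\mathbb X}\times Q\to\mathcal P(\hat{\mathbb U})$ used at every step. For $V:\hat{\mathbb X}\times Q\to[0,1]$: $\mathbf T^\mu(V)(\hat x,q)=\int\max\{\mathbf 1_F(q'),V(\hat x',q')\}\bar{\mathbf t}(d\hat x'\times\{q'\}\mid\hat x,q,\mu(\hat x,q))$ and $\mathbf T^\mu_\delta(V)=\mathbf L(\mathbf T^\mu(V)-\delta)$, $\mathbf L(r)=\min(1,\max(0,r))$. Approximate simulation: for gMDPs $\widehat{\mathbf M}$ and $\mathbf M$ with common $(\mathbb Y,\mathbf d_{\mathbb Y})$, $\widehat{\mathbf M}\preceq^\delta_\epsilon\mathbf M$ means there exist an interface function $\mathcal U_v:\hat{\mathbb U}\times\hat{\mathbb X}\times\mathbb X\to\mathcal P(\mathbb U)$, a measurable relation $\mathcal R\subseteq\hat{\mathbb X}\times\mathbb X$, and a Borel measurable kernel $\mathbb W_{\mathbf t}(\cdot\mid\hat u,\hat x,x)$ on $\hat{\mathbb X}\times\mathbb X$ such that $(\hat x_0,x_0)\in\mathcal R$ and for all $(\hat x,x)\in\mathcal R$: $\mathbf d_{\mathbb Y}(\hat h(\hat x),h(x))\le\epsilon$, and for all $\hat u\in\hat{\mathbb U}$ the measure $\mathbb W=\mathbb W_{\mathbf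 t}(\cdot\mid\hat u,\hat x,x)$ satisfies $\mathbb W(\hat A\times\mathbb X)=\hat{\mathbf t}(\hat A\mid\hat x,\hat u)$, $\mathbb W(\hat{\mathbb X}\times A)=\mathbf t(A\mid x,\mathcal U_v(\hat u,\hat x,x))$ for all measurable $\hat A,A$, and $\mathbb W(\mathcal R)\ge1-\delta$. *)

theory Defs
  imports "HOL-Probability.Probability" "HOL-Probability.Projective_Family"
begin

definition univ_sets :: "'a measure \<Rightarrow> 'a set set" where
  "univ_sets S = {A. A \<subseteq> space S \<and>
      (\<forall>P. prob_space P \<and> sets P = sets S \<longrightarrow> A \<in> sets (completion P))}"

definition univ_alg :: "'a measure \<Rightarrow> 'a measure" where
  "univ_alg S = sigma (space S) (univ_sets S)"

definition uext :: "'a measure \<Rightarrow> 'a measure" where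
  "uext P = measure_of (space P) (univ_sets P) (emeasure (completion P))"

record ('x, 'u, 'y) gmdp =
  init :: 'x
  trans :: "'x \<Rightarrow> 'u \<Rightarrow> 'x measure"
  out :: "'x \<Rightarrow> 'y"

definition is_gmdp :: "('x::polish_space, 'u::polish_space, 'y::metric_space) gmdp \<Rightarrow> bool" where
  "is_gmdp M \<longleftrightarrow>
     (\<lambda>(x, u). trans M x u) \<in> measurable borel (prob_algebra borel) \<and>
     out M \<in> measurable borel borel"

definition kmix :: "('x \<Rightarrow> 'u \<Rightarrow> 'z measure) \<Rightarrow> 'x \<Rightarrow> 'u measure \<Rightarrow> 'z measure" where
  "kmix t x \<nu> = \<nu> \<bind> (\<lambda>u. t x u)"

definition approx_sim ::
  "real \<Rightarrow> real \<Rightarrow> ('x::polish_space, 'u::polish_space, 'y::metric_space) gmdp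
     \<Rightarrow> ('xc::polish_space, 'uc::polish_space, 'y) gmdp \<Rightarrow> bool" where
  "approx_sim \<delta> \<epsilon> Mh M \<longleftrightarrow>
    (\<exists>(Uv :: 'u \<Rightarrow> 'x \<Rightarrow> 'xc \<Rightarrow> 'uc measure) (R :: ('x \<times> 'xc) set)
       (W :: 'u \<Rightarrow> 'x \<Rightarrow> 'xc \<Rightarrow> ('x \<times> 'xc) measure).
      (\<forall>u x xc. Uv u x xc \<in> space (prob_algebra borel)) \<and>
      R \<in> sets borel \<and>
      (\<lambda>(u, x, xc). W u x xc) \<in> measurable borel (prob_algebra borel) \<and>
      (init Mh, init M) \<in> R \<and>
      (\<forall>(x, xc) \<in> R.
         dist (out Mh x) (out M xc) \<le> \<epsilon> \<and>
         (\<forall>u. (\<forall>A \<in> sets borel. emeasure (W u x xc) (A \<times> UNIV) = emeasure (trans Mh x u) A) \<and>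
              (\<forall>A \<in> sets borel. emeasure (W u x xc) (UNIV \<times> A)
                                 = emeasure (kmix (trans M) xc (Uv u x xc)) A) \<and>
              measure (W u x xc) R \<ge> 1 - \<delta>)))"

datatype 'ap scltl =
    Prop 'ap
  | NProp 'ap
  | And "'ap scltl" "'ap scltl"
  | Or "'ap scltl" "'ap scltl"
  | Next "'ap scltl"
  | Until "'ap scltl" "'ap scltl"

fun scsat :: "(nat \<Rightarrow> 'ap set) \<Rightarrow> nat \<Rightarrow> 'ap scltl \<Rightarrow> bool" where
  "scsat w i (Prop p) = (p \<in> w i)"
| "scsat w i (NProp p) = (p \<notin> w i)"
| "scsat w i (And a b) = (scsat w i a \<and> scsat w i b)"
| "scsat w i (Or a b) = (scsat w i a \<or> scsat w i b)"
| "scsat w i (Next a) = scsat w (Suc i) a"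
| "scsat w i (Until a b) = (\<exists>j\<ge>i. scsat w j b \<and> (\<forall>k. i \<le> k \<and> k < j \<longrightarrow> scsat w k a))"

primrec dfa_run :: "('q \<Rightarrow> 'ap set \<Rightarrow> 'q) \<Rightarrow> 'q \<Rightarrow> (nat \<Rightarrow> 'ap set) \<Rightarrow> nat \<Rightarrow> 'q" where
  "dfa_run \<tau> q0 w 0 = q0"
| "dfa_run \<tau> q0 w (Suc i) = \<tau> (dfa_run \<tau> q0 w i) (w i)"

definition dfa_accepts :: "'q \<Rightarrow> 'q set \<Rightarrow> ('q \<Rightarrow> 'ap set \<Rightarrow> 'q) \<Rightarrow> (nat \<Rightarrow> 'ap set) \<Rightarrow> bool" where
  "dfa_accepts q0 F \<tau> w \<longleftrightarrow> (\<exists>n. dfa_run \<tau> q0 w n \<in> F)"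

abbreviation XQ :: "('x::topological_space \<times> 'q) measure" where
  "XQ \<equiv> borel \<Otimes>\<^sub>M count_space UNIV"

definition prod_kernel ::
  "('x::topological_space, 'u, 'y) gmdp \<Rightarrow> ('y \<Rightarrow> 'ap set) \<Rightarrow> ('q \<Rightarrow> 'ap set \<Rightarrow> 'q)
     \<Rightarrow> 'x \<times> 'q \<Rightarrow> 'u measure \<Rightarrow> ('x \<times> 'q) measure" where
  "prod_kernel Mh L \<tau> s \<nu> =
     kmix (\<lambda>x u. distr (trans Mh x u) XQ (\<lambda>x'. (x', \<tau> (snd s) (L (out Mh x'))))) (fst s) \<nu>"

text \<open>The operator T^mu (integration against the completed measure, so that universally
  measurable value functions are integrated correctly).\<close>
definition Tmu ::
  "('x::topological_space, 'u, 'y) gmdp \<Rightarrow> ('y \<Rightarrow> 'ap set) \<Rightarrow> 'q set \<Rightarrow> ('q \<Rightarrow> 'ap set \<Rightarrow> 'q)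
     \<Rightarrow> ('x \<times> 'q \<Rightarrow> 'u measure) \<Rightarrow> ('x \<times> 'q \<Rightarrow> real) \<Rightarrow> 'x \<times> 'q \<Rightarrow> real" where
  "Tmu Mh L F \<tau> \<mu> V s =
     (\<integral>s'. max (indicator F (snd s')) (V s') \<partial>completion (prod_kernel Mh L \<tau> s (\<mu> s)))"

definition clip01 :: "real \<Rightarrow> real" where
  "clip01 r = min 1 (max 0 r)"

definition Tmu_delta ::
  "('x::topological_space, 'u, 'y) gmdp \<Rightarrow> ('y \<Rightarrow> 'ap set) \<Rightarrow> 'q set \<Rightarrow> ('q \<Rightarrow> 'ap set \<Rightarrow> 'q)
     \<Rightarrow> ('x \<times> 'q \<Rightarrow> 'u measure) \<Rightarrow> real \<Rightarrow> ('x \<times> 'q \<Rightarrow> real) \<Rightarrow> 'x \<times> 'q \<Rightarrow> real" where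
  "Tmu_delta Mh L F \<tau> \<mu> \<delta> V s = clip01 (Tmu Mh L F \<tau> \<mu> V s - \<delta>)"

definition V_inf ::
  "('x::topological_space, 'u, 'y) gmdp \<Rightarrow> ('y \<Rightarrow> 'ap set) \<Rightarrow> 'q set \<Rightarrow> ('q \<Rightarrow> 'ap set \<Rightarrow> 'q)
     \<Rightarrow> ('x \<times> 'q \<Rightarrow> 'u measure) \<Rightarrow> real \<Rightarrow> 'x \<times> 'q \<Rightarrow> real" where
  "V_inf Mh L F \<tau> \<mu> \<delta> s = lim (\<lambda>l. ((Tmu_delta Mh L F \<tau> \<mu> \<delta> ^^ l) (\<lambda>_. 0)) s)"

definition robust_sat_prob ::
  "('x::topological_space, 'u, 'y) gmdp \<Rightarrow> ('y \<Rightarrow> 'ap set) \<Rightarrow> 'q \<Rightarrow> 'q set \<Rightarrow> ('q \<Rightarrow> 'ap set \<Rightarrow> 'q)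
     \<Rightarrow> ('x \<times> 'q \<Rightarrow> 'u measure) \<Rightarrow> real \<Rightarrow> real" where
  "robust_sat_prob Mh L q0 F \<tau> \<mu> \<delta> =
     (let qb0 = \<tau> q0 (L (out Mh (init Mh)))
      in max (indicator F qb0) (V_inf Mh L F \<tau> \<mu> \<delta> (init Mh, qb0)))"

definition is_policy :: "('x::topological_space \<times> 'q \<Rightarrow> 'u::topological_space measure) \<Rightarrow> bool" where
  "is_policy \<mu> \<longleftrightarrow> \<mu> \<in> measurable (univ_alg XQ) (prob_algebra borel)"

text \<open>A control strategy is a gMDP with memory state space 'm, input space = state space
  of the controlled gMDP and output space = probability measures on its inputs.\<close>
record ('m, 'xc, 'uc) strategy =
  cinit :: 'm
  ctrans :: "'m \<Rightarrow> 'xc \<Rightarrow> 'm measure"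
  cout :: "'m \<Rightarrow> 'uc measure"

definition is_strategy :: "'m measure \<Rightarrow> ('m, 'xc::topological_space, 'uc::topological_space) strategy \<Rightarrow> bool" where
  "is_strategy Mm C \<longleftrightarrow>
     (\<lambda>(m, x). ctrans C m x) \<in> measurable (univ_alg (Mm \<Otimes>\<^sub>M borel)) (prob_algebra Mm) \<and>
     cout C \<in> measurable (univ_alg Mm) (prob_algebra borel)"

definition cl_step ::
  "'m measure \<Rightarrow> ('m, 'xc::topological_space, 'uc) strategy \<Rightarrow> ('xc, 'uc, 'y) gmdp
     \<Rightarrow> 'm \<times> 'xc \<Rightarrow> ('m \<times> 'xc) measure" where
  "cl_step Mm C M z =
     uext (ctrans C (fst z) (snd z)) \<bind> (\<lambda>m'.
       uext (cout C m') \<bind> (\<lambda>u.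
         uext (trans M (snd z) u) \<bind> (\<lambda>x'. return (univ_alg (Mm \<Otimes>\<^sub>M borel)) (m', x'))))"

definition cl_kernels ::
  "'m measure \<Rightarrow> ('m, 'xc::topological_space, 'uc) strategy \<Rightarrow> ('xc, 'uc, 'y) gmdp
     \<Rightarrow> nat \<Rightarrow> (nat \<Rightarrow> 'm \<times> 'xc) \<Rightarrow> ('m \<times> 'xc) measure" where
  "cl_kernels Mm C M i \<omega> =
     (if i = 0 then return (univ_alg (Mm \<Otimes>\<^sub>M borel)) (cinit C, init M)
      else cl_step Mm C M (\<omega> (i - 1)))"

definition cl_path_measure ::
  "'m measure \<Rightarrow> ('m, 'xc::topological_space, 'uc) strategy \<Rightarrow> ('xc, 'uc, 'y) gmdp
     \<Rightarrow> (nat \<Rightarrow> 'm \<times> 'xc) measure" where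
  "cl_path_measure Mm C M =
     projective_family.lim UNIV
       (Ionescu_Tulcea.CI (cl_kernels Mm C M) (\<lambda>_. univ_alg (Mm \<Otimes>\<^sub>M borel)))
       (\<lambda>_. univ_alg (Mm \<Otimes>\<^sub>M borel))"

definition cl_trace_measure ::
  "'m measure \<Rightarrow> ('m, 'xc::topological_space, 'uc) strategy \<Rightarrow> ('xc, 'uc, 'y::topological_space) gmdp
     \<Rightarrow> (nat \<Rightarrow> 'y) measure" where
  "cl_trace_measure Mm C M =
     distr (cl_path_measure Mm C M) (Pi\<^sub>M UNIV (\<lambda>_. borel)) (\<lambda>\<omega> i. out M (snd (\<omega> i)))"

definition sat_prob ::
  "'m measure \<Rightarrow> ('m, 'xc::topological_space, 'uc) strategy \<Rightarrow> ('xc, 'uc, 'y::topological_space) gmdp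
     \<Rightarrow> ('y \<Rightarrow> 'ap set) \<Rightarrow> 'ap scltl \<Rightarrow> real" where
  "sat_prob Mm C M L \<psi> =
     measure (cl_trace_measure Mm C M)
       {ys \<in> space (Pi\<^sub>M UNIV (\<lambda>_. borel)). scsat (\<lambda>i. L (ys i)) 0 \<psi>}"

end

theory Submission
  imports Defs
begin

text \<open>
  The strategy simulates the abstract system: its memory \<open>(x, q, xc)\<close> holds an abstract state, the
  automaton state and the last concrete state. Averaging the coupling kernel over the abstract policy
  gives the joint law of the next pair of states. Observing the next concrete state, the strategy
  samples the next abstract state from the conditional law, so that the closed loop reproduces the
  coupling as long as the pair stays in the relation, where abstract and concrete outputs
  coincide. Leaving the relation costs at most \<open>\<delta>\<close> per step, which is exactly what the operator
  \<open>T\<^sub>\<delta>\<close> subtracts; induction on the horizon bounds the probability of reaching \<open>F\<close> within \<open>l\<close>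
  steps from below by the \<open>l\<close>-th iterate.

  Two measurability problems have to be overcome. The interface function is not assumed to be
  measurable; as the concrete marginal of the coupling is a measurable kernel, the von Neumann selection
  theorem yields a universally measurable replacement. And the conditional law must depend
  measurably on the memory, which requires a disintegration of kernels with a parameter.
\<close>

section \<open>Universal completion\<close>

text \<open>Three further points shape the construction. In a closed-loop step the memory reads the
  current concrete state before the input is drawn, so a chain state carries a memory that lags one
  step behind; the value functions \<open>v\<close> and the target set \<open>B\<close> therefore
  refer to the pending memory update. The update kernel is the same at all times, yet its first use
  must produce the initial abstract state; the initial memory is recognised by an accepting
  automaton state, which is why an empty \<open>F\<close> is treated separately. Finally, the policy
  is only universally measurable and the drawn abstract input is not remembered: the coupling is
  averaged over that input before it is disintegrated, and integrals of universally measurable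
  functions are handled through the extension \<open>uext\<close> of a law. As
  \<open>univ_alg (S \<Otimes>\<^sub>M T)\<close> may be larger than a product of completions,
  measurability in a parameter is obtained from joint laws on the product space.\<close>

lemma univ_sets_cong: "sets S = sets T \<Longrightarrow> univ_sets S = univ_sets T"
  using sets_eq_imp_space_eq[of S T] by (simp add: univ_sets_def)

lemma sigma_algebra_univ_sets: "sigma_algebra (space S) (univ_sets S)"
proof -
  show ?thesis
    unfolding sigma_algebra_iff2
  proof (intro conjI ballI allI impI)
    show "univ_sets S \<subseteq> Pow (space S)" by (auto simp: univ_sets_def)
    show "{} \<in> univ_sets S" by (auto simp: univ_sets_def)
    show "space S - s \<in> univ_sets S" if "s \<in> univ_sets S" for s
    proof -
      have "space S - s \<in> sets (completion P)" if "prob_space P" "sets P = sets S" for P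
        using \<open>s \<in> univ_sets S\<close> that sets.compl_sets[of s "completion P"]
        by (simp add: univ_sets_def sets_eq_imp_space_eq[OF that(2)])
      then show ?thesis by (simp add: univ_sets_def)
    qed
    show "(\<Union>i. A i) \<in> univ_sets S" if "range A \<subseteq> univ_sets S" for A :: "nat \<Rightarrow> _"
    proof -
      have "(\<Union>i. A i) \<in> sets (completion P)" if "prob_space P" "sets P = sets S" for P
        by (rule sets.countable_UN)
           (use \<open>range A \<subseteq> univ_sets S\<close> that in \<open>auto simp: univ_sets_def image_subset_iff\<close>)
      then show ?thesis using that by (auto simp: univ_sets_def image_subset_iff)
    qed
  qed
qed

lemma univ_sets_subset: "univ_sets S \<subseteq> Pow (space S)"
  by (auto simp: univ_sets_def)

lemma space_univ_alg [simp]: "space (univ_alg S) = space S"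
  unfolding univ_alg_def by (simp add: space_measure_of univ_sets_subset)

lemma sets_univ_alg: "sets (univ_alg S) = univ_sets S"
  unfolding univ_alg_def
  by (simp add: sigma_algebra.sets_measure_of_eq sigma_algebra_univ_sets)

lemma sets_le_univ_sets: "A \<in> sets S \<Longrightarrow> A \<in> univ_sets S"
  using sets.sets_into_space by (fastforce simp: univ_sets_def)

lemma univ_sets_completion:
  "A \<in> univ_sets S \<Longrightarrow> prob_space P \<Longrightarrow> sets P = sets S \<Longrightarrow> A \<in> sets (completion P)"
  by (simp add: univ_sets_def)

lemma sets_univ_alg_cong: "sets S = sets T \<Longrightarrow> sets (univ_alg S) = sets (univ_alg T)"
  unfolding sets_univ_alg by (rule univ_sets_cong)

lemma univ_alg_cong: "sets S = sets T \<Longrightarrow> univ_alg S = univ_alg T"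
  using sets_eq_imp_space_eq[of S T] univ_sets_cong[of S T] by (simp add: univ_alg_def)

text \<open>Treats one law at a time, so a proof may choose auxiliary sets that depend on the
  law.\<close>

lemma measurable_univ_algI:
  assumes "f \<in> space S \<rightarrow> space N"
    and "\<And>P. prob_space P \<Longrightarrow> sets P = sets S \<Longrightarrow> f \<in> measurable (completion P) N"
  shows "f \<in> measurable (univ_alg S) N"
proof (rule measurableI)
  show "f x \<in> space N" if "x \<in> space (univ_alg S)" for x using assms(1) that by auto
  fix A assume A: "A \<in> sets N"
  show "f -` A \<inter> space (univ_alg S) \<in> sets (univ_alg S)"
    unfolding sets_univ_alg univ_sets_def
  proof (safe; simp)
    fix P assume P: "prob_space P" "sets P = sets S"
    show "f -` A \<inter> space S \<in> sets (completion P)"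
      using measurable_sets[OF assms(2)[OF P] A] sets_eq_imp_space_eq[OF P(2)] by simp
  qed
qed

lemma measurable_univ_alg_finer: "f \<in> measurable S N \<Longrightarrow> f \<in> measurable (univ_alg S) N"
  by (auto simp: measurable_def sets_univ_alg sets_le_univ_sets)

text \<open>For a law \<open>P\<close> on \<open>S\<close>, sets in the completion of the image law
  \<open>distr P T f\<close> pull back into the completion of \<open>P\<close>. This allows a
  measurable map to be composed inside a universally measurable function.\<close>

lemma measurable_univ_alg_lift:
  assumes f: "f \<in> measurable S T"
  shows "f \<in> measurable (univ_alg S) (univ_alg T)"
proof (rule measurable_univ_algI)
  show "f \<in> space S \<rightarrow> space (univ_alg T)" using measurable_space[OF f] by auto
  fix P assume P: "prob_space P" "sets P = sets S"
  interpret prob_space P by fact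
  have f': "f \<in> measurable P T" using f P(2) by (simp cong: measurable_cong_sets)
  have D: "prob_space (distr P T f)" by (rule prob_space_distr[OF f'])
  have "f \<in> measurable (completion P) (completion (distr P T f))"
  proof (rule completion.measurable_completion2)
    show "f \<in> measurable (completion P) (distr P T f)"
      using measurable_completion[OF f'] by (simp cong: measurable_cong_sets)
    have "N \<in> null_sets (distr (completion P) T f)" if "N \<in> null_sets (distr P T f)" for N
      using that by (simp add: distr_completion[OF f'])
    then show "null_sets (distr P T f) \<subseteq> null_sets (distr (completion P) (distr P T f) f)"
      by (auto simp: null_sets_def distr_completion[OF f'] distr_cong[OF refl sets_distr refl])
  qed
  then show "f \<in> measurable (completion P) (univ_alg T)"
    using univ_sets_completion[OF _ D]
    by (auto simp: measurable_def sets_univ_alg)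
qed

lemma measurable_completion_AE:
  assumes f: "f \<in> measurable (completion P) N" and ae: "AE x in P. f x = g x"
    and g: "\<And>x. x \<in> space P \<Longrightarrow> g x \<in> space N"
  shows "g \<in> measurable (completion P) N"
proof (rule measurableI)
  show "g x \<in> space N" if "x \<in> space (completion P)" for x using g that by simp
  fix A assume A: "A \<in> sets N"
  have *: "AE x in completion P. x \<in> f -` A \<inter> space P \<longleftrightarrow> x \<in> g -` A \<inter> space P"
    using AE_completion[OF ae] by eventually_elim auto
  show "g -` A \<inter> space (completion P) \<in> sets (completion P)"
    using completion.in_sets_AE[OF *] measurable_sets[OF f A] by simp
qed

section \<open>The extension of a law to the universally measurable sets\<close>

lemma space_uext [simp]: "space (uext P) = space P"
  unfolding uext_def by (simp add: space_measure_of univ_sets_subset)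

lemma sets_uext: "sets (uext P) = sets (univ_alg P)"
  unfolding uext_def
  by (simp add: sigma_algebra.sets_measure_of_eq sigma_algebra_univ_sets sets_univ_alg)

lemma emeasure_uext:
  assumes P: "prob_space P" and A: "A \<in> univ_sets P"
  shows "emeasure (uext P) A = emeasure (completion P) A"
  unfolding uext_def
proof (rule emeasure_measure_of_sigma[OF sigma_algebra_univ_sets _ _ A])
  have sub: "univ_sets P \<subseteq> sets (completion P)"
    using univ_sets_completion[OF _ P refl] by auto
  show "positive (univ_sets P) (emeasure (completion P))" by (simp add: positive_def)
  show "countably_additive (univ_sets P) (emeasure (completion P))"
    using sub unfolding countably_additive_def
    by (auto intro!: suminf_emeasure)
qed

lemma emeasure_uext_sets:
  "prob_space P \<Longrightarrow> A \<in> sets P \<Longrightarrow> emeasure (uext P) A = emeasure P A"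
  by (simp add: emeasure_uext sets_le_univ_sets)

lemma prob_space_uext: "prob_space P \<Longrightarrow> prob_space (uext P)"
  by (rule prob_spaceI) (simp add: emeasure_uext_sets prob_space.emeasure_space_1)

lemma uext_in_prob_algebra:
  "P \<in> space (prob_algebra S) \<Longrightarrow> uext P \<in> space (prob_algebra (univ_alg S))"
  using sets_univ_alg_cong[of P S] by (simp add: space_prob_algebra prob_space_uext sets_uext)

text \<open>The sandwich used throughout: up to a null set of the given law, a universally
  measurable set can be replaced by a set of the original algebra, at equal measure.\<close>

lemma univ_setsE:
  assumes "A \<in> univ_sets S" "prob_space P" "sets P = sets S"
  obtains B N where "B \<in> sets S" "N \<in> null_sets P" "B \<subseteq> A" "A \<subseteq> B \<union> N" "emeasure (completion P) A = emeasure P B"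
proof -
  have A: "A \<in> sets (completion P)" by (rule univ_sets_completion[OF assms])
  then obtain B N N' where *: "A = B \<union> N" "N \<subseteq> N'" "N' \<in> null_sets P" "B \<in> sets P"
    by (rule sets_completionE)
  have "B \<in> sets (completion P)" "N' \<in> sets (completion P)"
    using * by auto
  then have "emeasure (completion P) A \<le> emeasure (completion P) (B \<union> N')"
    using * by (intro emeasure_mono) auto
  also have "\<dots> = emeasure P (B \<union> N')" using * by (subst emeasure_completion) auto
  also have "\<dots> = emeasure P B" using * by (simp add: emeasure_Un_null_set)
  finally have 1: "emeasure (completion P) A \<le> emeasure P B" .
  have "emeasure (completion P) B \<le> emeasure (completion P) A"
    using * A by (intro emeasure_mono) auto
  then have 2: "emeasure P B \<le> emeasure (completion P) A" using * by simp
  show thesis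
    using * assms(3) 1 2 by (intro that[of B N']) (auto intro: antisym)
qed

text \<open>By the sandwich, the values on the original sets force the value on every universally
  measurable set. The identities for \<open>uext\<close> of image laws, mixtures and Dirac laws all
  come from here.\<close>

lemma uext_unique:
  assumes Q: "prob_space Q" and P': "sets P' = sets (univ_alg Q)"
    and eq: "\<And>A. A \<in> sets Q \<Longrightarrow> emeasure P' A = emeasure Q A"
  shows "P' = uext Q"
proof (rule measure_eqI)
  show "sets P' = sets (uext Q)" by (simp add: sets_uext P')
  fix A assume "A \<in> sets P'"
  then have A: "A \<in> univ_sets Q" by (simp add: P' sets_univ_alg)
  obtain B N where *: "B \<in> sets Q" "N \<in> null_sets Q" "B \<subseteq> A" "A \<subseteq> B \<union> N"
    "emeasure (completion Q) A = emeasure Q B"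
    by (rule univ_setsE[OF A Q refl])
  have s: "C \<in> sets P'" if "C \<in> univ_sets Q" for C using that by (simp add: P' sets_univ_alg)
  have "emeasure P' A \<le> emeasure P' (B \<union> N)"
    using * by (intro emeasure_mono s sets_le_univ_sets) auto
  also have "\<dots> = emeasure Q B" using * by (subst eq) (auto simp: emeasure_Un_null_set)
  finally have 1: "emeasure P' A \<le> emeasure Q B" .
  have "emeasure P' B \<le> emeasure P' A" using * by (intro emeasure_mono s A) auto
  then have 2: "emeasure Q B \<le> emeasure P' A" using * eq by simp
  show "emeasure P' A = emeasure (uext Q) A"
    using 1 2 * by (simp add: emeasure_uext[OF Q A])
qed

text \<open>A law \<open>P\<close> extends to \<open>uext P\<close> on the completed algebra. Both
  sandwich sets taken for \<open>uext P\<close> already lie in the completion of \<open>P\<close>,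
  and so does everything between them. Hence results about kernels on \<open>S\<close> also apply to
  kernels that are only universally measurable.\<close>

lemma univ_alg_idem: "univ_alg (univ_alg S) = univ_alg S"
proof -
  have "univ_sets (univ_alg S) = univ_sets S"
  proof (intro set_eqI iffI)
    fix A assume A: "A \<in> univ_sets (univ_alg S)"
    show "A \<in> univ_sets S"
      unfolding univ_sets_def
    proof (safe)
      show "x \<in> space S" if "x \<in> A" for x using A that by (auto simp: univ_sets_def)
      fix P assume P: "prob_space P" "sets P = sets S"
          have U: "prob_space (uext P)" "sets (uext P) = sets (univ_alg S)"
        using prob_space_uext[OF P(1)] by (simp_all add: sets_uext sets_univ_alg_cong[OF P(2)])
      obtain B N where *: "B \<in> sets (univ_alg S)" "N \<in> null_sets (uext P)" "B \<subseteq> A" "A \<subseteq> B \<union> N"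
        by (rule univ_setsE[OF A U])
      have us: "univ_sets P = univ_sets S" by (rule univ_sets_cong[OF P(2)])
      have B: "B \<in> sets (completion P)" using * P by (simp add: sets_univ_alg univ_sets_completion)
      have N: "N \<in> univ_sets P" using * by (auto simp: null_sets_def U(2) sets_univ_alg us)
      have "N \<in> null_sets (completion P)"
        using * N P by (auto simp: null_sets_def emeasure_uext us univ_sets_completion)
      then have "A - B \<in> sets (completion P)"
        using completion.complete2[of "A - B" N] * by auto
      then have "B \<union> (A - B) \<in> sets (completion P)" using B by blast
      then show "A \<in> sets (completion P)" using * by (simp add: Un_absorb1)
    qed
  next
    fix A assume "A \<in> univ_sets S" then show "A \<in> univ_sets (univ_alg S)"
      by (intro sets_le_univ_sets) (simp add: sets_univ_alg)
  qed
  then show ?thesis by (simp add: univ_alg_def[of "univ_alg S"] univ_alg_def[symmetric])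
qed

lemma measurable_ident_univ: "(\<lambda>x. x) \<in> measurable (univ_alg S) S"
  by (rule measurable_univ_alg_finer) simp

lemma uext_subalgebra:
  assumes P: "prob_space P"
  shows "sets (uext P) \<subseteq> sets (completion P)" "space (uext P) = space (completion P)"
    "\<And>A. A \<in> sets (uext P) \<Longrightarrow> emeasure (uext P) A = emeasure (completion P) A"
  using univ_sets_completion[OF _ P refl] emeasure_uext[OF P]
  by (auto simp: sets_uext sets_univ_alg)

lemma nn_integral_uext:
  assumes P: "prob_space P" and f: "f \<in> borel_measurable (univ_alg P)"
  shows "(\<integral>\<^sup>+x. f x \<partial>uext P) = (\<integral>\<^sup>+x. f x \<partial>completion P)"
proof (rule nn_integral_subalgebra[OF _ uext_subalgebra[OF P]])
  show "f \<in> borel_measurable (uext P)"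
    using f by (subst measurable_cong_sets[OF sets_uext refl])
qed

lemma integral_uext:
  fixes f :: "'a \<Rightarrow> real"
  assumes P: "prob_space P" and f: "f \<in> borel_measurable (univ_alg P)"
  shows "(\<integral>x. f x \<partial>uext P) = (\<integral>x. f x \<partial>completion P)"
proof (rule integral_subalgebra[OF _ uext_subalgebra[OF P]])
  show "f \<in> borel_measurable (uext P)"
    using f by (subst measurable_cong_sets[OF sets_uext refl])
qed

text \<open>Under a fixed law on the parameters, the extended measure of a universally measurable
  set agrees almost everywhere with the measure of one fixed set of \<open>T\<close>, and the latter
  depends measurably on the parameter.\<close>

lemma measurable_uext_kernel:
  assumes k: "\<kappa> \<in> measurable S (prob_algebra T)"
  shows "(\<lambda>s. uext (\<kappa> s)) \<in> measurable (univ_alg S) (prob_algebra (univ_alg T))"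
proof (rule measurable_prob_algebraI)
  have ks: "\<kappa> s \<in> space (prob_algebra T)" if "s \<in> space S" for s using measurable_space[OF k that] .
  then have kp: "prob_space (\<kappa> s)" "sets (\<kappa> s) = sets T" if "s \<in> space S" for s
    using that by (auto simp: space_prob_algebra)
  show "prob_space (uext (\<kappa> s))" if "s \<in> space (univ_alg S)" for s
    using that kp by (simp add: prob_space_uext)
  have un: "univ_sets (\<kappa> s) = univ_sets T" if "s \<in> space S" for s
    by (intro univ_sets_cong kp that)
  show "(\<lambda>s. uext (\<kappa> s)) \<in> measurable (univ_alg S) (subprob_algebra (univ_alg T))"
  proof (rule measurable_subprob_algebra)
    show "subprob_space (uext (\<kappa> s))" if "s \<in> space (univ_alg S)" for s
      using that kp by (simp add: prob_space_uext prob_space_imp_subprob_space)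
    show "sets (uext (\<kappa> s)) = sets (univ_alg T)" if "s \<in> space (univ_alg S)" for s
      using that by (simp add: sets_uext sets_univ_alg un)
    fix A assume "A \<in> sets (univ_alg T)"
    then have A: "A \<in> univ_sets T" by (simp add: sets_univ_alg)
    show "(\<lambda>s. emeasure (uext (\<kappa> s)) A) \<in> borel_measurable (univ_alg S)"
    proof (rule measurable_univ_algI)
      fix P assume P: "prob_space P" "sets P = sets S"
          interpret prob_space P by fact
      have sp: "space P = space S" using P(2) by (rule sets_eq_imp_space_eq)
      have kP: "\<kappa> \<in> measurable P (prob_algebra T)" using k P(2) by (simp cong: measurable_cong_sets)
      have kPs: "\<kappa> \<in> measurable P (subprob_algebra T)" by (rule measurable_prob_algebraD[OF kP])
      \<comment> \<open>Sandwiching \<open>A\<close> under the mixture \<open>Q\<close> yields a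
        single pair \<open>B\<close>, \<open>N\<close> that serves almost all laws
        \<open>\<kappa> s\<close> simultaneously: a null set of the mixture is null for almost every
        component.\<close>
      define Q where "Q = P \<bind> \<kappa>"
      have Pp: "P \<in> space (prob_algebra P)" using P by (simp add: space_prob_algebra)
      have Q: "prob_space Q" "sets Q = sets T"
        using prob_space_bind'[OF Pp kP] sets_bind'[OF Pp kP] by (auto simp: Q_def)
      obtain B N where *: "B \<in> sets T" "N \<in> null_sets Q" "B \<subseteq> A" "A \<subseteq> B \<union> N"
        by (rule univ_setsE[OF A Q])
      have "AE x in Q. x \<notin> N" using * by (intro AE_not_in)
      then have "AE s in P. AE x in \<kappa> s. x \<notin> N"
        unfolding Q_def using * Q by (subst (asm) AE_bind[OF kPs]) (auto simp: null_sets_def)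
      then have ae: "AE s in P. emeasure (\<kappa> s) B = emeasure (uext (\<kappa> s)) A"
      proof (rule AE_mp[OF _ AE_I2], intro impI)
        fix s assume s: "s \<in> space P" and ae: "AE x in \<kappa> s. x \<notin> N"
        have N: "N \<in> null_sets (\<kappa> s)"
          using ae * kp(2)[of s] s sp Q by (subst AE_iff_null_sets) (auto simp: null_sets_def)
        have p: "prob_space (uext (\<kappa> s))" using s sp kp by (simp add: prob_space_uext)
        have in_u: "C \<in> sets (uext (\<kappa> s))" if "C \<in> univ_sets T" for C
          using that s sp by (simp add: sets_uext sets_univ_alg un)
        have B: "B \<in> sets (\<kappa> s)" using * kp(2)[of s] s sp by simp
        have "emeasure (\<kappa> s) B = emeasure (uext (\<kappa> s)) B"
          using B s sp kp by (simp add: emeasure_uext_sets)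
        also have "\<dots> \<le> emeasure (uext (\<kappa> s)) A" using * A by (intro emeasure_mono in_u)
        finally have 1: "emeasure (\<kappa> s) B \<le> emeasure (uext (\<kappa> s)) A" .
        have BN: "B \<union> N \<in> sets (\<kappa> s)" using B N by auto
        then have BN': "B \<union> N \<in> univ_sets T" using un[of s] s sp sets_le_univ_sets by auto
        have "emeasure (uext (\<kappa> s)) A \<le> emeasure (uext (\<kappa> s)) (B \<union> N)"
          using * by (intro emeasure_mono in_u BN')
        also have "\<dots> = emeasure (\<kappa> s) B"
          using BN B N s sp kp by (simp add: emeasure_uext_sets emeasure_Un_null_set)
        finally show "emeasure (\<kappa> s) B = emeasure (uext (\<kappa> s)) A" using 1 by simp
      qed
      have m: "(\<lambda>s. emeasure (\<kappa> s) B) \<in> borel_measurable (completion P)"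
        using kPs * by (intro measurable_completion) measurable
      show "(\<lambda>s. emeasure (uext (\<kappa> s)) A) \<in> borel_measurable (completion P)"
        by (rule measurable_completion_AE[OF m]) (use ae in \<open>auto simp: AE_completion_iff\<close>)
    qed simp
  qed
qed


lemma measurable_uext_univ_kernel:
  "\<kappa> \<in> measurable (univ_alg S) (prob_algebra T) \<Longrightarrow>
    (\<lambda>s. uext (\<kappa> s)) \<in> measurable (univ_alg S) (prob_algebra (univ_alg T))"
  using measurable_uext_kernel[of \<kappa> "univ_alg S" T] by (simp add: univ_alg_idem)

lemma distr_uext:
  assumes P: "P \<in> space (prob_algebra S)" and f: "f \<in> measurable S T"
  shows "distr (uext P) (univ_alg T) f = uext (distr P T f)"
proof (rule uext_unique)
  have P': "prob_space P" "sets P = sets S" using P by (auto simp: space_prob_algebra)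
  have fP: "f \<in> measurable P T" using f P' by (simp cong: measurable_cong_sets)
  show "prob_space (distr P T f)" by (rule prob_space.prob_space_distr[OF P'(1) fP])
  show "sets (distr (uext P) (univ_alg T) f) = sets (univ_alg (distr P T f))"
    using sets_univ_alg_cong[of "distr P T f" T] by simp
  fix A assume A: "A \<in> sets (distr P T f)"
  have fu: "f \<in> measurable (uext P) (univ_alg T)"
    using measurable_univ_alg_lift[OF fP] by (subst measurable_cong_sets[OF sets_uext refl])
  have "f -` A \<inter> space P \<in> sets P" using A by (intro measurable_sets[OF fP]) simp
  then show "emeasure (distr (uext P) (univ_alg T) f) A = emeasure (distr P T f) A"
    using A by (simp add: emeasure_distr[OF fu] emeasure_distr[OF fP] emeasure_uext_sets P'
      sets_univ_alg sets_le_univ_sets)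
qed

text \<open>Attaching the parameter to the sample moves the kernel to the product space. A function
  measurable for \<open>univ_alg (S \<Otimes>\<^sub>M T)\<close> can then be integrated there
  directly, although it need not be measurable for the product of \<open>univ_alg S\<close> and
  \<open>T\<close>.\<close>

lemma measurable_distr_Pair:
  assumes k: "\<kappa> \<in> measurable (univ_alg S) (prob_algebra T)"
  shows "(\<lambda>s. distr (\<kappa> s) (S \<Otimes>\<^sub>M T) (Pair s)) \<in> measurable (univ_alg S) (prob_algebra (S \<Otimes>\<^sub>M T))"
proof (rule measurable_distr_prob_space2[OF k])
  have "(\<lambda>x. (fst x, snd x)) \<in> measurable (univ_alg S \<Otimes>\<^sub>M T) (S \<Otimes>\<^sub>M T)"
    using measurable_ident_univ[of S]
    by (intro measurable_Pair measurable_snd) (rule measurable_compose[OF measurable_fst])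
  then show "(\<lambda>(x, y). (x, y)) \<in> measurable (univ_alg S \<Otimes>\<^sub>M T) (S \<Otimes>\<^sub>M T)"
    by (simp add: split_beta')
qed

lemma uext_distr_Pair:
  assumes k: "\<kappa> \<in> measurable (univ_alg S) (prob_algebra T)" and s: "s \<in> space S"
  shows "uext (distr (\<kappa> s) (S \<Otimes>\<^sub>M T) (Pair s)) = distr (uext (\<kappa> s)) (univ_alg (S \<Otimes>\<^sub>M T)) (Pair s)"
  using measurable_space[OF k] s by (intro distr_uext[symmetric]) auto

lemma measurable_Pair_univ:
  assumes s: "s \<in> space S"
  shows "Pair s \<in> measurable (univ_alg T) (univ_alg (S \<Otimes>\<^sub>M T))"
  using s by (intro measurable_univ_alg_lift) simp

lemma measurable_uext_cong:
  "P \<in> space (prob_algebra T) \<Longrightarrow> measurable (uext P) N = measurable (univ_alg T) N"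
  by (intro measurable_cong_sets refl) (simp add: sets_uext space_prob_algebra cong: sets_univ_alg_cong)

lemma measurable_bind_uext:
  assumes k: "\<kappa> \<in> measurable (univ_alg S) (prob_algebra T)"
    and f: "(\<lambda>(s, t). f s t) \<in> measurable (univ_alg (S \<Otimes>\<^sub>M T)) (prob_algebra N)"
  shows "(\<lambda>s. uext (\<kappa> s) \<bind> f s) \<in> measurable (univ_alg S) (prob_algebra N)"
proof -
  have "(\<lambda>s. uext (distr (\<kappa> s) (S \<Otimes>\<^sub>M T) (Pair s)) \<bind> (\<lambda>(s, t). f s t))
      \<in> measurable (univ_alg S) (prob_algebra N)"
    by (rule measurable_bind_prob_space[OF measurable_uext_univ_kernel[OF measurable_distr_Pair[OF k]] f])
  also have "?this \<longleftrightarrow> ?thesis"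
  proof (rule measurable_cong)
    fix s assume "s \<in> space (univ_alg S)"
    then have s: "s \<in> space S" by simp
    have ks: "\<kappa> s \<in> space (prob_algebra T)" using measurable_space[OF k] s by auto
    have [simp]: "space (\<kappa> s) \<noteq> {}" using ks prob_space.not_empty by (auto simp: space_prob_algebra)
    show "uext (distr (\<kappa> s) (S \<Otimes>\<^sub>M T) (Pair s)) \<bind> (\<lambda>(s, t). f s t) = uext (\<kappa> s) \<bind> f s"
      unfolding uext_distr_Pair[OF k s]
      by (subst bind_distr[OF _ measurable_prob_algebraD[OF f]])
         (auto simp: measurable_uext_cong[OF ks] measurable_Pair_univ[OF s])
  qed
  finally show ?thesis .
qed

lemma measurable_nn_integral_uext:
  assumes k: "\<kappa> \<in> measurable (univ_alg S) (prob_algebra T)"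
    and f: "(\<lambda>(s, t). f s t) \<in> borel_measurable (univ_alg (S \<Otimes>\<^sub>M T))"
  shows "(\<lambda>s. \<integral>\<^sup>+t. f s t \<partial>uext (\<kappa> s)) \<in> borel_measurable (univ_alg S)"
proof -
  have "(\<lambda>s. \<integral>\<^sup>+x. (case x of (s, t) \<Rightarrow> f s t) \<partial>uext (distr (\<kappa> s) (S \<Otimes>\<^sub>M T) (Pair s)))
      \<in> borel_measurable (univ_alg S)"
    by (rule measurable_compose[OF measurable_prob_algebraD[OF measurable_uext_univ_kernel[OF measurable_distr_Pair[OF k]]]
      nn_integral_measurable_subprob_algebra[OF f]])
  also have "?this \<longleftrightarrow> ?thesis"
  proof (rule measurable_cong)
    fix s assume "s \<in> space (univ_alg S)"
    then have s: "s \<in> space S" by simp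
    have ks: "\<kappa> s \<in> space (prob_algebra T)" using measurable_space[OF k] s by auto
    show "(\<integral>\<^sup>+x. (case x of (s, t) \<Rightarrow> f s t) \<partial>uext (distr (\<kappa> s) (S \<Otimes>\<^sub>M T) (Pair s)))
      = (\<integral>\<^sup>+t. f s t \<partial>uext (\<kappa> s))"
      unfolding uext_distr_Pair[OF k s]
      using f by (subst nn_integral_distr)
         (auto simp: measurable_uext_cong[OF ks] measurable_Pair_univ[OF s])
  qed
  finally show ?thesis .
qed

text \<open>Two consecutive extended draws can be merged into the extension of one composed law. By
  \<open>uext_unique\<close> agreement is checked on sets of \<open>T\<close>, where the extensions
  do not change the integrals.\<close>

lemma uext_bind:
  assumes P: "P \<in> space (prob_algebra S)" and k: "\<kappa> \<in> measurable S (prob_algebra T)"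
  shows "uext P \<bind> (\<lambda>s. uext (\<kappa> s)) = uext (P \<bind> \<kappa>)"
proof (rule uext_unique)
  note Pu = uext_in_prob_algebra[OF P] and ku = measurable_uext_kernel[OF k]
  show "prob_space (P \<bind> \<kappa>)" by (rule prob_space_bind'[OF P k])
  have sb: "sets (P \<bind> \<kappa>) = sets T" by (rule sets_bind'[OF P k])
  show "sets (uext P \<bind> (\<lambda>s. uext (\<kappa> s))) = sets (univ_alg (P \<bind> \<kappa>))"
    using sets_bind'[OF Pu ku] sets_univ_alg_cong[OF sb] by simp
  fix A assume "A \<in> sets (P \<bind> \<kappa>)"
  then have A: "A \<in> sets T" by (simp add: sb)
  have P': "prob_space P" "sets P = sets S" "space P = space S"
    using P by (auto simp: space_prob_algebra dest: sets_eq_imp_space_eq)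
  have ks: "prob_space (\<kappa> s)" "sets (\<kappa> s) = sets T" if "s \<in> space S" for s
    using measurable_space[OF k that] by (auto simp: space_prob_algebra)
  have m: "(\<lambda>s. emeasure (\<kappa> s) A) \<in> borel_measurable P"
    using measurable_prob_algebraD[OF k] A P'(2)
    by (simp add: measurable_emeasure_kernel cong: measurable_cong_sets)
  have "emeasure (uext P \<bind> (\<lambda>s. uext (\<kappa> s))) A = (\<integral>\<^sup>+s. emeasure (uext (\<kappa> s)) A \<partial>uext P)"
    using A by (intro emeasure_bind_prob_algebra[OF Pu ku]) (simp add: sets_univ_alg sets_le_univ_sets)
  also have "\<dots> = (\<integral>\<^sup>+s. emeasure (\<kappa> s) A \<partial>uext P)"
    by (intro nn_integral_cong) (simp add: P' emeasure_uext_sets ks A)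
  also have "\<dots> = (\<integral>\<^sup>+s. emeasure (\<kappa> s) A \<partial>P)"
    using m by (subst nn_integral_uext[OF P'(1)]) (auto intro: measurable_univ_alg_finer simp: nn_integral_completion)
  also have "\<dots> = emeasure (P \<bind> \<kappa>) A" by (rule emeasure_bind_prob_algebra[OF P k A, symmetric])
  finally show "emeasure (uext P \<bind> (\<lambda>s. uext (\<kappa> s))) A = emeasure (P \<bind> \<kappa>) A" .
qed

lemma nn_integral_uext_sets:
  assumes P: "P \<in> space (prob_algebra S)" and f: "f \<in> borel_measurable S"
  shows "(\<integral>\<^sup>+x. f x \<partial>uext P) = (\<integral>\<^sup>+x. f x \<partial>P)"
proof -
  have P': "prob_space P" "sets P = sets S" using P by (auto simp: space_prob_algebra)
  have "f \<in> borel_measurable P" using f P' by (simp cong: measurable_cong_sets)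
  then show ?thesis
    using P' by (simp add: nn_integral_uext measurable_univ_alg_finer nn_integral_completion)
qed

section \<open>Measurable selection\<close>

text \<open>Covers of the tails suffice because the finitely many initial terms can be added as
  further centres. The radius is halved so that a finite, hence closed, union of closed balls covers
  the closure and still lies in open balls of the full radius.\<close>

lemma sequence_totally_bounded_convergent_subseq:
  fixes e :: "nat \<Rightarrow> 'e::complete_space"
  assumes tb: "\<And>r. r > 0 \<Longrightarrow> \<exists>m k. finite k \<and> (\<forall>n\<ge>m. e n \<in> (\<Union>x\<in>k. cball x r))"
  obtains l r where "strict_mono r" "(e \<circ> r) \<longlonglongrightarrow> l"
proof -
  have "compact (closure (range e))"
    unfolding compact_eq_totally_bounded
  proof (intro conjI allI impI, simp add: complete_eq_closed)
    fix \<epsilon> :: real assume "\<epsilon> > 0"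
    then obtain m k where k: "finite k" "\<And>n. n \<ge> m \<Longrightarrow> e n \<in> (\<Union>x\<in>k. cball x (\<epsilon>/2))"
      using tb[of "\<epsilon>/2"] by auto
    have "closed (\<Union>x\<in>k \<union> e ` {..<m}. cball x (\<epsilon>/2))"
      using k by (intro closed_UN) auto
    moreover have "range e \<subseteq> (\<Union>x\<in>k \<union> e ` {..<m}. cball x (\<epsilon>/2))"
    proof safe
      fix n
      show "e n \<in> (\<Union>x\<in>k \<union> e ` {..<m}. cball x (\<epsilon>/2))"
      proof (cases "n < m")
        case True then show ?thesis using \<open>\<epsilon> > 0\<close> by (intro UN_I[of "e n"]) auto
      next
        case False then show ?thesis using k(2)[of n] by auto
      qed
    qed
    ultimately have "closure (range e) \<subseteq> (\<Union>x\<in>k \<union> e ` {..<m}. cball x (\<epsilon>/2))"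
      by (rule closure_minimal[rotated])
    also have "\<dots> \<subseteq> (\<Union>x\<in>k \<union> e ` {..<m}. ball x \<epsilon>)"
      using \<open>\<epsilon> > 0\<close> by (intro UN_mono) (auto simp: subset_iff)
    finally show "\<exists>k. finite k \<and> closure (range e) \<subseteq> (\<Union>x\<in>k. ball x \<epsilon>)"
      using k(1) by (intro exI[of _ "k \<union> e ` {..<m}"]) auto
  qed
  then have "seq_compact (closure (range e))" by (simp add: compact_eq_seq_compact_metric)
  moreover have "\<forall>n. e n \<in> closure (range e)" using closure_subset[of "range e"] by auto
  ultimately show thesis using that unfolding seq_compact_def by metis
qed

lemma dense_sequence:
  obtains d :: "nat \<Rightarrow> 'e::{metric_space, second_countable_topology}"
  where "\<And>x r. r > 0 \<Longrightarrow> \<exists>i. dist (d i) x < r"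
proof -
  obtain D :: "'e set" where D: "countable D" "\<And>X. open X \<Longrightarrow> X \<noteq> {} \<Longrightarrow> \<exists>d\<in>D. d \<in> X"
    using countable_dense_setE by blast
  have ne: "D \<noteq> {}" using D(2)[of UNIV] by auto
  show thesis
  proof (rule that[of "from_nat_into D"])
    fix x :: 'e and r :: real assume "r > 0"
    then obtain y where "y \<in> D" "y \<in> ball x r" using D(2)[of "ball x r"] by auto
    moreover then obtain i where "from_nat_into D i = y"
      using from_nat_into_surj[OF D(1)] by blast
    ultimately show "\<exists>i. dist (from_nat_into D i) x < r" by (auto simp: dist_commute)
  qed
qed

text \<open>Capacitability: the projection is exhausted from inside by projections of compact pieces,
  cut out by finitely many small balls on every scale, and those are closed.\<close>

lemma proj_closed_inner_approx:
  fixes C :: "('z::metric_space \<times> 'e::polish_space) set"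
  assumes C: "closed C" and P: "prob_space P" "sets P = sets borel" and \<epsilon>: "\<epsilon> > 0"
  obtains K where "closed K" "K \<subseteq> fst ` C" "outer_measure_of P (fst ` C) \<le> emeasure P K + ennreal \<epsilon>"
proof -
  interpret prob_space P by fact
  have spP: "space P = UNIV" using P(2) sets_eq_imp_space_eq[of P borel] by simp
  obtain d :: "nat \<Rightarrow> 'e" where d: "\<And>x r. r > 0 \<Longrightarrow> \<exists>i. dist (d i) x < r"
    using dense_sequence by blast
  define B where "B n k = (\<Union>i\<le>k. cball (d i) (1/2^n))" for n k :: nat
  define pr where "pr X = fst ` (C \<inter> UNIV \<times> X)" for X
  let ?o = "outer_measure_of P"
  have ofin: "?o X \<noteq> \<top>" for X
  proof -
    have "?o X \<le> ?o (space P)" by (intro outer_measure_of_mono) (simp add: spP)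
    then show ?thesis using emeasure_space_1 by (auto simp: top_unique)
  qed
  \<comment> \<open>Outer measure is continuous along increasing sequences of arbitrary sets, so
    finitely many balls of scale \<open>n\<close> capture the projection up to
    \<open>\<epsilon> / 2^Suc n\<close>. Summed over all scales the loss stays below
    \<open>\<epsilon>\<close>.\<close>
  have step: "\<exists>k. ?o (pr X) \<le> ?o (pr (X \<inter> B n k)) + ennreal (\<epsilon> / 2^Suc n)" for X n
  proof (cases "?o (pr X) = 0")
    case True then show ?thesis by simp
  next
    case False
    have inc: "incseq (\<lambda>k. pr (X \<inter> B n k))"
      unfolding incseq_def pr_def B_def by (intro allI impI image_mono) fastforce
    have "(\<Union>k. B n k) = UNIV"
    proof (intro set_eqI iffI UNIV_I)
      fix x
      obtain i where "dist (d i) x < 1/2^n" using d[of "1/2^n" x] by auto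
      then show "x \<in> (\<Union>k. B n k)" unfolding B_def by (auto intro!: exI[of _ i] bexI[of _ i] simp: less_imp_le)
    qed
    then have "C \<inter> UNIV \<times> X = (\<Union>k. C \<inter> UNIV \<times> (X \<inter> B n k))" by blast
    then have "pr X = (\<Union>k. pr (X \<inter> B n k))" unfolding pr_def by (simp only: image_UN)
    then have eq: "?o (pr X) = (SUP k. ?o (pr (X \<inter> B n k)))"
      using SUP_outer_measure_of_incseq[OF _ inc, of P] by (simp add: spP)
    have "?o (pr X) - ennreal (\<epsilon> / 2^Suc n) < ?o (pr X)"
    proof (rule ennreal_between)
      show "0 < ennreal (\<epsilon> / 2^Suc n)" using \<epsilon> by simp
      show "0 < ?o (pr X)" using False by (rule zero_less_iff_neq_zero[THEN iffD2])
      show "?o (pr X) < \<top>" using ofin[of "pr X"] by (rule less_top[THEN iffD1])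
    qed
    also note eq
    finally obtain k where "?o (pr X) - ennreal (\<epsilon> / 2^Suc n) < ?o (pr (X \<inter> B n k))"
      unfolding less_SUP_iff by blast
    then have "?o (pr X) \<le> ?o (pr (X \<inter> B n k)) + ennreal (\<epsilon> / 2^Suc n)"
      by (drule_tac less_imp_le) (simp add: ennreal_minus_le_iff add.commute)
    then show ?thesis ..
  qed
  define k where "k X n = (SOME k. ?o (pr X) \<le> ?o (pr (X \<inter> B n k)) + ennreal (\<epsilon> / 2^Suc n))" for X n
  have k: "?o (pr X) \<le> ?o (pr (X \<inter> B n (k X n))) + ennreal (\<epsilon> / 2^Suc n)" for X n
    unfolding k_def by (rule someI_ex[OF step])
  define X where "X = rec_nat UNIV (\<lambda>n A. A \<inter> B n (k A n))"
  have X0: "X 0 = UNIV" and XS: "\<And>n. X (Suc n) = X n \<inter> B n (k (X n) n)" by (simp_all add: X_def)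
  then have X: "\<And>n. \<exists>k. X (Suc n) = X n \<inter> B n k" by blast
  have Xo: "?o (pr (X n)) \<le> ?o (pr (X (Suc n))) + ennreal (\<epsilon> / 2^Suc n)" for n
    unfolding XS by (rule k)
  have dec: "X n \<subseteq> X m" if "m \<le> n" for m n
    using that X by (induction rule: dec_induct) blast+
  have Xn: "?o (fst ` C) \<le> ?o (pr (X n)) + ennreal (\<epsilon> * (1 - 1/2^n))" for n
  proof (induction n)
    case 0
    have "pr UNIV = fst ` C" by (simp add: pr_def)
    then show ?case by (simp add: X0)
  next
    case (Suc n)
    have "?o (fst ` C) \<le> (?o (pr (X (Suc n))) + ennreal (\<epsilon> / 2^Suc n)) + ennreal (\<epsilon> * (1 - 1/2^n))"
      using Suc Xo[of n] by (meson add_right_mono order_trans)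
    also have "\<dots> = ?o (pr (X (Suc n))) + ennreal (\<epsilon> / 2^Suc n + \<epsilon> * (1 - 1/2^n))"
      using \<epsilon> by (simp add: add.assoc ennreal_plus)
    also have "\<epsilon> / 2^Suc n + \<epsilon> * (1 - 1/2^n) = \<epsilon> * (1 - 1/2^Suc n)" by (simp add: field_simps)
    finally show ?case .
  qed
  \<comment> \<open>The sets \<open>pr (X n)\<close> may fail to be measurable, but their closures
    are closed sets. It remains to see that intersecting the closures does not lead out of the
    projection of \<open>C\<close>.\<close>
  define K where "K = (\<Inter>n. closure (pr (X n)))"
  show thesis
  proof (rule that[of K])
    show "closed K" unfolding K_def by auto
    show "K \<subseteq> fst ` C"
    proof
      fix z assume "z \<in> K"
      then have "\<exists>p. p \<in> C \<and> snd p \<in> X n \<and> dist (fst p) z < 1 / real (Suc n)" for n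
      proof -
        have "z \<in> closure (pr (X n))" using \<open>z \<in> K\<close> by (simp add: K_def)
        then obtain y where "y \<in> pr (X n)" "dist y z < 1 / real (Suc n)"
          unfolding closure_approachable by (metis of_nat_0_less_iff zero_less_Suc zero_less_divide_1_iff)
        moreover from this obtain b where "(y, b) \<in> C" "b \<in> X n" by (auto simp: pr_def)
        ultimately show ?thesis by (intro exI[of _ "(y, b)"]) simp
      qed
      then have "\<exists>p. \<forall>n. p n \<in> C \<and> snd (p n) \<in> X n \<and> dist (fst (p n)) z < 1 / real (Suc n)"
        by (intro choice allI)
      then obtain p where p: "\<And>n. p n \<in> C" "\<And>n. snd (p n) \<in> X n" "\<And>n. dist (fst (p n)) z < 1 / real (Suc n)"
        by blast
      \<comment> \<open>The piece with index \<open>Suc m\<close> has been cut by balls of scale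
        \<open>m\<close>, so from that index on the second coordinates lie in finitely many balls of
        radius \<open>1/2^m\<close>. A convergent subsequence then gives a point of \<open>C\<close>
        above \<open>z\<close>.\<close>
      have "\<exists>m k. finite k \<and> (\<forall>n\<ge>m. snd (p n) \<in> (\<Union>x\<in>k. cball x r))" if r: "r > 0" for r :: real
      proof -
        obtain m where m: "(1/2)^m < r" using real_arch_pow_inv[OF r, of "1/2"] by auto
        obtain k where k: "X (Suc m) = X m \<inter> B m k" using X by blast
        have "snd (p n) \<in> (\<Union>x\<in>d ` {..k}. cball x r)" if "n \<ge> Suc m" for n
        proof -
          have "snd (p n) \<in> B m k" using p(2)[of n] dec[OF that] k by blast
          then obtain i where "i \<le> k" "dist (d i) (snd (p n)) \<le> 1/2^m" by (auto simp: B_def)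
          then show ?thesis using m by (auto simp: power_divide intro!: bexI[of _ i])
        qed
        then show ?thesis by (intro exI[of _ "Suc m"] exI[of _ "d ` {..k}"]) auto
      qed
      then obtain l r where lr: "strict_mono r" "((\<lambda>n. snd (p n)) \<circ> r) \<longlonglongrightarrow> l"
        using sequence_totally_bounded_convergent_subseq[of "\<lambda>n. snd (p n)"] by blast
      have "(\<lambda>n. fst (p n)) \<longlonglongrightarrow> z"
      proof (rule metric_LIMSEQ_I)
        fix r :: real assume "r > 0"
        then obtain N where N: "1 / real (Suc N) < r" using reals_Archimedean
          by (metis inverse_eq_divide)
        have "dist (fst (p n)) z < r" if "n \<ge> N" for n
        proof -
          have "1 / real (Suc n) \<le> 1 / real (Suc N)" using that by (simp add: frac_le)
          then show ?thesis using p(3)[of n] N by linarith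
        qed
        then show "\<exists>N. \<forall>n\<ge>N. dist (fst (p n)) z < r" by blast
      qed
      then have "((\<lambda>n. fst (p n)) \<circ> r) \<longlonglongrightarrow> z" using lr(1) by (rule LIMSEQ_subseq_LIMSEQ)
      then have "(\<lambda>n. (fst (p (r n)), snd (p (r n)))) \<longlonglongrightarrow> (z, l)"
        using lr(2) by (intro tendsto_Pair) (auto simp: o_def)
      then have "(z, l) \<in> C" using C p(1) closed_sequentially[of C "\<lambda>n. p (r n)" "(z,l)"] by simp
      then show "z \<in> fst ` C" by force
    qed
    have decs: "decseq (\<lambda>n. closure (pr (X n)))"
      unfolding decseq_def pr_def using dec by (intro allI impI closure_mono image_mono) blast
    have "range (\<lambda>n. closure (pr (X n))) \<subseteq> sets P" unfolding P(2) by auto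
    then have KI: "emeasure P K = (INF n. emeasure P (closure (pr (X n))))"
      unfolding K_def by (rule INF_emeasure_decseq[OF _ decs, symmetric]) simp
    have "?o (fst ` C) - ennreal \<epsilon> \<le> emeasure P (closure (pr (X n)))" for n
    proof -
      have "?o (fst ` C) \<le> ?o (pr (X n)) + ennreal \<epsilon>"
        using \<epsilon> by (intro order_trans[OF Xn[of n]] add_left_mono ennreal_leI) simp
      also have "?o (pr (X n)) \<le> ?o (closure (pr (X n)))"
        by (intro outer_measure_of_mono closure_subset)
      also have "\<dots> = emeasure P (closure (pr (X n)))" using P(2) by (intro outer_measure_of_eq) simp
      finally show ?thesis by (simp add: ennreal_minus_le_iff add.commute)
    qed
    then have "?o (fst ` C) - ennreal \<epsilon> \<le> emeasure P K" unfolding KI by (rule INF_greatest)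
    then show "?o (fst ` C) \<le> emeasure P K + ennreal \<epsilon>"
      by (simp add: ennreal_minus_le_iff add.commute)
  qed
qed

text \<open>For each law, a countable union \<open>U\<close> of inner closed approximations and a
  measurable hull \<open>E\<close> of the projection have equal measure, so the projection differs
  from \<open>U\<close> by part of the null set \<open>E - U\<close>.\<close>

lemma univ_sets_proj_closed:
  fixes C :: "('z::metric_space \<times> 'e::polish_space) set"
  assumes C: "closed C"
  shows "fst ` C \<in> univ_sets borel"
  unfolding univ_sets_def
proof (intro CollectI conjI allI impI)
  fix P :: "'z measure" assume "prob_space P \<and> sets P = sets borel"
  then have P: "prob_space P" "sets P = sets borel" by auto
  interpret prob_space P by fact
  have spP: "space P = UNIV" using P(2) sets_eq_imp_space_eq[of P borel] by simp
  have "\<exists>K. closed K \<and> K \<subseteq> fst ` C \<and> outer_measure_of P (fst ` C) \<le> emeasure P K + ennreal (1 / Suc n)" for n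
    using proj_closed_inner_approx[OF C P, of "1 / Suc n"] by (metis of_nat_0_less_iff zero_less_Suc zero_less_divide_1_iff)
  then obtain K where K: "\<And>n. closed (K n)" "\<And>n. K n \<subseteq> fst ` C"
      "\<And>n. outer_measure_of P (fst ` C) \<le> emeasure P (K n) + ennreal (1 / Suc n)"
    by metis
  define U where "U = (\<Union>n. K n)"
  have U: "U \<in> sets P" unfolding U_def using K(1) P(2) by auto
  obtain E where E: "E \<in> sets P" "fst ` C \<subseteq> E" "outer_measure_of P (fst ` C) = emeasure P E"
    using outer_measure_of_attain[of "fst ` C" P] by (auto simp: spP)
  have UE: "U \<subseteq> E" using K(2) E(2) by (auto simp: U_def)
  have "emeasure P E \<le> emeasure P U + ennreal e" if e: "e > 0" for e :: real
  proof -
    obtain n where n: "1 / Suc n < e" using reals_Archimedean[OF e] by (auto simp: inverse_eq_divide)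
    have "emeasure P E \<le> emeasure P (K n) + ennreal (1 / Suc n)" using K(3) E by simp
    also have "\<dots> \<le> emeasure P U + ennreal e"
      using U n by (intro add_mono emeasure_mono ennreal_leI) (auto simp: U_def)
    finally show ?thesis .
  qed
  then have "emeasure P E \<le> emeasure P U" by (rule ennreal_le_epsilon)
  then have EU: "emeasure P E = emeasure P U" using emeasure_mono[OF UE E(1)] by (rule antisym)
  have "emeasure P (E - U) = emeasure P E - emeasure P U"
    by (rule emeasure_Diff[OF _ E(1) U UE]) simp
  then have "emeasure P (E - U) = 0" using EU by simp
  then have N: "E - U \<in> null_sets P" using E(1) U by (intro null_setsI sets.Diff)
  have "fst ` C = U \<union> (fst ` C - U)" using K(2) by (auto simp: U_def)
  then show "fst ` C \<in> sets (completion P)"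
    by (rule sets_completionI[OF _ _ N U]) (use E(2) in blast)
qed simp


text \<open>The auxiliary factor is Baire space. A point of it can encode an index followed by
  another point, or a whole sequence of points; this gives closure under countable unions and
  intersections.\<close>

definition analytic :: "'p::topological_space set \<Rightarrow> bool" where
  "analytic G \<longleftrightarrow> (\<exists>C :: ('p \<times> (nat \<Rightarrow> nat discrete)) set. closed C \<and> G = fst ` C)"

lemma analytic_closed: "closed A \<Longrightarrow> analytic A"
  unfolding analytic_def by (intro exI[of _ "A \<times> UNIV"]) (auto intro: closed_Times)

lemma continuous_on_snd_coord:
  "continuous_on UNIV (\<lambda>x::'a::topological_space \<times> ('i \<Rightarrow> 'b::topological_space). snd x j)"
  by (rule continuous_on_product_then_coordinatewise[OF continuous_on_snd[OF continuous_on_id]])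

lemma continuous_on_reindex:
  "continuous_on UNIV (\<lambda>x::'a::topological_space \<times> ('i \<Rightarrow> 'b::topological_space). (fst x, \<lambda>i. snd x (g i)))"
  by (rule continuous_on_Pair[OF continuous_on_fst[OF continuous_on_id]
    continuous_on_coordinatewise_then_product[OF continuous_on_snd_coord]])

text \<open>The first entry of the witness names the set to be entered, the shifted remainder is the
  witness for it. The condition is closed because the entries are discrete.\<close>

lemma analytic_UN:
  assumes "\<And>n::nat. analytic (A n)"
  shows "analytic (\<Union>n. A n)"
proof -
  obtain C :: "nat \<Rightarrow> ('a \<times> (nat \<Rightarrow> nat discrete)) set" where C: "\<And>n. closed (C n)" "\<And>n. A n = fst ` C n"
    using assms unfolding analytic_def by metis
  define D where "D = (\<Inter>n. {x. snd x 0 \<noteq> discrete n} \<union> {x. (fst x, \<lambda>i. snd x (Suc i)) \<in> C n})"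
  have "closed D"
    unfolding D_def
  proof (intro closed_INT ballI closed_Un)
    fix n :: nat
    have "continuous_on UNIV (\<lambda>x::'a \<times> (nat \<Rightarrow> nat discrete). snd x 0)"
      by (rule continuous_on_snd_coord)
    moreover have "closed (- {discrete n})" by (simp add: open_discrete closed_def)
    ultimately show "closed {x::'a \<times> (nat \<Rightarrow> nat discrete). snd x 0 \<noteq> discrete n}"
      using closed_vimage[of "- {discrete n}"] by (simp add: vimage_def)
    have "continuous_on UNIV (\<lambda>x::'a \<times> (nat \<Rightarrow> nat discrete). (fst x, \<lambda>i. snd x (Suc i)))"
      by (rule continuous_on_reindex)
    then show "closed {x. (fst x, \<lambda>i. snd x (Suc i)) \<in> C n}"
      using closed_vimage[OF C(1)[of n]] by (simp add: vimage_def)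
  qed
  moreover have "(\<Union>n. A n) = fst ` D"
  proof (intro set_eqI iffI)
    fix p assume "p \<in> (\<Union>n. A n)"
    then obtain n b where "(p, b) \<in> C n" by (auto simp: C(2))
    then have "(p, case_nat (discrete n) b) \<in> D" by (auto simp: D_def discrete_inject)
    then show "p \<in> fst ` D" by force
  next
    fix p assume "p \<in> fst ` D"
    then obtain b where b: "(p, b) \<in> D" by auto
    obtain n where "b 0 = discrete n" by (cases "b 0")
    then have "(p, \<lambda>i. b (Suc i)) \<in> C n" using b by (auto simp: D_def)
    then have "p \<in> A n" unfolding C(2) by force
    then show "p \<in> (\<Union>n. A n)" by blast
  qed
  ultimately show ?thesis unfolding analytic_def by blast
qed

text \<open>One witness stores countably many witnesses, interleaved by the pairing
  function.\<close>

lemma analytic_INT: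
  assumes "\<And>n::nat. analytic (A n)"
  shows "analytic (\<Inter>n. A n)"
proof -
  obtain C :: "nat \<Rightarrow> ('a \<times> (nat \<Rightarrow> nat discrete)) set" where C: "\<And>n. closed (C n)" "\<And>n. A n = fst ` C n"
    using assms unfolding analytic_def by metis
  define D where "D = (\<Inter>n. {x. (fst x, \<lambda>k. snd x (prod_encode (n, k))) \<in> C n})"
  have "closed D"
    unfolding D_def
  proof (intro closed_INT ballI)
    fix n
    have "continuous_on UNIV (\<lambda>x::'a \<times> (nat \<Rightarrow> nat discrete). (fst x, \<lambda>k. snd x (prod_encode (n, k))))"
      by (rule continuous_on_reindex)
    then show "closed {x. (fst x, \<lambda>k. snd x (prod_encode (n, k))) \<in> C n}"
      using closed_vimage[OF C(1)[of n]] by (simp add: vimage_def)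
  qed
  moreover have "(\<Inter>n. A n) = fst ` D"
  proof (intro set_eqI iffI)
    fix p assume "p \<in> (\<Inter>n. A n)"
    then have "\<exists>b. (p, b) \<in> C n" for n using C(2)[of n] by (auto simp: image_iff) force
    then obtain b where b: "\<And>n. (p, b n) \<in> C n" by metis
    then have "(p, \<lambda>j. b (fst (prod_decode j)) (snd (prod_decode j))) \<in> D" by (simp add: D_def)
    then show "p \<in> fst ` D" by force
  next
    fix p assume "p \<in> fst ` D"
    then obtain b where b: "(p, b) \<in> D" by auto
    have "p \<in> A n" for n
      using b unfolding C(2) D_def by (auto intro!: image_eqI[of _ fst "(p, \<lambda>k. b (prod_encode (n, k)))"])
    then show "p \<in> (\<Inter>n. A n)" by blast
  qed
  ultimately show ?thesis unfolding analytic_def by blast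
qed

text \<open>In a metric space an open set is a countable union of closed sets, graded by the
  distance to its complement.\<close>

lemma analytic_open:
  fixes U :: "'p::metric_space set"
  assumes "open U"
  shows "analytic U"
proof -
  define K where "K n = (\<Inter>y\<in>-U. {x. 1 / real (Suc n) \<le> dist x y})" for n
  have "closed (K n)" for n
    unfolding K_def by (intro closed_INT ballI closed_Collect_le continuous_intros)
  moreover have "U = (\<Union>n. K n)"
  proof (intro set_eqI iffI)
    fix x assume "x \<in> U"
    then obtain e where e: "e > 0" "ball x e \<subseteq> U" using \<open>open U\<close> by (auto simp: open_contains_ball)
    obtain n where "inverse (real (Suc n)) < e" using reals_Archimedean[OF e(1)] by blast
    then have "x \<in> K n" using e(2) by (auto simp: K_def inverse_eq_divide subset_iff not_less[symmetric])
    then show "x \<in> (\<Union>n. K n)" by blast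
  next
    fix x assume "x \<in> (\<Union>n. K n)"
    then obtain n where n: "x \<in> K n" by blast
    show "x \<in> U"
    proof (rule ccontr)
      assume "x \<notin> U"
      then have "1 / real (Suc n) \<le> dist x x" using n unfolding K_def by blast
      then show False by (simp add: field_simps)
    qed
  qed
  ultimately show ?thesis using analytic_UN[of K] analytic_closed by metis
qed

text \<open>The complement of an analytic set need not be analytic, so the induction carries a set
  together with its complement.\<close>

lemma borel_imp_analytic:
  fixes G :: "'p::metric_space set"
  assumes "G \<in> sets borel"
  shows "analytic G"
proof -
  have "G \<in> sigma_sets UNIV {S. open S}" using assms by (simp add: borel_def)
  then have "analytic G \<and> analytic (- G)"
  proof induction
    case (Basic a) then show ?case by (simp add: analytic_open analytic_closed closed_Compl)
  next
    case Empty then show ?case by (auto intro: analytic_closed)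
  next
    case (Compl a) then show ?case by (simp add: Compl_eq_Diff_UNIV[symmetric])
  next
    case (Union a)
    then have "analytic (\<Union>n. a n)" "analytic (\<Inter>n. - a n)" by (auto intro: analytic_UN analytic_INT)
    then show ?case by simp
  qed
  then show ?thesis ..
qed

text \<open>On every scale the ball of least index is chosen for which \<open>z\<close> stays in the
  projection of what is left of \<open>C\<close>. The centres form a Cauchy sequence whose limit
  lies in the fibre, as \<open>C\<close> is closed. Each choice depends only on membership in
  projections of closed sets, hence is universally measurable.\<close>

lemma closed_selection:
  fixes C :: "('z::metric_space \<times> 'e::polish_space) set"
  assumes C: "closed C"
  obtains s where "s \<in> measurable (univ_alg borel) borel" "\<And>z. z \<in> fst ` C \<Longrightarrow> (z, s z) \<in> C"
proof -
  obtain d :: "nat \<Rightarrow> 'e" where d: "\<And>x r. r > 0 \<Longrightarrow> \<exists>i. dist (d i) x < r"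
    using dense_sequence by blast
  \<comment> \<open>Lists grow at the head: the head is the index of the newest ball, and the length
    of the tail is its scale.\<close>
  define X where "X = rec_list (UNIV :: 'e set) (\<lambda>i l A. A \<inter> cball (d i) (1/2^length l))"
  have X: "X [] = UNIV" "\<And>i l. X (i # l) = X l \<inter> cball (d i) (1/2^length l)" by (auto simp: X_def)
  define pr where "pr l = fst ` (C \<inter> UNIV \<times> X l)" for l
  have clX: "closed (X l)" for l by (induction l) (auto simp: X)
  have pr[measurable]: "pr l \<in> sets (univ_alg borel)" for l
    unfolding pr_def sets_univ_alg
    by (intro univ_sets_proj_closed closed_Int C closed_Times clX closed_UNIV)
  have ex: "\<exists>i. z \<in> pr (i # l)" if z: "z \<in> pr l" for z l
  proof -
    obtain e where e: "(z, e) \<in> C" "e \<in> X l" using z by (auto simp: pr_def)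
    obtain i where "dist (d i) e < 1/2^length l" using d[of "1/2^length l" e] by auto
    then show ?thesis using e by (intro exI[of _ i]) (force simp: pr_def X less_imp_le)
  qed
  define path where "path z = rec_nat [] (\<lambda>n l. (LEAST i. z \<in> pr (i # l)) # l)" for z
  have path: "path z 0 = []" "path z (Suc n) = (LEAST i. z \<in> pr (i # path z n)) # path z n" for z n
    by (auto simp: path_def)
  have len: "length (path z n) = n" for z n by (induction n) (auto simp: path)
  have mpath: "(\<lambda>z. path z n) \<in> measurable (univ_alg borel) (count_space UNIV)" for n
  proof (induction n)
    case 0 then show ?case by (simp add: path)
  next
    case (Suc n)
    have "(\<lambda>z. (LEAST i. z \<in> pr (i # l)) # l) \<in> measurable (univ_alg borel) (count_space UNIV)" for l
      by measurable
    then show ?case unfolding path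
      by (rule measurable_compose_countable[OF _ Suc])
  qed
  have inpr: "z \<in> pr (path z n)" if "z \<in> pr []" for z n
  proof (induction n)
    case 0 then show ?case using that by (simp add: path)
  next
    case (Suc n) then show ?case unfolding path by (rule LeastI_ex[OF ex])
  qed
  \<comment> \<open>The constant value off the projection makes the sequence converge at every
    \<open>z\<close>, so the limit is measurable on the whole space.\<close>
  define c where "c n z = (if z \<in> pr [] then d (hd (path z (Suc n))) else d 0)" for n z
  have mc: "c n \<in> borel_measurable (univ_alg borel)" for n
  proof -
    have "(\<lambda>z. d (hd (path z (Suc n)))) \<in> borel_measurable (univ_alg borel)"
      by (rule measurable_compose[OF mpath]) simp
    then show ?thesis unfolding c_def by measurable
  qed
  have conv: "\<exists>e. (z, e) \<in> C \<and> (\<lambda>n. c n z) \<longlonglongrightarrow> e" if z: "z \<in> pr []" for z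
  proof -
    have "\<exists>e. (z, e) \<in> C \<and> e \<in> X (path z n)" for n using inpr[OF z, of n] by (auto simp: pr_def)
    then obtain e where e: "\<And>n. (z, e n) \<in> C" "\<And>n. e n \<in> X (path z n)" by metis
    have dec: "X (path z n) \<subseteq> X (path z m)" if "m \<le> n" for m n
      using that by (induction rule: dec_induct) (auto simp: X path)
    \<comment> \<open>The ball of scale \<open>m\<close> enters the path at length
      \<open>Suc m\<close>, hence the shifted index.\<close>
    have near: "dist (c m z) (e n) \<le> 1/2^m" if "Suc m \<le> n" for m n
      using e(2)[of n] dec[OF that] z by (auto simp: c_def path X len)
    have "Cauchy (\<lambda>n. c n z)"
    proof (rule metric_CauchyI)
      fix r :: real assume r: "r > 0"
      obtain M where M: "(1/2)^M < r/2" using real_arch_pow_inv[of "r/2" "1/2"] r by auto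
      have "dist (c m z) (c n z) < r" if "m \<ge> M" "n \<ge> M" for m n
      proof -
        have "dist (c m z) (c n z) \<le> dist (c m z) (e (Suc (max m n))) + dist (c n z) (e (Suc (max m n)))"
          by (rule dist_triangle2)
        also have "\<dots> \<le> 1/2^m + 1/2^n" by (intro add_mono near) auto
        also have "\<dots> \<le> 1/2^M + 1/2^M" using that by (intro add_mono divide_left_mono power_increasing) auto
        also have "\<dots> < r" using M by (simp add: power_divide)
        finally show ?thesis .
      qed
      then show "\<exists>M. \<forall>m\<ge>M. \<forall>n\<ge>M. dist (c m z) (c n z) < r" by blast
    qed
    then obtain l where l: "(\<lambda>n. c n z) \<longlonglongrightarrow> l" using Cauchy_convergent_iff convergent_def by blast
    have "(\<lambda>n. dist (c n z) (e (Suc n))) \<longlonglongrightarrow> 0"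
    proof (rule Lim_null_comparison)
      show "\<forall>\<^sub>F n in sequentially. norm (dist (c n z) (e (Suc n))) \<le> (1/2)^n"
        using near[of n "Suc n" for n] by (auto simp: power_divide)
      show "(\<lambda>n. (1/2::real)^n) \<longlonglongrightarrow> 0" by (intro LIMSEQ_realpow_zero) auto
    qed
    then have "(\<lambda>n. dist (c n z) (e (Suc n)) + dist (c n z) l) \<longlonglongrightarrow> 0 + 0"
      by (rule tendsto_add) (rule tendsto_dist_iff[THEN iffD1, OF l])
    then have "(\<lambda>n. dist (e (Suc n)) l) \<longlonglongrightarrow> 0"
      by (intro Lim_null_comparison[of "\<lambda>n. dist (e (Suc n)) l"]) (auto intro: always_eventually dist_triangle3)
    then have "(\<lambda>n. e (Suc n)) \<longlonglongrightarrow> l" by (simp add: tendsto_dist_iff[of "\<lambda>n. e (Suc n)"])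
    then have "(\<lambda>n. (z, e (Suc n))) \<longlonglongrightarrow> (z, l)" by (intro tendsto_intros)
    then have "(z, l) \<in> C" using C e(1) closed_sequentially[of C "\<lambda>n. (z, e (Suc n))" "(z, l)"] by simp
    then show ?thesis using l by blast
  qed
  have "\<exists>e. (z \<in> pr [] \<longrightarrow> (z, e) \<in> C) \<and> (\<lambda>n. c n z) \<longlonglongrightarrow> e" for z
    using conv[of z] by (cases "z \<in> pr []") (auto simp: c_def intro!: exI[of _ "d 0"])
  then obtain s where s: "\<And>z. z \<in> pr [] \<Longrightarrow> (z, s z) \<in> C" "\<And>z. (\<lambda>n. c n z) \<longlonglongrightarrow> s z" by metis
  show thesis
  proof (rule that[of s])
    show "s \<in> borel_measurable (univ_alg borel)"
      by (rule borel_measurable_LIMSEQ_metric[OF mc s(2)])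
    show "(z, s z) \<in> C" if "z \<in> fst ` C" for z
      using that s(1)[of z] by (simp add: pr_def X)
  qed
qed

instance prod :: (polish_space, polish_space) polish_space ..

text \<open>A Borel set is the projection of a closed set in a larger product. After rebracketing,
  the second coordinate and the Baire witness are selected together as one point of a Polish fibre,
  and the witness is dropped.\<close>

theorem Jankov_von_Neumann:
  fixes G :: "('z::polish_space \<times> 'e::polish_space) set"
  assumes "G \<in> sets borel"
  obtains s where "s \<in> measurable (univ_alg borel) borel" "\<And>z e. (z, e) \<in> G \<Longrightarrow> (z, s z) \<in> G"
proof -
  obtain C :: "(('z \<times> 'e) \<times> (nat \<Rightarrow> nat discrete)) set" where C: "closed C" "G = fst ` C"
    using borel_imp_analytic[OF assms] by (auto simp: analytic_def)
  define C' where "C' = {x. ((fst x, fst (snd x)), snd (snd x)) \<in> C}"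
  have "closed C'"
    unfolding C'_def
    using closed_vimage[OF C(1), of "\<lambda>x. ((fst x, fst (snd x)), snd (snd x))"]
    by (simp add: vimage_def continuous_intros)
  then obtain s where s: "s \<in> measurable (univ_alg borel) borel" "\<And>z. z \<in> fst ` C' \<Longrightarrow> (z, s z) \<in> C'"
    by (rule closed_selection) blast
  show thesis
  proof (rule that[of "\<lambda>z. fst (s z)"])
    show "(\<lambda>z. fst (s z)) \<in> borel_measurable (univ_alg borel)"
      by (rule measurable_compose[OF s(1)]) (intro borel_measurable_continuous_onI continuous_intros)
    fix z e assume "(z, e) \<in> G"
    then obtain b where "((z, e), b) \<in> C" by (auto simp: C(2))
    then have "(z, (e, b)) \<in> C'" by (simp add: C'_def)
    then have "(z, s z) \<in> C'" by (intro s(2)) force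
    then show "(z, fst (s z)) \<in> G" by (force simp: C'_def C(2))
  qed
qed

section \<open>Coding Borel probability measures by real sequences\<close>

text \<open>Base 3 with digits 0 and 1 avoids the ambiguity of binary expansions: a tail sums to at
  most one half, so multiplying and taking the floor recovers every digit.\<close>

lemma ternary_digits:
  fixes a :: "nat \<Rightarrow> bool"
  defines "x \<equiv> (\<Sum>n. of_bool (a n) / 3 ^ Suc n :: real)"
  shows "0 \<le> x" "x < 1" "\<lfloor>3 ^ Suc n * x\<rfloor> mod 3 = of_bool (a n)"
proof -
  have sg: "(\<lambda>n. 1 / 3 ^ Suc n :: real) sums (1/2)"
    using sums_mult[OF geometric_sums[of "1/3::real"], of "1/3"] by (simp add: power_divide)
  have sm: "summable (\<lambda>n. of_bool (b n) / 3 ^ Suc n :: real)" for b :: "nat \<Rightarrow> bool"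
    by (rule summable_comparison_test'[OF sums_summable[OF sg], of 0]) auto
  have bd: "0 \<le> (\<Sum>n. of_bool (b n) / 3 ^ Suc n :: real)" "(\<Sum>n. of_bool (b n) / 3 ^ Suc n :: real) \<le> 1/2" for b :: "nat \<Rightarrow> bool"
  proof -
    show "0 \<le> (\<Sum>n. of_bool (b n) / 3 ^ Suc n :: real)" by (rule suminf_nonneg[OF sm]) simp
    have "(\<Sum>n. of_bool (b n) / 3 ^ Suc n :: real) \<le> (\<Sum>n. 1 / 3 ^ Suc n)"
      by (rule suminf_le[OF _ sm sums_summable[OF sg]]) simp
    then show "(\<Sum>n. of_bool (b n) / 3 ^ Suc n :: real) \<le> 1/2" using sums_unique[OF sg] by simp
  qed
  show "0 \<le> x" "x < 1" using bd[of a] by (auto simp: x_def)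
  \<comment> \<open>The rescaled tail after digit \<open>n\<close>; being below 1 it does not affect
    the floor.\<close>
  define t where "t = (\<Sum>k. of_bool (a (k + Suc n)) / 3 ^ Suc k :: real)"
  have t: "0 \<le> t" "t < 1" using bd[of "\<lambda>k. a (k + Suc n)"] by (auto simp: t_def)
  have tail: "(\<Sum>k. of_bool (a (k + Suc n)) / 3 ^ Suc (k + Suc n)) = t / 3 ^ Suc n"
    unfolding t_def
    using suminf_divide[OF sm[of "\<lambda>k. a (k + Suc n)"], of "3 ^ Suc n"]
    by (simp add: power_add mult.commute mult.left_commute)
  have "x = t / 3 ^ Suc n + (\<Sum>i<Suc n. of_bool (a i) / 3 ^ Suc i)"
    unfolding x_def tail[symmetric] by (rule suminf_split_initial_segment[OF sm])
  then have "3 ^ Suc n * x = t + (\<Sum>i<Suc n. 3 ^ Suc n * (of_bool (a i) / 3 ^ Suc i))"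
    by (simp add: distrib_left sum_distrib_left del: sum.lessThan_Suc)
  also have "(\<Sum>i<Suc n. 3 ^ Suc n * (of_bool (a i) / 3 ^ Suc i) :: real) = (\<Sum>i<Suc n. of_bool (a i) * 3 ^ (n - i))"
    by (intro sum.cong refl) (auto simp: power_diff)
  also have "\<dots> = of_int (\<Sum>i<Suc n. of_bool (a i) * 3 ^ (n - i))" by simp
  finally have "\<lfloor>3 ^ Suc n * x\<rfloor> = (\<Sum>i<Suc n. of_bool (a i) * 3 ^ (n - i))"
    using t by linarith
  also have "\<dots> mod 3 = (of_bool (a n) + 3 * (\<Sum>i<n. of_bool (a i) * 3 ^ (n - Suc i))) mod 3"
  proof -
    have "(\<Sum>i<n. of_bool (a i) * 3 ^ (n - i)) = (3 * (\<Sum>i<n. of_bool (a i) * 3 ^ (n - Suc i)) :: int)"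
      unfolding sum_distrib_left
    proof (rule sum.cong[OF refl])
      fix i assume "i \<in> {..<n}"
      then have "n - i = Suc (n - Suc i)" by auto
      then show "of_bool (a i) * 3 ^ (n - i) = (3 * (of_bool (a i) * 3 ^ (n - Suc i)) :: int)" by simp
    qed
    then show ?thesis by (simp only: sum.lessThan_Suc) (simp add: add.commute)
  qed
  also have "\<dots> = of_bool (a n)" by simp
  finally show "\<lfloor>3 ^ Suc n * x\<rfloor> mod 3 = of_bool (a n)" .
qed

text \<open>A point is coded by the bits telling which points of a dense sequence are within
  \<open>1/2^k\<close> of it, and these bits become ternary digits of a real. To decode, the first
  admissible dense point is taken on each scale, and these points converge. The pair
  \<open>f\<close>, \<open>g\<close> transfers questions about laws on a Polish space to the unit
  interval.\<close>

lemma polish_embedding_real: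
  obtains f :: "'a::polish_space \<Rightarrow> real" and g :: "real \<Rightarrow> 'a"
  where "f \<in> borel_measurable borel" "g \<in> borel_measurable borel" "\<And>x. g (f x) = x"
    "\<And>x. 0 \<le> f x" "\<And>x. f x < 1"
proof -
  obtain d :: "nat \<Rightarrow> 'a" where d: "\<And>x r. r > 0 \<Longrightarrow> \<exists>i. dist (d i) x < r"
    using dense_sequence by blast
  define b where "b x n = (case prod_decode n of (k, i) \<Rightarrow> dist (d i) x < 1/2^k)" for x :: 'a and n
  define f where "f x = (\<Sum>n. of_bool (b x n) / 3 ^ Suc n :: real)" for x
  define dig where "dig n r \<longleftrightarrow> \<lfloor>3 ^ Suc n * r\<rfloor> mod 3 = 1" for n and r :: real
  have dig: "dig n (f x) \<longleftrightarrow> b x n" for n x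
    unfolding dig_def f_def ternary_digits(3) by auto
  define c where "c k r = d (LEAST i. dig (prod_encode (k, i)) r)" for k r
  have c: "dist (c k (f x)) x < 1/2^k" for k x
  proof -
    have "\<exists>i. dig (prod_encode (k, i)) (f x)" using d[of "1/2^k" x] by (simp add: dig b_def)
    then have "dig (prod_encode (k, LEAST i. dig (prod_encode (k, i)) (f x))) (f x)" by (rule LeastI_ex)
    then show ?thesis unfolding c_def by (simp add: dig b_def)
  qed
  have lim: "(\<lambda>k. c k (f x)) \<longlonglongrightarrow> x" for x
  proof -
    have "(\<lambda>k. dist (c k (f x)) x) \<longlonglongrightarrow> 0"
    proof (rule Lim_null_comparison)
      show "\<forall>\<^sub>F k in sequentially. norm (dist (c k (f x)) x) \<le> (1/2)^k"
        using c[of _ x] by (intro always_eventually allI) (simp add: power_divide less_imp_le)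
      show "(\<lambda>n. (1/2::real)^n) \<longlonglongrightarrow> 0" by (intro LIMSEQ_realpow_zero) auto
    qed
    then show ?thesis by (simp add: tendsto_dist_iff[of "\<lambda>k. c k (f x)"])
  qed
  have mdig[measurable]: "Measurable.pred borel (dig n)" for n
  proof -
    have "(\<lambda>r::real. \<lfloor>3 ^ Suc n * r\<rfloor>) \<in> measurable borel (count_space UNIV)" by measurable
    then have "Measurable.pred borel (\<lambda>r::real. \<lfloor>3 ^ Suc n * r\<rfloor> \<in> {i. i mod 3 = 1})"
      by (rule pred_sets1[rotated]) simp
    then show ?thesis by (simp add: dig_def[abs_def])
  qed
  have mc[measurable]: "c k \<in> borel_measurable borel" for k
  proof -
    have "(\<lambda>r. LEAST i. dig (prod_encode (k, i)) r) \<in> measurable borel (count_space UNIV)" by measurable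
    then show ?thesis unfolding c_def[abs_def] by (rule measurable_compose) simp
  qed
  \<comment> \<open>Off the Borel set where the decoded points converge, a constant is used, so that
    \<open>g\<close> is total and Borel.\<close>
  define S where "S = {r\<in>space borel. Cauchy (\<lambda>k. c k r)}"
  have [measurable]: "S \<in> sets borel" unfolding S_def by measurable
  define g where "g r = (if r \<in> S then lim (\<lambda>k. c k r) else d 0)" for r
  show thesis
  proof (rule that[of f g])
    have "(\<lambda>x. of_bool (b x n) / 3 ^ Suc n :: real) \<in> borel_measurable borel" for n
    proof -
      have "open {x. b x n}"
        unfolding b_def by (cases "prod_decode n") (auto intro!: open_Collect_less continuous_intros)
      then have "indicat_real {x. b x n} \<in> borel_measurable borel" by simp
      moreover have "(\<lambda>x. of_bool (b x n) / 3 ^ Suc n :: real) = (\<lambda>x. indicator {x. b x n} x / 3 ^ Suc n)"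
        by (auto simp: indicator_def)
      ultimately show ?thesis by (simp only: borel_measurable_divide borel_measurable_const)
    qed
    then show "f \<in> borel_measurable borel"
      unfolding f_def[abs_def] by (rule borel_measurable_suminf)
    show "g \<in> borel_measurable borel"
    proof (rule borel_measurable_LIMSEQ_metric[of "\<lambda>k r. if r \<in> S then c k r else d 0"])
      show "(\<lambda>r. if r \<in> S then c k r else d 0) \<in> borel_measurable borel" for k by measurable
      show "(\<lambda>k. if r \<in> S then c k r else d 0) \<longlonglongrightarrow> g r" for r
        using Cauchy_convergent_iff[of "\<lambda>k. c k r"] convergent_LIMSEQ_iff[of "\<lambda>k. c k r"]
        by (auto simp: g_def S_def)
    qed
    show "g (f x) = x" for x
      using limI[OF lim[of x]] LIMSEQ_imp_Cauchy[OF lim[of x]] by (simp add: g_def S_def)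
    show "0 \<le> f x" "f x < 1" for x unfolding f_def by (rule ternary_digits)+
  qed
qed

section \<open>Laws on the real line through rational half-lines\<close>

lemma borel_real_eq_sigma_rat: "borel = sigma UNIV (range (\<lambda>r::rat. {..real_of_rat r}))"
proof (rule borel_eq_sigmaI1[OF borel_eq_atMost])
  fix x :: "real set" assume "x \<in> range (\<lambda>a. {..a})"
  then obtain a where x: "x = {..a}" by auto
  have "{..a} = (\<Inter>r\<in>{r. a < real_of_rat r}. {..real_of_rat r})"
  proof (intro set_eqI iffI)
    fix y assume y: "y \<in> (\<Inter>r\<in>{r. a < real_of_rat r}. {..real_of_rat r})"
    show "y \<in> {..a}"
    proof (rule ccontr)
      assume "y \<notin> {..a}"
      then obtain r where "a < real_of_rat r" "real_of_rat r < y" using of_rat_dense[of a y] by auto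
      then show False using y by force
    qed
  qed auto
  also have "\<dots> \<in> sets (sigma UNIV (range (\<lambda>r::rat. {..real_of_rat r})))"
  proof (rule sets.countable_INT')
    obtain r where "a < real_of_rat r" using of_rat_dense[of a "a + 1"] by auto
    then show "{r. a < real_of_rat r} \<noteq> {}" by blast
  qed auto
  finally show "x \<in> sets (sigma UNIV (range (\<lambda>r::rat. {..real_of_rat r})))" by (simp add: x)
qed auto

text \<open>The generator is countable, so equality of laws becomes countably many equations. This
  matters where each equation holds only almost everywhere or has to be measurable in a
  parameter.\<close>

lemma real_measure_eqI_rat:
  fixes M N :: "real measure"
  assumes "finite_measure M" "sets M = sets borel" "sets N = sets borel"
    and eq: "\<And>r::rat. emeasure M {..real_of_rat r} = emeasure N {..real_of_rat r}"
  shows "M = N"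
proof (rule measure_eqI_generator_eq[where E="range (\<lambda>r::rat. {..real_of_rat r})" and A="\<lambda>n. {..real_of_rat (of_nat n)}" and \<Omega>=UNIV])
  show "Int_stable (range (\<lambda>r::rat. {..real_of_rat r}))"
    unfolding Int_stable_def
  proof safe
    fix r s :: rat
    have "{..real_of_rat r} \<inter> {..real_of_rat s} = {..real_of_rat (min r s)}"
      by (auto simp: min_def of_rat_less_eq)
    then show "{..real_of_rat r} \<inter> {..real_of_rat s} \<in> range (\<lambda>r. {..real_of_rat r})" by blast
  qed
  have "sets borel = sigma_sets UNIV (range (\<lambda>r::rat. {..real_of_rat r}))"
    by (subst borel_real_eq_sigma_rat) simp
  then show "sets M = sigma_sets UNIV (range (\<lambda>r::rat. {..real_of_rat r}))"
    "sets N = sigma_sets UNIV (range (\<lambda>r::rat. {..real_of_rat r}))" using assms by auto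
  show "(\<Union>i. {..real_of_rat (of_nat i)}) = UNIV" using real_arch_simple by auto
  show "emeasure M {..real_of_rat (of_nat i)} \<noteq> \<infinity>" for i
    using finite_measure.emeasure_finite[OF assms(1)] by simp
  show "range (\<lambda>n. {..real_of_rat (of_nat n)}) \<subseteq> range (\<lambda>r::rat. {..real_of_rat r})" by blast
qed (use eq in auto)


text \<open>The quantile function of a distribution function known on the rationals. Clipping and
  the default value 1 keep the infimum bounded for arbitrary \<open>e\<close>, so that every
  sequence, sensible or not, codes a law.\<close>

definition rquant :: "(rat \<Rightarrow> real) \<Rightarrow> real \<Rightarrow> real" where
  "rquant e \<omega> = (INF r. if \<omega> \<le> e r then max 0 (min 1 (real_of_rat r)) else 1)"

text \<open>Inverse transform sampling: the law of the quantile function at a uniform random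
  point.\<close>

definition rcode :: "(rat \<Rightarrow> real) \<Rightarrow> real measure" where
  "rcode e = distr (uniform_measure lborel {0<..<1}) borel (rquant e)"

lemma measurable_rquant: "(\<lambda>(e, \<omega>). rquant e \<omega>) \<in> borel_measurable (borel \<Otimes>\<^sub>M borel)"
proof -
  have "(\<lambda>x::(rat \<Rightarrow> real) \<times> real. fst x r) \<in> borel_measurable (borel \<Otimes>\<^sub>M borel)" for r
    by (rule measurable_compose[OF measurable_fst measurable_product_coordinates])
  then show ?thesis
    unfolding rquant_def[abs_def] split_beta'
    by (intro borel_measurable_cINF_real) auto
qed

lemma prob_space_unit_interval: "prob_space (uniform_measure lborel {0<..<1::real})"
  by (rule prob_space_uniform_measure) auto

lemma measurable_rcode: "rcode \<in> measurable borel (prob_algebra borel)"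
  unfolding rcode_def[abs_def]
proof (rule measurable_distr_prob_space2[where M=borel])
  show "(\<lambda>x. uniform_measure lborel {0<..<1::real}) \<in> borel \<rightarrow>\<^sub>M prob_algebra borel"
    by (rule measurable_const) (simp add: space_prob_algebra prob_space_unit_interval)
qed (rule measurable_rquant)

text \<open>The assumptions say that \<open>e\<close> is a distribution function on the rationals,
  concentrated on the unit interval. Then \<open>rquant e \<omega> \<le> r\<close> is equivalent to
  \<open>\<omega> \<le> e r\<close>, an event of uniform probability \<open>e r\<close>.\<close>

lemma emeasure_rcode:
  assumes mono: "\<And>r s. r \<le> s \<Longrightarrow> e r \<le> e s"
    and e0: "\<And>r. r < 0 \<Longrightarrow> e r = 0" and e1: "\<And>r. 1 \<le> r \<Longrightarrow> e r = 1"
    and rc: "\<And>r \<epsilon>. 0 < \<epsilon> \<Longrightarrow> \<exists>s>r. e s < e r + \<epsilon>"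
  shows "emeasure (rcode e) {..real_of_rat r} = ennreal (e r)"
proof -
  have e01: "0 \<le> e r" "e r \<le> 1"
    using mono[of "min r (-1)" r] mono[of r "max r 1"] by (simp_all add: e0 e1)
  have bdd: "bdd_below (range (\<lambda>r. if \<omega> \<le> e r then max 0 (min 1 (real_of_rat r)) else 1))" for \<omega>
    by (rule bdd_belowI[of _ 0]) auto
  have *: "rquant e \<omega> \<le> real_of_rat r \<longleftrightarrow> \<omega> \<le> e r" if \<omega>: "0 < \<omega>" "\<omega> < 1" for \<omega>
  proof
    assume le: "\<omega> \<le> e r"
    then have "0 \<le> r" using e0[of r] \<omega> by (cases "r < 0") auto
    have "rquant e \<omega> \<le> (if \<omega> \<le> e r then max 0 (min 1 (real_of_rat r)) else 1)"
      unfolding rquant_def by (rule cINF_lower[OF bdd]) simp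
    also have "\<dots> \<le> real_of_rat r" using le \<open>0 \<le> r\<close> by simp
    finally show "rquant e \<omega> \<le> real_of_rat r" .
  next
    assume le: "rquant e \<omega> \<le> real_of_rat r"
    show "\<omega> \<le> e r"
    proof (rule ccontr)
      assume "\<not> \<omega> \<le> e r"
      \<comment> \<open>Right continuity leaves a gap to the right of \<open>r\<close> in which
        \<open>e\<close> is still below \<open>\<omega>\<close>. The gap is cut at 1 because the
        values entering the infimum are clipped there.\<close>
      then obtain s where s: "r < s" "e s < \<omega>" using rc[of "\<omega> - e r" r] by auto
      have r1: "r < 1" using \<open>\<not> \<omega> \<le> e r\<close> e1[of r] \<omega> by (cases "1 \<le> r") auto
      define u where "u = min s 1"
      have u: "r < u" "u \<le> 1" "e u < \<omega>" using s r1 mono[of u s] by (auto simp: u_def)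
      have "real_of_rat u \<le> (if \<omega> \<le> e t then max 0 (min 1 (real_of_rat t)) else 1)" for t
      proof (cases "\<omega> \<le> e t")
        case True
        then have "u \<le> t" using mono[of t u] u by (cases "t \<le> u") auto
        then have "real_of_rat u \<le> real_of_rat t" by (simp add: of_rat_less_eq)
        moreover have "real_of_rat u \<le> 1" using u by simp
        ultimately have "real_of_rat u \<le> max 0 (min 1 (real_of_rat t))"
          by (intro max.coboundedI2 min.boundedI)
        then show ?thesis using True by simp
      next
        case False then show ?thesis using u by (simp add: of_rat_le_1_iff)
      qed
      then have "real_of_rat u \<le> rquant e \<omega>" unfolding rquant_def by (intro cINF_greatest) auto
      moreover have "real_of_rat r < real_of_rat u" using u by (simp add: of_rat_less)
      ultimately show False using le by linarith
    qed
  qed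
  have m: "rquant e \<in> borel_measurable borel"
    using measurable_compose[OF measurable_Pair1' measurable_rquant, of e] by simp
  have "emeasure (rcode e) {..real_of_rat r} = emeasure (uniform_measure lborel {0<..<1}) (rquant e -` {..real_of_rat r})"
    unfolding rcode_def using m by (subst emeasure_distr) auto
  also have "\<dots> = emeasure lborel ({0<..<1} \<inter> rquant e -` {..real_of_rat r})"
    using measurable_sets[OF m, of "{..real_of_rat r}"] by (subst emeasure_uniform_measure) (auto simp: divide_ennreal_def)
  also have "{0<..<1} \<inter> rquant e -` {..real_of_rat r} = {0<..<1} \<inter> {..e r}" using * by auto
  also have "emeasure lborel ({0<..<1} \<inter> {..e r}) = ennreal (e r)"
  proof (cases "e r = 1")
    case True
    then have "{0<..<1} \<inter> {..e r} = {0<..<1}" by auto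
    then show ?thesis using True by simp
  next
    case False
    then have "{0<..<1} \<inter> {..e r} = {0<..e r}" using e01 by auto
    then show ?thesis using e01 by simp
  qed
  finally show ?thesis .
qed

lemma rcode_cdf:
  fixes \<nu> :: "real measure"
  assumes \<nu>: "\<nu> \<in> space (prob_algebra borel)" and supp: "measure \<nu> {0..<1} = 1"
  shows "rcode (\<lambda>r. measure \<nu> {..real_of_rat r}) = \<nu>"
proof -
  have p: "prob_space \<nu>" "sets \<nu> = sets borel" using \<nu> by (auto simp: space_prob_algebra)
  interpret prob_space \<nu> by fact
  have sp: "space \<nu> = UNIV" using p(2) sets_eq_imp_space_eq[of \<nu> borel] by simp
  have [simp]: "A \<in> sets borel \<Longrightarrow> A \<in> sets \<nu>" for A using p by simp
  show ?thesis
  proof (rule real_measure_eqI_rat)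
    have R: "rcode e \<in> space (prob_algebra borel)" for e using measurable_space[OF measurable_rcode] by simp
    show "finite_measure (rcode e)" "sets (rcode e) = sets borel" for e
      using R[of e] by (auto simp: space_prob_algebra prob_space_def)
    show "sets \<nu> = sets borel" by fact
    fix r
    have "emeasure (rcode (\<lambda>r. measure \<nu> {..real_of_rat r})) {..real_of_rat r} = ennreal (measure \<nu> {..real_of_rat r})"
    proof (rule emeasure_rcode)
      show "measure \<nu> {..real_of_rat r} \<le> measure \<nu> {..real_of_rat s}" if "r \<le> s" for r s
        using that by (intro finite_measure_mono) (auto simp: of_rat_less_eq intro: order_trans)
      show "measure \<nu> {..real_of_rat r} = 0" if "r < 0" for r
      proof -
        have "measure \<nu> {..real_of_rat r} \<le> measure \<nu> (space \<nu> - {0..<1})"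
        proof (intro finite_measure_mono)
          have r: "real_of_rat r < 0" using that by simp
          have "x < 0" if "x \<le> real_of_rat r" for x using that r by (rule le_less_trans)
          then show "{..real_of_rat r} \<subseteq> space \<nu> - {0..<1}" unfolding sp by fastforce
        qed (rule sets.compl_sets, simp)
        also have "\<dots> = 0" using supp by (subst prob_compl) auto
        finally show ?thesis using measure_nonneg[of \<nu>] by (simp add: antisym)
      qed
      show "measure \<nu> {..real_of_rat r} = 1" if "1 \<le> r" for r
      proof -
        have r: "1 \<le> real_of_rat r" using that by simp
        have "x \<le> real_of_rat r" if "x < 1" for x using order_trans[OF less_imp_le[OF that] r] .
        then have "measure \<nu> {0..<1} \<le> measure \<nu> {..real_of_rat r}"
          by (intro finite_measure_mono) auto
        then show ?thesis using supp prob_le_1[of "{..real_of_rat r}"] by simp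
      qed
      fix r :: rat and \<epsilon> :: real assume \<epsilon>: "0 < \<epsilon>"
      have "(\<lambda>n. measure \<nu> {..real_of_rat (r + 1 / of_nat (Suc n))}) \<longlonglongrightarrow> measure \<nu> (\<Inter>n. {..real_of_rat (r + 1 / of_nat (Suc n))})"
      proof (rule finite_Lim_measure_decseq)
        show "decseq (\<lambda>n. {..real_of_rat (r + 1 / of_nat (Suc n))})"
          by (auto simp: decseq_def of_rat_less_eq field_simps intro: order_trans)
      qed auto
      also have "(\<Inter>n. {..real_of_rat (r + 1 / of_nat (Suc n))}) = {..real_of_rat r}"
      proof (intro set_eqI iffI)
        fix x assume x: "x \<in> (\<Inter>n. {..real_of_rat (r + 1 / of_nat (Suc n))})"
        show "x \<in> {..real_of_rat r}"
        proof (rule ccontr)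
          assume "x \<notin> {..real_of_rat r}"
          then obtain n where "inverse (real (Suc n)) < x - real_of_rat r"
            using reals_Archimedean[of "x - real_of_rat r"] by auto
          moreover have "x \<le> real_of_rat r + inverse (real (Suc n))"
            using x by (auto simp: of_rat_add of_rat_divide inverse_eq_divide dest!: spec[of _ n])
          ultimately show False by linarith
        qed
      next
        fix x assume "x \<in> {..real_of_rat r}"
        then show "x \<in> (\<Inter>n. {..real_of_rat (r + 1 / of_nat (Suc n))})"
          by (auto simp: of_rat_add of_rat_divide intro: order_trans)
      qed
      finally have "\<forall>\<^sub>F n in sequentially. measure \<nu> {..real_of_rat (r + 1 / of_nat (Suc n))} < measure \<nu> {..real_of_rat r} + \<epsilon>"
        using \<epsilon> by (intro order_tendstoD) auto
      then obtain n where "measure \<nu> {..real_of_rat (r + 1 / of_nat (Suc n))} < measure \<nu> {..real_of_rat r} + \<epsilon>"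
        using eventually_happens by fastforce
      moreover have "r < r + 1 / of_nat (Suc n)" by simp
      ultimately show "\<exists>s>r. measure \<nu> {..real_of_rat s} < measure \<nu> {..real_of_rat r} + \<epsilon>" by blast
    qed
    then show "emeasure (rcode (\<lambda>r. measure \<nu> {..real_of_rat r})) {..real_of_rat r} = emeasure \<nu> {..real_of_rat r}"
      by (simp add: emeasure_eq_measure)
  qed
qed

text \<open>A Borel parametrisation, onto all probability laws, by the Polish space of real
  sequences. Selecting a law thereby becomes selecting a point.\<close>

lemma polish_prob_code:
  obtains enc :: "(rat \<Rightarrow> real) \<Rightarrow> 'a::polish_space measure"
  where "enc \<in> measurable borel (prob_algebra borel)"
    "\<And>\<nu>. \<nu> \<in> space (prob_algebra borel) \<Longrightarrow> \<exists>e. enc e = \<nu>"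
proof -
  obtain f :: "'a \<Rightarrow> real" and g where fg: "f \<in> borel_measurable borel" "g \<in> borel_measurable borel"
    "\<And>x. g (f x) = x" "\<And>x. 0 \<le> f x" "\<And>x. f x < 1"
    using polish_embedding_real by blast
  show thesis
  proof (rule that[of "\<lambda>e. distr (rcode e) borel g"])
    show "(\<lambda>e. distr (rcode e) borel g) \<in> borel \<rightarrow>\<^sub>M prob_algebra borel"
      by (rule measurable_compose[OF measurable_rcode measurable_distr_prob_space[OF fg(2)]])
    fix \<nu> :: "'a measure" assume \<nu>: "\<nu> \<in> space (prob_algebra borel)"
    then have p: "prob_space \<nu>" "sets \<nu> = sets borel" by (auto simp: space_prob_algebra)
    have sp: "space \<nu> = UNIV" using p(2) sets_eq_imp_space_eq[of \<nu> borel] by simp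
    interpret prob_space \<nu> by fact
    have f\<nu>: "f \<in> borel_measurable \<nu>" using fg(1) p(2) by (simp cong: measurable_cong_sets)
    have D: "distr \<nu> borel f \<in> space (prob_algebra borel)"
      using prob_space_distr[OF f\<nu>] by (simp add: space_prob_algebra)
    have "f -` {0..<1} \<inter> space \<nu> = space \<nu>" using fg(4,5) by auto
    then have "measure (distr \<nu> borel f) {0..<1} = 1"
      using f\<nu> prob_space by (subst measure_distr) auto
    then have "rcode (\<lambda>r. measure (distr \<nu> borel f) {..real_of_rat r}) = distr \<nu> borel f"
      by (rule rcode_cdf[OF D])
    moreover have "distr (distr \<nu> borel f) borel g = \<nu>"
    proof -
      have "distr (distr \<nu> borel f) borel g = distr \<nu> borel (\<lambda>x. x)"
        using fg f\<nu> by (subst distr_distr) (auto simp: o_def)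
      also have "\<dots> = distr \<nu> \<nu> (\<lambda>x. x)" using p(2) by (intro distr_cong) auto
      finally show ?thesis by simp
    qed
    ultimately show "\<exists>e. distr (rcode e) borel g = \<nu>" by metis
  qed
qed

section \<open>Disintegration of kernels\<close>

text \<open>The dyadic conditional expectations are an \<open>L\<^sup>2\<close>-bounded martingale; a subsequence chosen
  measurably in the parameter converges almost everywhere for every parameter.\<close>

lemma kernel_density:
  fixes W :: "'t \<Rightarrow> ('x::topological_space \<times> 'y::polish_space) measure" and A :: "'x set"
  assumes W: "W \<in> measurable \<Theta> (prob_algebra (borel \<Otimes>\<^sub>M borel))" and A: "A \<in> sets borel"
  obtains E :: "'t \<Rightarrow> 'y \<Rightarrow> real"
  where "(\<lambda>(\<theta>, y). E \<theta> y) \<in> borel_measurable (\<Theta> \<Otimes>\<^sub>M borel)" "\<And>\<theta> y. 0 \<le> E \<theta> y" "\<And>\<theta> y. E \<theta> y \<le> 1"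
    "\<And>\<theta> B. \<theta> \<in> space \<Theta> \<Longrightarrow> B \<in> sets borel \<Longrightarrow>
      measure (W \<theta>) (A \<times> B) = (\<integral>y. E \<theta> y * indicator B y \<partial>distr (W \<theta>) borel snd)"
proof -
  obtain \<phi> :: "'y \<Rightarrow> real" and \<psi> where \<phi>: "\<phi> \<in> borel_measurable borel" "\<psi> \<in> borel_measurable borel"
    "\<And>y. \<psi> (\<phi> y) = y" "\<And>y. 0 \<le> \<phi> y" "\<And>y. \<phi> y < 1"
    using polish_embedding_real by blast
  note [measurable] = \<phi>(1)
  \<comment> \<open>The index of the dyadic interval of length \<open>1/2^n\<close> that contains
    \<open>\<phi> y\<close>; the cells of this index generate the filtration of the
    martingale.\<close>
  define c where "c n y = nat \<lfloor>2^n * \<phi> y\<rfloor>" for n y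
  have c_meas[measurable]: "c n \<in> measurable borel (count_space UNIV)" for n
    unfolding c_def by measurable
  have c_lt: "c n y < 2^n" for n y
  proof -
    have "2^n * \<phi> y < 2^n" using \<phi>(5)[of y] by simp
    then have "\<lfloor>2^n * \<phi> y\<rfloor> < 2^n" by (simp add: floor_less_iff)
    then show ?thesis unfolding c_def using \<phi>(4)[of y] by (simp add: nat_less_iff)
  qed
  have c_le: "real (c n y) \<le> 2^n * \<phi> y" "2^n * \<phi> y < real (c n y) + 1" for n y
    unfolding c_def using \<phi>(4)[of y] by (simp_all add: of_nat_nat)
  have c_div: "c n y = c m y div 2^(m - n)" if "n \<le> m" for n m y
  proof -
    have "\<lfloor>2^n * \<phi> y\<rfloor> = \<lfloor>(2^m * \<phi> y) / real_of_int (2^(m-n))\<rfloor>"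
      using that by (simp only: of_int_power of_int_numeral) (simp add: power_diff mult.commute)
    also have "\<dots> = \<lfloor>2^m * \<phi> y\<rfloor> div 2^(m-n)" by (rule floor_divide_real_eq_div) simp
    finally show ?thesis unfolding c_def
      by (simp add: nat_div_distrib \<phi>(4) nat_power_eq)
  qed
  define b where "b \<theta> n j = measure (W \<theta>) (UNIV \<times> (c n -` {j}))" for \<theta> n j
  define a where "a \<theta> n j = measure (W \<theta>) (A \<times> (c n -` {j}))" for \<theta> n j
  have cs[measurable]: "c n -` {j} \<in> sets borel" for n j
    using measurable_sets[OF c_meas[of n], of "{j}"] by simp
  have ab_meas[measurable]: "(\<lambda>\<theta>. b \<theta> n j) \<in> borel_measurable \<Theta>" "(\<lambda>\<theta>. a \<theta> n j) \<in> borel_measurable \<Theta>" for n j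
    unfolding a_def b_def using A
    by (auto intro!: measurable_compose[OF W measurable_measure_prob_algebra])
  \<comment> \<open>The conditional probability of \<open>A\<close> given the cell of level
    \<open>n\<close>. On cells of mass zero the quotient is 0, and there \<open>a\<close> vanishes
    together with \<open>b\<close>.\<close>
  define h where "h n \<theta> y = a \<theta> n (c n y) / b \<theta> n (c n y)" for n \<theta> y
  \<comment> \<open>The squared L2 norm of \<open>h n\<close>, written as a finite sum so that it is
    visibly measurable in the parameter.\<close>
  define s where "s \<theta> n = (\<Sum>j<2^n. (a \<theta> n j)\<^sup>2 / b \<theta> n j)" for \<theta> n
  have s_meas[measurable]: "(\<lambda>\<theta>. s \<theta> n) \<in> borel_measurable \<Theta>" for n
    unfolding s_def by measurable
  \<comment> \<open>The least level from which the squared norm grows by at most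
    \<open>16^(-k)\<close>. Consecutive chosen members then differ by at most \<open>4^(-k)\<close>
    in the mean, which is summable, and the least index is measurable in the parameter.\<close>
  define N where "N \<theta> k = (LEAST n. k \<le> n \<and> (\<forall>m. n \<le> m \<longrightarrow> s \<theta> m - s \<theta> n \<le> (1/16)^k))" for \<theta> k
  have N_meas: "(\<lambda>\<theta>. N \<theta> k) \<in> measurable \<Theta> (count_space UNIV)" for k
    unfolding N_def by measurable
  have h_meas: "(\<lambda>x. h n (fst x) (snd x)) \<in> borel_measurable (\<Theta> \<Otimes>\<^sub>M borel)" for n
  proof -
    have "(\<lambda>x. a (fst x) n j / b (fst x) n j) \<in> borel_measurable (\<Theta> \<Otimes>\<^sub>M borel)" for j
      by measurable
    moreover have "(\<lambda>x. c n (snd x)) \<in> measurable (\<Theta> \<Otimes>\<^sub>M borel) (count_space UNIV)" by measurable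
    ultimately show ?thesis unfolding h_def by (rule measurable_compose_countable)
  qed
  have H_meas: "(\<lambda>x. h (N (fst x) k) (fst x) (snd x)) \<in> borel_measurable (\<Theta> \<Otimes>\<^sub>M borel)" for k
    by (rule measurable_compose_countable[OF h_meas measurable_compose[OF measurable_fst N_meas]])
  \<comment> \<open>Clipping enforces the bounds also at points where the sequence does not
    converge; almost everywhere it changes nothing.\<close>
  define E where "E \<theta> y = max 0 (min 1 (lim (\<lambda>k. h (N \<theta> k) \<theta> y)))" for \<theta> y
  have E_meas: "(\<lambda>x. E (fst x) (snd x)) \<in> borel_measurable (\<Theta> \<Otimes>\<^sub>M borel)"
    unfolding E_def using H_meas by measurable
  have E01: "0 \<le> E \<theta> y" "E \<theta> y \<le> 1" for \<theta> y by (auto simp: E_def)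
  have main: "measure (W \<theta>) (A \<times> B) = (\<integral>y. E \<theta> y * indicator B y \<partial>distr (W \<theta>) borel snd)"
    if \<theta>: "\<theta> \<in> space \<Theta>" and B: "B \<in> sets borel" for \<theta> B
  proof -
    have pW: "prob_space (W \<theta>)" "sets (W \<theta>) = sets (borel \<Otimes>\<^sub>M borel)"
      using measurable_space[OF W \<theta>] by (auto simp: space_prob_algebra)
    interpret W: prob_space "W \<theta>" by fact
    have spW: "space (W \<theta>) = UNIV" using sets_eq_imp_space_eq[OF pW(2)] by (simp add: space_pair_measure)
    have snd_m: "snd \<in> measurable (W \<theta>) borel" using pW(2) by (simp cong: measurable_cong_sets)
    define P where "P = distr (W \<theta>) borel snd"
    interpret P: prob_space P unfolding P_def by (rule W.prob_space_distr[OF snd_m])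
    have setsP[measurable_cong]: "sets P = sets borel" by (simp add: P_def)
    have spP: "space P = UNIV" by (simp add: P_def)
    have measP: "measure P C = measure (W \<theta>) (UNIV \<times> C)" if "C \<in> sets borel" for C
    proof -
      have "snd -` C \<inter> space (W \<theta>) = UNIV \<times> C" by (auto simp: spW)
      then show ?thesis unfolding P_def using that snd_m by (simp add: measure_distr)
    qed
    have rect: "X \<times> Y \<in> sets (W \<theta>)" if "X \<in> sets borel" "Y \<in> sets borel" for X Y
      using that by (simp add: pW(2))
    let ?h = "\<lambda>n. h n \<theta>"
    have ab: "0 \<le> a \<theta> n j" "a \<theta> n j \<le> b \<theta> n j" for n j
      unfolding a_def b_def using A rect by (auto intro!: W.finite_measure_mono)
    have h01: "0 \<le> ?h n y" "?h n y \<le> 1" for n y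
      using ab[of n "c n y"] unfolding h_def by (auto simp: divide_le_eq_1)
    have hm[measurable]: "?h n \<in> borel_measurable P" for n
      using measurable_compose[OF measurable_Pair1'[OF \<theta>] h_meas[of n]] by (simp cong: measurable_cong_sets)
    have cP[measurable]: "c n \<in> measurable P (count_space UNIV)" for n
      using c_meas[of n] by (simp cong: measurable_cong_sets)
    have sum1: "G (c n y) = (\<Sum>j<2^n. G j * indicator (c n -` {j}) y)" for G :: "nat \<Rightarrow> real" and n y
    proof -
      have "(\<Sum>j<2^n. G j * indicator (c n -` {j}) y) = (\<Sum>j\<in>{c n y}. G j * indicator (c n -` {j}) y)"
        by (rule sum.mono_neutral_right) (auto simp: c_lt indicator_def)
      then show ?thesis by simp
    qed
    have fund: "(\<integral>y. G (c n y) \<partial>P) = (\<Sum>j<2^n. G j * b \<theta> n j)" for G :: "nat \<Rightarrow> real" and n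
    proof -
      have "(\<integral>y. G (c n y) \<partial>P) = (\<integral>y. (\<Sum>j<2^n. G j * indicator (c n -` {j}) y) \<partial>P)"
        using sum1[of G n] by simp
      also have "\<dots> = (\<Sum>j<2^n. (\<integral>y. G j * indicator (c n -` {j}) y \<partial>P))"
        by (rule Bochner_Integration.integral_sum) (auto simp: setsP P.emeasure_eq_measure)
      also have "\<dots> = (\<Sum>j<2^n. G j * b \<theta> n j)"
        by (intro sum.cong refl) (simp add: setsP spP measP b_def)
      finally show ?thesis .
    qed
    have fundA: "(\<integral>w. G (c n (snd w)) * indicator A (fst w) \<partial>W \<theta>) = (\<Sum>j<2^n. G j * a \<theta> n j)" for G :: "nat \<Rightarrow> real" and n
    proof -
      have "(\<integral>w. G (c n (snd w)) * indicator A (fst w) \<partial>W \<theta>) = (\<integral>w. (\<Sum>j<2^n. G j * indicator (A \<times> (c n -` {j})) w) \<partial>W \<theta>)"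
        by (intro Bochner_Integration.integral_cong refl) (subst sum1, simp add: sum_distrib_right indicator_times mult.assoc mult.commute[of "indicator A _"])
      also have "\<dots> = (\<Sum>j<2^n. (\<integral>w. G j * indicator (A \<times> (c n -` {j})) w \<partial>W \<theta>))"
        by (rule Bochner_Integration.integral_sum) (auto simp: rect A W.emeasure_eq_measure)
      also have "\<dots> = (\<Sum>j<2^n. G j * a \<theta> n j)"
        by (intro sum.cong refl) (simp add: rect A spW a_def)
      finally show ?thesis .
    qed
    \<comment> \<open>The martingale property: against a function of the coarser cell, every finer
      \<open>h m\<close> integrates like the indicator of \<open>A\<close>.\<close>
    have key: "(\<integral>y. G (c n y) * ?h m y \<partial>P) = (\<integral>w. G (c n (snd w)) * indicator A (fst w) \<partial>W \<theta>)"
      if "n \<le> m" for G :: "nat \<Rightarrow> real" and n m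
    proof -
      define G' where "G' j = G (j div 2^(m-n))" for j
      have "(\<integral>y. G (c n y) * ?h m y \<partial>P) = (\<integral>y. G' (c m y) * (a \<theta> m (c m y) / b \<theta> m (c m y)) \<partial>P)"
        using c_div[OF \<open>n \<le> m\<close>] by (simp add: G'_def h_def)
      also have "\<dots> = (\<Sum>j<2^m. (G' j * (a \<theta> m j / b \<theta> m j)) * b \<theta> m j)"
        by (rule fund)
      also have "\<dots> = (\<Sum>j<2^m. G' j * a \<theta> m j)"
      proof (rule sum.cong[OF refl])
        fix j
        show "(G' j * (a \<theta> m j / b \<theta> m j)) * b \<theta> m j = G' j * a \<theta> m j"
          using ab[of m j] by (cases "b \<theta> m j = 0") auto
      qed
      also have "\<dots> = (\<integral>w. G (c n (snd w)) * indicator A (fst w) \<partial>W \<theta>)"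
        unfolding fundA[symmetric] using c_div[OF \<open>n \<le> m\<close>] by (simp add: G'_def)
      finally show ?thesis .
    qed
    have int_h: "integrable P (\<lambda>y. ?h n y * ?h m y)" "integrable P (?h n)" for n m
      using h01 by (auto intro!: P.integrable_const_bound[where B=1] AE_I2 simp: abs_mult mult_le_one)
    have sint: "s \<theta> n = (\<integral>y. ?h n y * ?h m y \<partial>P)" if "n \<le> m" for n m
    proof -
      have "(\<integral>y. ?h n y * ?h m y \<partial>P) = (\<Sum>j<2^n. (a \<theta> n j / b \<theta> n j) * a \<theta> n j)"
        unfolding fundA[symmetric] using key[OF that, of "\<lambda>j. a \<theta> n j / b \<theta> n j"] by (simp only: h_def)
      then show ?thesis by (simp add: s_def power2_eq_square)
    qed
    \<comment> \<open>Orthogonality of martingale increments: the mixed term equals the squared norm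
      at the coarser level.\<close>
    have diff: "(\<integral>y. (?h m y - ?h n y)\<^sup>2 \<partial>P) = s \<theta> m - s \<theta> n" if "n \<le> m" for n m
    proof -
      have "(\<integral>y. (?h m y - ?h n y)\<^sup>2 \<partial>P) = (\<integral>y. ?h m y * ?h m y - 2 * (?h n y * ?h m y) + ?h n y * ?h n y \<partial>P)"
        by (simp add: power2_eq_square algebra_simps)
      also have "\<dots> = s \<theta> m - 2 * s \<theta> n + s \<theta> n"
        using int_h by (simp add: sint[OF that, symmetric] sint[of m m, OF order_refl, symmetric] sint[of n n, OF order_refl, symmetric])
      finally show ?thesis by simp
    qed
    have smono: "s \<theta> n \<le> s \<theta> m" if "n \<le> m" for n m
      using diff[OF that] integral_nonneg_AE[of "\<lambda>y. (?h m y - ?h n y)\<^sup>2" P] by simp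
    have sbound: "s \<theta> n \<le> 1" for n
    proof -
      have "s \<theta> n \<le> (\<integral>y. 1 \<partial>P)"
        unfolding sint[of n n, OF order_refl] using h01 int_h by (intro integral_mono) (auto simp: mult_le_one)
      then show ?thesis by (simp add: P.prob_space)
    qed
    have Nex: "\<exists>n\<ge>k. \<forall>m\<ge>n. s \<theta> m - s \<theta> n \<le> (1/16)^k" for k
    proof -
      have "incseq (s \<theta>)" using smono by (auto simp: incseq_def)
      then obtain l where l: "s \<theta> \<longlonglongrightarrow> l" "\<And>i. s \<theta> i \<le> l" using incseq_convergent[of "s \<theta>" 1] sbound by blast
      have "\<forall>\<^sub>F n in sequentially. l - (1/16)^k < s \<theta> n" using l(1) by (rule order_tendstoD) simp
      then obtain n0 where n0: "\<And>n. n \<ge> n0 \<Longrightarrow> l - (1/16)^k < s \<theta> n" by (auto simp: eventually_sequentially)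
      have "s \<theta> m - s \<theta> (max n0 k) \<le> (1/16)^k" for m
        using n0[of "max n0 k"] l(2)[of m] by simp
      then show ?thesis by (intro exI[of _ "max n0 k"]) auto
    qed
    have Np: "k \<le> N \<theta> k" "N \<theta> k \<le> m \<Longrightarrow> s \<theta> m - s \<theta> (N \<theta> k) \<le> (1/16)^k" for k m
      using LeastI_ex[OF Nex[of k]] unfolding N_def by blast+
    have Nmono: "N \<theta> k \<le> N \<theta> (Suc k)" for k
    proof -
      have "s \<theta> m - s \<theta> (N \<theta> (Suc k)) \<le> (1/16)^k" if "N \<theta> (Suc k) \<le> m" for m
        using Np(2)[OF that] by (rule order_trans) (simp add: power_decreasing)
      then show ?thesis using Np(1)[of "Suc k"] unfolding N_def[of \<theta> k] by (intro Least_le) auto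
    qed
    define H where "H k = ?h (N \<theta> k)" for k
    have Hm[measurable]: "H k \<in> borel_measurable P" for k by (simp add: H_def)
    have H01: "0 \<le> H k y" "H k y \<le> 1" for k y using h01 by (auto simp: H_def)
    have Hdiff: "(\<integral>\<^sup>+y. ennreal \<bar>H (Suc k) y - H k y\<bar> \<partial>P) \<le> ennreal ((1/4)^k)" for k
    proof -
      have int2: "integrable P (\<lambda>y. (H (Suc k) y - H k y)\<^sup>2)"
        by (rule P.integrable_const_bound[where B=1]) (use H01 in \<open>auto intro!: AE_I2 simp: abs_square_le_1 abs_le_iff diff_le_eq intro: order_trans[of _ 1] add_increasing2\<close>)
      \<comment> \<open>The mean is bounded through the second moment by
        \<open>2 * x \<le> 4^k * x^2 + (1/4)^k\<close>; the weight balances the growth bound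
        \<open>(1/16)^k\<close>, and both terms become \<open>(1/4)^k\<close>.\<close>
      have "(\<integral>\<^sup>+y. ennreal \<bar>H (Suc k) y - H k y\<bar> \<partial>P) \<le> (\<integral>\<^sup>+y. ennreal ((4^k * (H (Suc k) y - H k y)\<^sup>2 + (1/4)^k) / 2) \<partial>P)"
      proof (intro nn_integral_mono ennreal_leI)
        fix y
        define x where "x = \<bar>H (Suc k) y - H k y\<bar>"
        have "0 \<le> (2^k * x - (1/2)^k)\<^sup>2" by simp
        also have "\<dots> = (2^k * 2^k) * x\<^sup>2 - 2 * ((2^k * (1/2)^k) * x) + (1/2)^k * (1/2)^k"
          by (simp add: power2_eq_square algebra_simps)
        also have "2^k * 2^k = (4::real)^k" by (simp flip: power_mult_distrib)
        also have "2^k * (1/2)^k = (1::real)" by (simp flip: power_mult_distrib)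
        also have "(1/2)^k * (1/2)^k = (1/4::real)^k" by (simp flip: power_mult_distrib)
        finally have "2 * x \<le> 4^k * x\<^sup>2 + (1/4)^k" by simp
        then show "\<bar>H (Suc k) y - H k y\<bar> \<le> (4^k * (H (Suc k) y - H k y)\<^sup>2 + (1/4)^k) / 2"
          by (simp add: x_def)
      qed
      also have "\<dots> = ennreal (\<integral>y. (4^k * (H (Suc k) y - H k y)\<^sup>2 + (1/4)^k) / 2 \<partial>P)"
        using int2 by (intro nn_integral_eq_integral) auto
      also have "(\<integral>y. (4^k * (H (Suc k) y - H k y)\<^sup>2 + (1/4)^k) / 2 \<partial>P) = (4^k * (s \<theta> (N \<theta> (Suc k)) - s \<theta> (N \<theta> k)) + (1/4)^k) / 2"
        using int2 diff[OF Nmono[of k]] by (simp add: P.prob_space H_def)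
      also have "\<dots> \<le> (4^k * (1/16)^k + (1/4)^k) / 2"
        using Np(2)[OF Nmono[of k]] by (intro divide_right_mono add_right_mono mult_left_mono) auto
      also have "(4::real)^k * (1/16)^k = (1/4)^k" by (simp flip: power_mult_distrib)
      finally show ?thesis by (simp add: ennreal_leI)
    qed
    have "(\<integral>\<^sup>+y. (\<Sum>k. ennreal \<bar>H (Suc k) y - H k y\<bar>) \<partial>P) = (\<Sum>k. \<integral>\<^sup>+y. ennreal \<bar>H (Suc k) y - H k y\<bar> \<partial>P)"
      by (rule nn_integral_suminf) simp
    also have "\<dots> \<le> (\<Sum>k. ennreal ((1/4)^k))" by (intro suminf_le Hdiff summableI)
    also have "\<dots> = ennreal (\<Sum>k. (1/4)^k)" by (rule suminf_ennreal2) (auto intro: summable_geometric)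
    also have "\<dots> < \<infinity>" by simp
    finally have "AE y in P. (\<Sum>k. ennreal \<bar>H (Suc k) y - H k y\<bar>) \<noteq> \<infinity>"
      by (intro nn_integral_noteq_infinite) auto
    then have conv: "AE y in P. (\<lambda>k. H k y) \<longlonglongrightarrow> E \<theta> y"
    proof eventually_elim
      case (elim y)
      then have "summable (\<lambda>k. \<bar>H (Suc k) y - H k y\<bar>)" by (intro summable_suminf_not_top) auto
      then have "summable (\<lambda>k. H (Suc k) y - H k y)" by (rule summable_rabs_cancel)
      then have "convergent (\<lambda>n. \<Sum>k<n. H (Suc k) y - H k y)" by (simp add: summable_iff_convergent)
      then have "convergent (\<lambda>n. H n y - H 0 y)" by (simp only: sum_lessThan_telescope[of "\<lambda>k. H k y"])
      from convergent_add[OF this convergent_const[of "H 0 y"]] have "convergent (\<lambda>k. H k y)" by simp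
      then have l: "(\<lambda>k. H k y) \<longlonglongrightarrow> lim (\<lambda>k. H k y)" by (simp add: convergent_LIMSEQ_iff)
      have "0 \<le> lim (\<lambda>k. H k y)" "lim (\<lambda>k. H k y) \<le> 1"
        using l H01 by (auto intro: LIMSEQ_le_const LIMSEQ_le_const2)
      then have "E \<theta> y = lim (\<lambda>k. H k y)" by (simp add: E_def H_def)
      then show ?case using l by simp
    qed
    have Em[measurable]: "E \<theta> \<in> borel_measurable P"
      using measurable_compose[OF measurable_Pair1'[OF \<theta>] E_meas] by (simp cong: measurable_cong_sets)
    have keyE: "(\<integral>y. G (c n y) * E \<theta> y \<partial>P) = (\<integral>w. G (c n (snd w)) * indicator A (fst w) \<partial>W \<theta>)"
      if G: "\<And>j. \<bar>G j\<bar> \<le> 1" for G :: "nat \<Rightarrow> real" and n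
    proof -
      have 1: "(\<lambda>k. \<integral>y. G (c n y) * H k y \<partial>P) \<longlonglongrightarrow> (\<integral>y. G (c n y) * E \<theta> y \<partial>P)"
      proof (rule integral_dominated_convergence[where w="\<lambda>_. 1"])
        show "AE y in P. (\<lambda>k. G (c n y) * H k y) \<longlonglongrightarrow> G (c n y) * E \<theta> y"
          using conv by eventually_elim (intro tendsto_intros)
        show "AE y in P. norm (G (c n y) * H k y) \<le> 1" for k
        proof (rule AE_I2)
          fix y
          show "norm (G (c n y) * H k y) \<le> 1"
            using mult_le_one[OF G[of "c n y"] H01(1)[of k y] H01(2)[of k y]] H01(1)[of k y] by (simp add: abs_mult)
        qed
      qed auto
      have "\<forall>\<^sub>F k in sequentially. (\<integral>y. G (c n y) * H k y \<partial>P) = (\<integral>w. G (c n (snd w)) * indicator A (fst w) \<partial>W \<theta>)"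
        using eventually_ge_at_top[of n]
      proof eventually_elim
        case (elim k)
        then show ?case unfolding H_def by (intro key order_trans[OF _ Np(1)])
      qed
      then have "(\<lambda>k. \<integral>y. G (c n y) * H k y \<partial>P) \<longlonglongrightarrow> (\<integral>w. G (c n (snd w)) * indicator A (fst w) \<partial>W \<theta>)"
        by (rule tendsto_eventually)
      with 1 show ?thesis by (rule LIMSEQ_unique)
    qed
    \<comment> \<open>Both sides of the claim are finite measures as functions of \<open>B\<close>;
      pushed to the line by \<open>\<phi>\<close> they are compared on rational half-lines.\<close>
    define M1 where "M1 = distr (density P (\<lambda>y. ennreal (E \<theta> y))) borel \<phi>"
    define M2 where "M2 = distr (density (W \<theta>) (indicator (A \<times> UNIV))) borel (\<lambda>w. \<phi> (snd w))"
    have \<phi>P[measurable]: "\<phi> \<in> borel_measurable P" by measurable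
    have \<phi>W[measurable]: "(\<lambda>w. \<phi> (snd w)) \<in> borel_measurable (W \<theta>)"
      by (rule measurable_compose[OF snd_m \<phi>(1)])
    have em1: "emeasure M1 C = ennreal (\<integral>y. indicator C (\<phi> y) * E \<theta> y \<partial>P)" if C: "C \<in> sets borel" for C
    proof -
      have "emeasure M1 C = (\<integral>\<^sup>+y. ennreal (E \<theta> y) * indicator (\<phi> -` C) y \<partial>P)"
        unfolding M1_def using C measurable_sets[OF \<phi>P C] by (simp add: emeasure_distr emeasure_density spP)
      also have "\<dots> = (\<integral>\<^sup>+y. ennreal (indicator C (\<phi> y) * E \<theta> y) \<partial>P)"
        by (intro nn_integral_cong) (auto simp: indicator_def)
      also have "\<dots> = ennreal (\<integral>y. indicator C (\<phi> y) * E \<theta> y \<partial>P)"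
        using C E01 by (intro nn_integral_eq_integral P.integrable_const_bound[where B=1]) (auto simp: indicator_def)
      finally show ?thesis .
    qed
    have em2: "emeasure M2 C = ennreal (measure (W \<theta>) (A \<times> (\<phi> -` C)))" if C: "C \<in> sets borel" for C
    proof -
      have "\<phi> -` C \<in> sets borel" using measurable_sets[OF \<phi>(1) C] by simp
      moreover have eqC: "(\<lambda>w. \<phi> (snd w)) -` C = UNIV \<times> (\<phi> -` C)" by auto
      moreover have "emeasure M2 C = (\<integral>\<^sup>+w. indicator (A \<times> UNIV) w * indicator ((\<lambda>w. \<phi> (snd w)) -` C) w \<partial>W \<theta>)"
        unfolding M2_def using C measurable_sets[OF \<phi>W C] rect[OF A, of UNIV] by (simp add: emeasure_distr emeasure_density spW)
      moreover have "indicator (A \<times> UNIV) w * indicator (UNIV \<times> (\<phi> -` C)) w = (indicator (A \<times> (\<phi> -` C)) w :: ennreal)" for w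
        by (auto simp: indicator_def)
      ultimately show ?thesis using rect[OF A, of "\<phi> -` C"] by (simp add: eqC W.emeasure_eq_measure)
    qed
    have "M1 = M2"
    proof (rule real_measure_eqI_rat)
      show "finite_measure M1"
        by (rule finite_measureI) (simp add: em1 M1_def[THEN arg_cong[where f=space]])
      show "sets M1 = sets borel" "sets M2 = sets borel" by (simp_all add: M1_def M2_def)
      fix r :: rat
      define x where "x = real_of_rat r"
      \<comment> \<open>The half-line is approximated by cells whose left endpoint is at most
        \<open>x\<close>. Left endpoints approach \<open>\<phi> y\<close> from below, so points at
        or below \<open>x\<close> are always counted and points above \<open>x\<close> are
        eventually excluded.\<close>
      let ?G = "\<lambda>n j. indicator {..x} (real j / 2^n) :: real"
      have lim: "(\<lambda>n. ?G n (c n y)) \<longlonglongrightarrow> indicator {..x} (\<phi> y)" for y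
      proof (rule tendsto_eventually)
        show "\<forall>\<^sub>F n in sequentially. ?G n (c n y) = indicator {..x} (\<phi> y)"
        proof (cases "\<phi> y \<le> x")
          case True
          have "real (c n y) / 2^n \<le> x" for n
          proof -
            have "real (c n y) / 2^n \<le> \<phi> y" using c_le(1)[of n y] by (simp add: divide_le_eq mult.commute)
            then show ?thesis using True by (rule order_trans)
          qed
          then show ?thesis using True by simp
        next
          case False
          then obtain k where k: "(1/2)^k < \<phi> y - x" using real_arch_pow_inv[of "\<phi> y - x" "1/2"] by auto
          show ?thesis using eventually_ge_at_top[of k]
          proof eventually_elim
            case (elim n)
            have "(1/2::real)^n \<le> (1/2)^k" using elim by (simp add: power_decreasing)
            moreover have "\<phi> y < real (c n y) / 2^n + (1/2)^n"
              using c_le(2)[of n y] by (simp add: field_simps power_divide)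
            ultimately have "x < real (c n y) / 2^n" using k by linarith
            then show ?case using False by simp
          qed
        qed
      qed
      have L1: "(\<lambda>n. \<integral>y. ?G n (c n y) * E \<theta> y \<partial>P) \<longlonglongrightarrow> (\<integral>y. indicator {..x} (\<phi> y) * E \<theta> y \<partial>P)"
      proof (rule integral_dominated_convergence[where w="\<lambda>_. 1"])
        show "AE y in P. (\<lambda>n. ?G n (c n y) * E \<theta> y) \<longlonglongrightarrow> indicator {..x} (\<phi> y) * E \<theta> y"
          by (intro AE_I2 tendsto_mult lim tendsto_const)
      qed (use E01 in \<open>auto simp: indicator_def\<close>)
      have L2: "(\<lambda>n. \<integral>w. ?G n (c n (snd w)) * indicator A (fst w) \<partial>W \<theta>) \<longlonglongrightarrow> (\<integral>w. indicator {..x} (\<phi> (snd w)) * indicator A (fst w) \<partial>W \<theta>)"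
      proof (rule integral_dominated_convergence[where w="\<lambda>_. 1"])
        have [measurable]: "fst \<in> measurable (W \<theta>) borel" using pW(2) by (simp cong: measurable_cong_sets)
        note [measurable] = A snd_m
        show "(\<lambda>w. indicat_real {..x} (\<phi> (snd w)) * indicat_real A (fst w)) \<in> borel_measurable (W \<theta>)" by measurable
        have "(\<lambda>w. c n (snd w)) \<in> measurable (W \<theta>) (count_space UNIV)" for n
          by (rule measurable_compose[OF snd_m c_meas])
        then show "(\<lambda>w. ?G n (c n (snd w)) * indicator A (fst w)) \<in> borel_measurable (W \<theta>)" for n by measurable
        show "AE w in W \<theta>. (\<lambda>n. ?G n (c n (snd w)) * indicator A (fst w)) \<longlonglongrightarrow> indicator {..x} (\<phi> (snd w)) * indicator A (fst w)"
          by (intro AE_I2 tendsto_mult lim tendsto_const)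
      qed (auto simp: indicator_def)
      have "(\<integral>y. ?G n (c n y) * E \<theta> y \<partial>P) = (\<integral>w. ?G n (c n (snd w)) * indicator A (fst w) \<partial>W \<theta>)" for n
        by (rule keyE) (simp add: indicator_def)
      then have "(\<integral>y. indicator {..x} (\<phi> y) * E \<theta> y \<partial>P) = (\<integral>w. indicator {..x} (\<phi> (snd w)) * indicator A (fst w) \<partial>W \<theta>)"
        by (intro LIMSEQ_unique[OF L1]) (simp only: L2)
      also have "\<dots> = (\<integral>w. indicator (A \<times> (\<phi> -` {..x})) w \<partial>W \<theta>)"
        by (intro Bochner_Integration.integral_cong refl) (auto simp: indicator_def)
      also have "\<dots> = measure (W \<theta>) (A \<times> (\<phi> -` {..x}))"
        using rect[OF A, of "\<phi> -` {..x}"] measurable_sets[OF \<phi>(1), of "{..x}"] by (simp add: spW)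
      finally show "emeasure M1 {..real_of_rat r} = emeasure M2 {..real_of_rat r}"
        by (simp add: em1 em2 x_def)
    qed
    \<comment> \<open>As \<open>\<phi>\<close> has the Borel left inverse \<open>\<psi>\<close>,
      every Borel \<open>B\<close> is the preimage under \<open>\<phi>\<close> of a Borel set of
      reals.\<close>
    moreover have "\<psi> -` B \<in> sets borel" using measurable_sets[OF \<phi>(2) B] by simp
    moreover have "\<phi> -` \<psi> -` B = B" using \<phi>(3) by auto
    ultimately have "ennreal (\<integral>y. indicator (\<psi> -` B) (\<phi> y) * E \<theta> y \<partial>P) = ennreal (measure (W \<theta>) (A \<times> B))"
      using em1[of "\<psi> -` B"] em2[of "\<psi> -` B"] by simp
    moreover have "indicator (\<psi> -` B) (\<phi> y) * E \<theta> y = E \<theta> y * indicator B y" for y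
      using \<phi>(3) by (simp add: indicator_def)
    moreover have "0 \<le> (\<integral>y. E \<theta> y * indicator B y \<partial>P)" using E01 by (intro integral_nonneg_AE) auto
    ultimately show ?thesis by (simp add: P_def)
  qed
  show thesis
    by (rule that[of E]) (use E_meas E01 main in \<open>auto simp: split_beta'\<close>)
qed


text \<open>Tested on the set where the inequality fails, the integral of the positive difference
  must vanish.\<close>

lemma (in prob_space) AE_le_of_set_integrals:
  fixes f g :: "'a \<Rightarrow> real"
  assumes f[measurable]: "f \<in> borel_measurable M" and g[measurable]: "g \<in> borel_measurable M"
    and fb: "\<And>x. 0 \<le> f x" "\<And>x. f x \<le> 1" and gb: "\<And>x. 0 \<le> g x" "\<And>x. g x \<le> 1"
    and le: "\<And>B. B \<in> sets M \<Longrightarrow> (\<integral>x. f x * indicator B x \<partial>M) \<le> (\<integral>x. g x * indicator B x \<partial>M)"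
  shows "AE x in M. f x \<le> g x"
proof -
  define B where "B = {x\<in>space M. g x < f x}"
  have B[measurable]: "B \<in> sets M" unfolding B_def by measurable
  have i: "integrable M (\<lambda>x. f x * indicator B x)" "integrable M (\<lambda>x. g x * indicator B x)"
    using fb gb by (auto intro!: integrable_const_bound[where B=1] AE_I2 simp: indicator_def)
  have nn: "AE x in M. 0 \<le> f x * indicator B x - g x * indicator B x"
    by (rule AE_I2) (auto simp: B_def indicator_def)
  have "(\<integral>x. f x * indicator B x - g x * indicator B x \<partial>M) = 0"
    using le[OF B] i integral_nonneg_AE[OF nn] by simp
  then have "AE x in M. f x * indicator B x - g x * indicator B x = 0"
    using integral_nonneg_eq_0_iff_AE[OF Bochner_Integration.integrable_diff[OF i] nn] by simp
  then show ?thesis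
    by (rule AE_mp[OF _ AE_I2]) (auto simp: B_def indicator_def not_less[symmetric])
qed

text \<open>The densities for the half-lines in the coordinate \<open>f\<close> form, almost
  everywhere, a distribution function on the rationals. Since \<open>rcode\<close> turns every
  sequence into a law, the conditional kernel is defined and measurable everywhere, without
  correcting it on an exceptional set that varies with the parameter.\<close>

theorem kernel_disintegration_rect:
  fixes W :: "'t \<Rightarrow> ('x::polish_space \<times> 'y::polish_space) measure"
  assumes W: "W \<in> measurable \<Theta> (prob_algebra (borel \<Otimes>\<^sub>M borel))"
  obtains K :: "'t \<Rightarrow> 'y \<Rightarrow> 'x measure"
  where "(\<lambda>(\<theta>, y). K \<theta> y) \<in> measurable (\<Theta> \<Otimes>\<^sub>M borel) (prob_algebra borel)"
    "\<And>\<theta> A B. \<theta> \<in> space \<Theta> \<Longrightarrow> A \<in> sets borel \<Longrightarrow> B \<in> sets borel \<Longrightarrow>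
      emeasure (W \<theta>) (A \<times> B) = (\<integral>\<^sup>+y. emeasure (K \<theta> y) A * indicator B y \<partial>distr (W \<theta>) borel snd)"
proof -
  obtain f :: "'x \<Rightarrow> real" and g where fg: "f \<in> borel_measurable borel" "g \<in> borel_measurable borel"
    "\<And>x. g (f x) = x" "\<And>x. 0 \<le> f x" "\<And>x. f x < 1"
    using polish_embedding_real by blast
  define A where "A r = f -` {..real_of_rat r}" for r
  have A: "A r \<in> sets borel" for r unfolding A_def using measurable_sets[OF fg(1), of "{..real_of_rat r}"] by simp
  have "\<forall>r. \<exists>E :: 't \<Rightarrow> 'y \<Rightarrow> real. (\<lambda>(\<theta>, y). E \<theta> y) \<in> borel_measurable (\<Theta> \<Otimes>\<^sub>M borel) \<and>
    (\<forall>\<theta> y. 0 \<le> E \<theta> y \<and> E \<theta> y \<le> 1) \<and>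
    (\<forall>\<theta> B. \<theta> \<in> space \<Theta> \<longrightarrow> B \<in> sets borel \<longrightarrow>
      measure (W \<theta>) (A r \<times> B) = (\<integral>y. E \<theta> y * indicator B y \<partial>distr (W \<theta>) borel snd))" (is "\<forall>r. ?P r")
  proof
    fix r
    show "?P r"
      by (rule kernel_density[OF W A[of r]]) blast
  qed
  from choice[OF this] obtain E :: "rat \<Rightarrow> 't \<Rightarrow> 'y \<Rightarrow> real" where
    E_meas: "\<And>r. (\<lambda>(\<theta>, y). E r \<theta> y) \<in> borel_measurable (\<Theta> \<Otimes>\<^sub>M borel)" and
    E01: "\<And>r \<theta> y. 0 \<le> E r \<theta> y" "\<And>r \<theta> y. E r \<theta> y \<le> 1" and
    E: "\<And>r \<theta> B. \<theta> \<in> space \<Theta> \<Longrightarrow> B \<in> sets borel \<Longrightarrow>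
      measure (W \<theta>) (A r \<times> B) = (\<integral>y. E r \<theta> y * indicator B y \<partial>distr (W \<theta>) borel snd)"
    by blast
  define KR where "KR \<theta> y = rcode (\<lambda>r. E r \<theta> y)" for \<theta> y
  have KR_meas: "(\<lambda>x. KR (fst x) (snd x)) \<in> measurable (\<Theta> \<Otimes>\<^sub>M borel) (prob_algebra borel)"
    unfolding KR_def
    by (rule measurable_compose[OF measurable_coordinatewise_then_product measurable_rcode])
       (use E_meas in \<open>simp add: split_beta'\<close>)
  define K where "K \<theta> y = distr (KR \<theta> y) borel g" for \<theta> y
  have K_meas: "(\<lambda>x. K (fst x) (snd x)) \<in> measurable (\<Theta> \<Otimes>\<^sub>M borel) (prob_algebra borel)"
    unfolding K_def by (rule measurable_compose[OF KR_meas measurable_distr_prob_space[OF fg(2)]])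
  have main: "emeasure (W \<theta>) (X \<times> B) = (\<integral>\<^sup>+y. emeasure (K \<theta> y) X * indicator B y \<partial>distr (W \<theta>) borel snd)"
    if \<theta>: "\<theta> \<in> space \<Theta>" and X: "X \<in> sets borel" and B: "B \<in> sets borel" for \<theta> X B
  proof -
    have pW: "prob_space (W \<theta>)" "sets (W \<theta>) = sets (borel \<Otimes>\<^sub>M borel)"
      using measurable_space[OF W \<theta>] by (auto simp: space_prob_algebra)
    interpret W: prob_space "W \<theta>" by fact
    have spW: "space (W \<theta>) = UNIV" using sets_eq_imp_space_eq[OF pW(2)] by (simp add: space_pair_measure)
    have snd_m: "snd \<in> measurable (W \<theta>) borel" using pW(2) by (simp cong: measurable_cong_sets)
    define P where "P = distr (W \<theta>) borel snd"
    interpret P: prob_space P unfolding P_def by (rule W.prob_space_distr[OF snd_m])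
    have setsP[measurable_cong]: "sets P = sets borel" by (simp add: P_def)
    have spP: "space P = UNIV" by (simp add: P_def)
    have rect: "X \<times> Y \<in> sets (W \<theta>)" if "X \<in> sets borel" "Y \<in> sets borel" for X Y
      using that by (simp add: pW(2))
    have Em[measurable]: "E r \<theta> \<in> borel_measurable P" for r
      using measurable_compose[OF measurable_Pair1'[OF \<theta>] E_meas[of r]] by (simp cong: measurable_cong_sets)
    have EP: "(\<integral>y. E r \<theta> y * indicator C y \<partial>P) = measure (W \<theta>) (A r \<times> C)" if "C \<in> sets P" for r C
      using E[OF \<theta>, of C r] that by (simp add: P_def)
    have Amono: "A r \<subseteq> A s" if "r \<le> s" for r s
    proof -
      have "real_of_rat r \<le> real_of_rat s" using that by (simp add: of_rat_less_eq)
      then show ?thesis unfolding A_def by fastforce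
    qed
    have mono: "AE y in P. E r \<theta> y \<le> E s \<theta> y" if "r \<le> s" for r s
      by (rule P.AE_le_of_set_integrals)
         (use E01 Amono[OF that] A in \<open>auto simp: EP rect setsP intro!: W.finite_measure_mono\<close>)
    have zero: "AE y in P. E r \<theta> y = 0" if "r < 0" for r
    proof -
      have "real_of_rat r < 0" using that by simp
      then have "A r = {}" unfolding A_def using fg(4) by (fastforce simp: not_le[symmetric] dest: order_trans)
      then have "AE y in P. E r \<theta> y \<le> 0"
        by (intro P.AE_le_of_set_integrals) (use E01 in \<open>auto simp: EP\<close>)
      then show ?thesis by eventually_elim (use E01 in \<open>auto intro: antisym\<close>)
    qed
    have one: "AE y in P. E r \<theta> y = 1" if "1 \<le> r" for r
    proof -
      have r: "1 \<le> real_of_rat r" using that by simp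
      have "f x \<le> real_of_rat r" for x using order_trans[OF less_imp_le[OF fg(5)] r] .
      then have AU: "A r = UNIV" unfolding A_def by auto
      have "AE y in P. 1 \<le> E r \<theta> y"
      proof (rule P.AE_le_of_set_integrals)
        fix C assume C: "C \<in> sets P"
        have "snd -` C \<inter> space (W \<theta>) = UNIV \<times> C" by (auto simp: spW)
        then have "measure P C = measure (W \<theta>) (UNIV \<times> C)"
          unfolding P_def using C snd_m by (simp add: measure_distr setsP)
        then show "(\<integral>x. 1 * indicator C x \<partial>P) \<le> (\<integral>x. E r \<theta> x * indicator C x \<partial>P)"
          using C by (simp add: EP AU)
      qed (use E01 in auto)
      then show ?thesis by eventually_elim (use E01 in \<open>auto intro: antisym\<close>)
    qed
    \<comment> \<open>Right continuity is tested along one rational sequence decreasing to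
      \<open>r\<close>, so that only countably many almost sure statements are combined.\<close>
    define q where "q r n = r + 1 / of_nat (Suc n)" for r :: rat and n
    have q: "r < q r n" for r n by (simp add: q_def)
    have rc: "AE y in P. (INF n. E (q r n) \<theta> y) \<le> E r \<theta> y" for r
    proof (rule P.AE_le_of_set_integrals)
      have bdd: "bdd_below (range (\<lambda>n. E (q r n) \<theta> y))" for y using E01 by (intro bdd_belowI[of _ 0]) auto
      show "(\<lambda>y. INF n. E (q r n) \<theta> y) \<in> borel_measurable P" by (intro borel_measurable_cINF_real) auto
      show "0 \<le> (INF n. E (q r n) \<theta> y)" for y using E01 by (intro cINF_greatest) auto
      have le: "(INF n. E (q r n) \<theta> y) \<le> E (q r n) \<theta> y" for y n by (intro cINF_lower bdd) auto
      show le1: "(INF n. E (q r n) \<theta> y) \<le> 1" for y using le[of y 0] E01(2) by (rule order_trans)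
      fix C assume C: "C \<in> sets P"
      have Cb: "C \<in> sets borel" using C by (simp add: setsP)
      have "(\<integral>y. (INF n. E (q r n) \<theta> y) * indicator C y \<partial>P) \<le> measure (W \<theta>) (A (q r n) \<times> C)" for n
        unfolding EP[OF C, symmetric]
      proof (rule integral_mono)
        have m: "(\<lambda>y. INF n. E (q r n) \<theta> y) \<in> borel_measurable P" by (intro borel_measurable_cINF_real) auto
        have nn: "0 \<le> (INF n. E (q r n) \<theta> y)" for y using E01 by (intro cINF_greatest) auto
        show "integrable P (\<lambda>y. (INF n. E (q r n) \<theta> y) * indicator C y)"
          using C m nn le1 by (intro P.integrable_const_bound[where B=1]) (auto simp: indicator_def)
        show "integrable P (\<lambda>y. E (q r n) \<theta> y * indicator C y)"
          using C E01 by (intro P.integrable_const_bound[where B=1]) (auto simp: indicator_def)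
        show "(INF n. E (q r n) \<theta> y) * indicator C y \<le> E (q r n) \<theta> y * indicator C y" for y
          by (intro mult_right_mono le) simp
      qed
      moreover have "(\<lambda>n. measure (W \<theta>) (A (q r n) \<times> C)) \<longlonglongrightarrow> measure (W \<theta>) (\<Inter>n. A (q r n) \<times> C)"
      proof (rule W.finite_Lim_measure_decseq)
        show "decseq (\<lambda>n. A (q r n) \<times> C)"
          unfolding decseq_def
        proof (intro allI impI Sigma_mono order_refl Amono)
          fix m n :: nat assume "m \<le> n"
          then show "q r n \<le> q r m" by (simp add: q_def frac_le)
        qed
      qed (use A Cb rect in auto)
      moreover have "(\<Inter>n. A (q r n) \<times> C) = A r \<times> C"
      proof -
        have "(\<Inter>n. A (q r n)) = A r"
        proof (intro equalityI subsetI)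
          fix x assume x: "x \<in> (\<Inter>n. A (q r n))"
          have fx: "f x \<le> real_of_rat r + inverse (real (Suc n))" for n
          proof -
            have "f x \<le> real_of_rat (q r n)" using x by (auto simp: A_def)
            then show ?thesis by (simp add: q_def of_rat_add of_rat_divide inverse_eq_divide)
          qed
          have "f x \<le> real_of_rat r"
          proof (rule ccontr)
            assume "\<not> f x \<le> real_of_rat r"
            then obtain n where "inverse (real (Suc n)) < f x - real_of_rat r"
              using reals_Archimedean[of "f x - real_of_rat r"] by auto
            then show False using fx[of n] by linarith
          qed
          then show "x \<in> A r" by (simp add: A_def)
        next
          fix x assume "x \<in> A r" then show "x \<in> (\<Inter>n. A (q r n))" using Amono[OF less_imp_le[OF q]] by blast
        qed
        then show ?thesis by blast
      qed
      ultimately have "(\<integral>y. (INF n. E (q r n) \<theta> y) * indicator C y \<partial>P) \<le> measure (W \<theta>) (A r \<times> C)"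
        by (intro LIMSEQ_le_const[where X="\<lambda>n. measure (W \<theta>) (A (q r n) \<times> C)"]) auto
      then show "(\<integral>y. (INF n. E (q r n) \<theta> y) * indicator C y \<partial>P) \<le> (\<integral>y. E r \<theta> y * indicator C y \<partial>P)"
        by (simp add: EP[OF C])
    qed (use E01 in auto)
    have "AE y in P. (\<forall>r s. r \<le> s \<longrightarrow> E r \<theta> y \<le> E s \<theta> y) \<and> (\<forall>r. r < 0 \<longrightarrow> E r \<theta> y = 0) \<and>
      (\<forall>r. 1 \<le> r \<longrightarrow> E r \<theta> y = 1) \<and> (\<forall>r. (INF n. E (q r n) \<theta> y) \<le> E r \<theta> y)"
      using mono zero one rc by (simp add: AE_all_countable AE_conj_iff AE_impI)
    then have code: "AE y in P. \<forall>r. emeasure (KR \<theta> y) {..real_of_rat r} = ennreal (E r \<theta> y)"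
    proof eventually_elim
      case (elim y)
      show ?case unfolding KR_def
      proof (intro allI emeasure_rcode)
        fix r and \<epsilon> :: real assume "0 < \<epsilon>"
        then have "(INF n. E (q r n) \<theta> y) < E r \<theta> y + \<epsilon>" using elim by (metis add.right_neutral add_le_less_mono)
        then obtain n where "E (q r n) \<theta> y < E r \<theta> y + \<epsilon>"
          by (subst (asm) cINF_less_iff) (use E01 in \<open>auto intro!: bdd_belowI[of _ 0]\<close>)
        then show "\<exists>s>r. E s \<theta> y < E r \<theta> y + \<epsilon>" using q by blast
      qed (use elim in auto)
    qed
    have KRm: "KR \<theta> \<in> measurable borel (prob_algebra borel)"
      using measurable_compose[OF measurable_Pair1'[OF \<theta>] KR_meas] by simp
    define D where "D = density P (indicator B)"
    have setsD: "sets D = sets borel" by (simp add: D_def setsP)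
    have BP: "B \<in> sets P" using B by (simp add: setsP)
    \<comment> \<open>For fixed \<open>B\<close>, these are the two sides of the rectangle formula
      as measures on the line in the coordinate \<open>f\<close>; on rational half-lines
      \<open>code\<close> identifies them.\<close>
    define M1 where "M1 = D \<bind> KR \<theta>"
    define M2 where "M2 = distr (density (W \<theta>) (indicator (UNIV \<times> B))) borel (\<lambda>w. f (fst w))"
    have KRD: "KR \<theta> \<in> measurable D (subprob_algebra borel)"
      using measurable_prob_algebraD[OF KRm] setsD by (simp cong: measurable_cong_sets)
    have em1: "emeasure M1 C = (\<integral>\<^sup>+y. emeasure (KR \<theta> y) C * indicator B y \<partial>P)" if C: "C \<in> sets borel" for C
    proof -
      have m: "(\<lambda>y. emeasure (KR \<theta> y) C) \<in> borel_measurable P"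
        using measurable_emeasure_kernel[OF measurable_prob_algebraD[OF KRm] C] by (simp cong: measurable_cong_sets)
      have "emeasure M1 C = (\<integral>\<^sup>+y. emeasure (KR \<theta> y) C \<partial>D)"
        unfolding M1_def by (rule emeasure_bind[OF _ KRD C]) (simp add: D_def spP)
      also have "\<dots> = (\<integral>\<^sup>+y. indicator B y * emeasure (KR \<theta> y) C \<partial>P)"
        unfolding D_def using BP m by (intro nn_integral_density) auto
      finally show ?thesis by (simp add: mult.commute)
    qed
    have fW: "(\<lambda>w. f (fst w)) \<in> borel_measurable (W \<theta>)"
      using measurable_compose[OF measurable_fst fg(1)] pW(2) by (simp cong: measurable_cong_sets)
    have em2: "emeasure M2 C = emeasure (W \<theta>) ((f -` C) \<times> B)" if C: "C \<in> sets borel" for C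
    proof -
      have fC: "f -` C \<in> sets borel" using measurable_sets[OF fg(1) C] by simp
      have eqC: "(\<lambda>w. f (fst w)) -` C = (f -` C) \<times> UNIV" by auto
      have "emeasure M2 C = (\<integral>\<^sup>+w. indicator (UNIV \<times> B) w * indicator ((\<lambda>w. f (fst w)) -` C) w \<partial>W \<theta>)"
        unfolding M2_def using C measurable_sets[OF fW C] rect[OF _ B, of UNIV] fW by (simp add: emeasure_distr emeasure_density spW)
      also have "\<dots> = (\<integral>\<^sup>+w. indicator ((f -` C) \<times> B) w \<partial>W \<theta>)"
        unfolding eqC by (intro nn_integral_cong) (auto simp: indicator_def)
      also have "\<dots> = emeasure (W \<theta>) ((f -` C) \<times> B)" using rect[OF fC B] by simp
      finally show ?thesis .
    qed
    have "M2 = M1"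
    proof (rule real_measure_eqI_rat)
      show sM2: "sets M2 = sets borel" by (simp add: M2_def)
      show "finite_measure M2"
        by (rule finite_measureI) (use em2[of UNIV] in \<open>simp add: M2_def\<close>)
      show "sets M1 = sets borel" unfolding M1_def
        by (rule sets_bind) (use KRD in \<open>auto simp: D_def spP dest: subprob_measurableD(2)\<close>)
      fix r
      have "emeasure M1 {..real_of_rat r} = (\<integral>\<^sup>+y. ennreal (E r \<theta> y * indicator B y) \<partial>P)"
        using code by (subst em1) (auto intro!: nn_integral_cong_AE simp: ennreal_mult E01 split: split_indicator)
      also have "\<dots> = ennreal (\<integral>y. E r \<theta> y * indicator B y \<partial>P)"
        using E01 BP by (intro nn_integral_eq_integral P.integrable_const_bound[where B=1]) (auto simp: indicator_def)
      also have "\<dots> = emeasure (W \<theta>) (A r \<times> B)" by (simp add: EP[OF BP] W.emeasure_eq_measure)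
      finally show "emeasure M2 {..real_of_rat r} = emeasure M1 {..real_of_rat r}"
        by (simp add: em2 A_def)
    qed
    moreover have gX: "g -` X \<in> sets borel" using measurable_sets[OF fg(2) X] by simp
    moreover have "f -` g -` X = X" using fg(3) by auto
    ultimately have WX: "emeasure (W \<theta>) (X \<times> B) = (\<integral>\<^sup>+y. emeasure (KR \<theta> y) (g -` X) * indicator B y \<partial>P)"
      using em1[OF gX] em2[OF gX] by simp
    have "emeasure (KR \<theta> y) (g -` X) = emeasure (K \<theta> y) X" for y
    proof -
      have "KR \<theta> y \<in> space (prob_algebra borel)" using measurable_space[OF KRm, of y] by simp
      then have "sets (KR \<theta> y) = sets borel" by (simp add: space_prob_algebra)
      moreover from sets_eq_imp_space_eq[OF this] have "space (KR \<theta> y) = UNIV" by simp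
      ultimately show ?thesis unfolding K_def using fg(2) X
        by (subst emeasure_distr) (auto cong: measurable_cong_sets)
    qed
    then show ?thesis unfolding WX by (simp add: P_def)
  qed
  show thesis
    by (rule that[of K]) (use K_meas main in \<open>auto simp: split_beta'\<close>)
qed

theorem kernel_disintegration:
  fixes W :: "'t \<Rightarrow> ('x::polish_space \<times> 'y::polish_space) measure"
  assumes W: "W \<in> measurable \<Theta> (prob_algebra (borel \<Otimes>\<^sub>M borel))"
  obtains K :: "'t \<Rightarrow> 'y \<Rightarrow> 'x measure"
  where "(\<lambda>(\<theta>, y). K \<theta> y) \<in> measurable (\<Theta> \<Otimes>\<^sub>M borel) (prob_algebra borel)"
    "\<And>\<theta>. \<theta> \<in> space \<Theta> \<Longrightarrow>
      W \<theta> = distr (W \<theta>) borel snd \<bind> (\<lambda>y. distr (K \<theta> y) (borel \<Otimes>\<^sub>M borel) (\<lambda>x. (x, y)))"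
proof (rule kernel_disintegration_rect[OF W])
  fix K :: "'t \<Rightarrow> 'y \<Rightarrow> 'x measure"
  assume K: "(\<lambda>(\<theta>, y). K \<theta> y) \<in> measurable (\<Theta> \<Otimes>\<^sub>M borel) (prob_algebra borel)"
    and rect: "\<And>\<theta> A B. \<theta> \<in> space \<Theta> \<Longrightarrow> A \<in> sets borel \<Longrightarrow> B \<in> sets borel \<Longrightarrow>
      emeasure (W \<theta>) (A \<times> B) = (\<integral>\<^sup>+y. emeasure (K \<theta> y) A * indicator B y \<partial>distr (W \<theta>) borel snd)"
  show thesis
  proof (rule that[OF K])
    fix \<theta> assume \<theta>: "\<theta> \<in> space \<Theta>"
    have pW: "prob_space (W \<theta>)" "sets (W \<theta>) = sets (borel \<Otimes>\<^sub>M borel)"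
      using measurable_space[OF W \<theta>] by (auto simp: space_prob_algebra)
    interpret W: prob_space "W \<theta>" by fact
    have snd_m: "snd \<in> measurable (W \<theta>) borel" using pW(2) by (simp cong: measurable_cong_sets)
    have P: "distr (W \<theta>) borel snd \<in> space (prob_algebra borel)"
      using W.prob_space_distr[OF snd_m] by (simp add: space_prob_algebra)
    have K\<theta>: "K \<theta> \<in> measurable borel (prob_algebra borel)"
      using measurable_compose[OF measurable_Pair1'[OF \<theta>] K] by simp
    have Ks: "sets (K \<theta> y) = sets borel" "space (K \<theta> y) = UNIV" for y
      using measurable_space[OF K\<theta>, of y] by (auto simp: space_prob_algebra dest: sets_eq_imp_space_eq)
    let ?R = "\<lambda>y. distr (K \<theta> y) (borel \<Otimes>\<^sub>M borel) (\<lambda>x. (x, y))"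
    have R: "?R \<in> measurable borel (prob_algebra (borel \<Otimes>\<^sub>M borel))"
      by (rule measurable_distr_prob_space2[OF K\<theta>]) simp
    let ?E = "{a \<times> b |a b. a \<in> sets (borel::'x measure) \<and> b \<in> sets (borel::'y measure)}"
    show "W \<theta> = distr (W \<theta>) borel snd \<bind> ?R"
    proof (rule measure_eqI_generator_eq[where E="?E" and \<Omega>="space borel \<times> space borel" and A="\<lambda>_. UNIV \<times> UNIV"])
      show "Int_stable ?E" by (rule Int_stable_pair_measure_generator)
      show "?E \<subseteq> Pow (space borel \<times> space borel)" by auto
      show "sets (W \<theta>) = sigma_sets (space borel \<times> space borel) ?E" by (simp only: pW(2) sets_pair_measure)
      show "sets (distr (W \<theta>) borel snd \<bind> ?R) = sigma_sets (space borel \<times> space borel) ?E"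
        unfolding sets_bind'[OF P R] by (rule sets_pair_measure)
      show "range (\<lambda>_::nat. UNIV \<times> UNIV) \<subseteq> ?E" by (auto intro!: exI[of _ UNIV])
      fix X assume "X \<in> ?E"
      then obtain a b where X: "X = a \<times> b" and ab: "a \<in> sets borel" "b \<in> sets borel" by blast
      have "emeasure (distr (W \<theta>) borel snd \<bind> ?R) X = (\<integral>\<^sup>+y. emeasure (?R y) X \<partial>distr (W \<theta>) borel snd)"
        using ab by (intro emeasure_bind_prob_algebra[OF P R]) (simp add: X)
      also have "\<dots> = (\<integral>\<^sup>+y. emeasure (K \<theta> y) a * indicator b y \<partial>distr (W \<theta>) borel snd)"
      proof (intro nn_integral_cong)
        fix y
        have "(\<lambda>x. (x, y)) -` (a \<times> b) = (if y \<in> b then a else {})" by auto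
        then show "emeasure (?R y) X = emeasure (K \<theta> y) a * indicator b y"
          using ab unfolding X by (subst emeasure_distr) (auto simp: Ks cong: measurable_cong_sets)
      qed
      finally show "emeasure (W \<theta>) X = emeasure (distr (W \<theta>) borel snd \<bind> ?R) X"
        using rect[OF \<theta> ab] by (simp add: X)
    qed auto
  qed
qed

section \<open>Hitting probabilities of Markov chains\<close>

locale markov_chain =
  fixes N :: "'z measure" and \<kappa> :: "'z \<Rightarrow> 'z measure" and z0 :: 'z
  assumes kernel: "\<kappa> \<in> measurable N (prob_algebra N)" and start: "z0 \<in> space N"
begin

text \<open>The start is the law of coordinate 0 and the transition into coordinate \<open>i\<close>
  reads coordinate \<open>i - 1\<close>, the same indexing as in \<open>cl_kernels\<close>.\<close>

definition ker :: "nat \<Rightarrow> (nat \<Rightarrow> 'z) \<Rightarrow> 'z measure" where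
  "ker i \<omega> = (if i = 0 then return N z0 else \<kappa> (\<omega> (i - 1)))"

lemma ker_measurable: "ker i \<in> measurable (PiM {0..<i} (\<lambda>_. N)) (prob_algebra N)"
proof (cases "i = 0")
  case True
  have "return N z0 \<in> space (prob_algebra N)" by (rule measurable_space[OF measurable_return_prob_space start])
  then show ?thesis using True by (simp add: ker_def[abs_def])
next
  case False
  then have "(\<lambda>\<omega>. \<omega> (i - 1)) \<in> measurable (PiM {0..<i} (\<lambda>_. N)) N" by (intro measurable_component_singleton) auto
  from measurable_compose[OF this kernel] show ?thesis using False by (simp add: ker_def[abs_def])
qed

sublocale IT: Ionescu_Tulcea ker "\<lambda>_. N"
  using ker_measurable measurable_space[OF ker_measurable]
  by (intro Ionescu_Tulcea.intro) (auto intro: measurable_prob_algebraD simp: space_prob_algebra)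

abbreviation "Cn n \<equiv> IT.C 0 n (\<lambda>_. undefined)"

lemma undefined_in_empty_product[simp]: "(\<lambda>_. undefined) \<in> space (PiM {0..<0::nat} (\<lambda>_. N))" by (simp add: space_PiM)

text \<open>\<open>Cn n\<close> carries the coordinates below \<open>n\<close>, so the coordinate
  added next has index \<open>n\<close> itself.\<close>

lemma nn_integral_Cn_Suc:
  assumes f: "f \<in> borel_measurable (PiM {0..<Suc n} (\<lambda>_. N))"
  shows "(\<integral>\<^sup>+\<omega>. f \<omega> \<partial>Cn (Suc n)) = (\<integral>\<^sup>+\<omega>. (\<integral>\<^sup>+z. f (fun_upd \<omega> n z) \<partial>ker n \<omega>) \<partial>Cn n)"
proof -
  have "(\<integral>\<^sup>+\<omega>. f \<omega> \<partial>Cn (Suc n)) = (\<integral>\<^sup>+\<omega>. (\<integral>\<^sup>+x. f x \<partial>IT.eP n \<omega>) \<partial>Cn n)"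
  proof -
    have "IT.eP n \<in> measurable (Cn n) (subprob_algebra (PiM {0..<Suc n} (\<lambda>_. N)))"
      using IT.measurable_eP[of n] by (subst measurable_cong_sets[OF IT.sets_C[OF undefined_in_empty_product] refl]) simp
    then show ?thesis by (simp only: IT.C.simps add_0) (rule nn_integral_bind[OF f])
  qed
  also have "\<dots> = (\<integral>\<^sup>+\<omega>. (\<integral>\<^sup>+z. f (fun_upd \<omega> n z) \<partial>ker n \<omega>) \<partial>Cn n)"
    by (intro nn_integral_cong IT.nn_integral_eP f) (simp add: IT.space_C)
  finally show ?thesis .
qed

lemma emeasure_lim_cylinder:
  assumes "X \<in> sets (PiM {0..<n} (\<lambda>_. N))"
  shows "emeasure IT.PF.lim {\<omega>\<in>space (PiM UNIV (\<lambda>_. N)). restrict \<omega> {0..<n} \<in> X} = emeasure (Cn n) X"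
proof -
  have "{\<omega>\<in>space (PiM UNIV (\<lambda>_. N)). restrict \<omega> {0..<n} \<in> X} = IT.PF.emb UNIV {0..<n} X"
    by (auto simp: prod_emb_def space_PiM)
  also have "emeasure IT.PF.lim \<dots> = emeasure (IT.CI {0..<n}) X"
    by (rule IT.lim[OF _ assms]) simp
  also have "\<dots> = emeasure (Cn n) (prod_emb {0..<n} (\<lambda>_. N) {0..<n} X)"
    by (rule IT.emeasure_CI[OF _ assms]) simp
  also have "prod_emb {0..<n} (\<lambda>_. N) {0..<n} X = X"
    using sets.sets_into_space[OF assms] by (intro prod_emb_id) (simp add: space_PiM)
  finally show ?thesis .
qed

text \<open>The functions \<open>v l\<close> are subsolutions of the recursion for hitting
  \<open>B\<close> with horizon \<open>l\<close>. Stopped at \<open>B\<close>, their values along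
  the chain do not decrease in the mean, and once the horizon is used up only visits to
  \<open>B\<close> contribute.\<close>

lemma hitting_lower_bound:
  fixes v :: "nat \<Rightarrow> 'z \<Rightarrow> ennreal"
  assumes B: "B \<in> sets N" and v: "\<And>l. v l \<in> borel_measurable N"
    and v0: "\<And>z. z \<in> space N \<Longrightarrow> v 0 z \<le> indicator B z"
    and v1: "\<And>l z. z \<in> space N \<Longrightarrow> v l z \<le> 1"
    and vS: "\<And>l z. z \<in> space N \<Longrightarrow> z \<notin> B \<Longrightarrow> v (Suc l) z \<le> (\<integral>\<^sup>+z'. v l z' \<partial>\<kappa> z)"
  shows "v n z0 \<le> emeasure IT.PF.lim {\<omega>\<in>space (PiM UNIV (\<lambda>_. N)). \<exists>i\<le>n. \<omega> i \<in> B}"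
proof -
  \<comment> \<open>The stopped value process. Elapsed time and remaining horizon are separate
    indices, so the induction can trade one for the other with their sum fixed.\<close>
  define U where "U n l \<omega> = (if \<exists>i<n. \<omega> i \<in> B then 1 else v l (\<omega> n))" for n l and \<omega> :: "nat \<Rightarrow> 'z"
  have comp: "(\<lambda>\<omega>. \<omega> i) \<in> measurable (PiM {0..<n} (\<lambda>_. N)) N" if "i < n" for i n :: nat
    using that by (intro measurable_component_singleton) auto
  have hit: "{\<omega> \<in> space (PiM {0..<m} (\<lambda>_. N)). \<exists>i<n. \<omega> i \<in> B} \<in> sets (PiM {0..<m} (\<lambda>_. N))" if "n \<le> m" for n m :: nat
  proof -
    have "{\<omega> \<in> space (PiM {0..<m} (\<lambda>_. N)). \<exists>i<n. \<omega> i \<in> B} = (\<Union>i<n. (\<lambda>\<omega>. \<omega> i) -` B \<inter> space (PiM {0..<m} (\<lambda>_. N)))" by auto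
    also have "\<dots> \<in> sets (PiM {0..<m} (\<lambda>_. N))"
      using that B by (intro sets.finite_UN measurable_sets[OF comp]) auto
    finally show ?thesis .
  qed
  have Um: "U n l \<in> borel_measurable (PiM {0..<Suc n} (\<lambda>_. N))" for n l
    unfolding U_def
    by (rule measurable_If[OF measurable_const measurable_compose[OF comp v] hit]) simp_all
  have main: "v (n + l) z0 \<le> (\<integral>\<^sup>+\<omega>. U n l \<omega> \<partial>Cn (Suc n))" for n l
  proof (induction n arbitrary: l)
    case 0
    have "(\<integral>\<^sup>+\<omega>. U 0 l \<omega> \<partial>Cn (Suc 0)) = (\<integral>\<^sup>+\<omega>. (\<integral>\<^sup>+z. v l z \<partial>return N z0) \<partial>Cn 0)"
      by (subst nn_integral_Cn_Suc[OF Um]) (simp add: U_def ker_def)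
    also have "\<dots> = (\<integral>\<^sup>+\<omega>. v l z0 \<partial>Cn 0)" using v start by (simp add: nn_integral_return)
    also have "\<dots> = v l z0" using prob_space.emeasure_space_1[OF IT.prob_space_C[OF undefined_in_empty_product, of 0]] by simp
    finally show ?case by simp
  next
    case (Suc n)
    have "v (Suc n + l) z0 \<le> (\<integral>\<^sup>+\<omega>. U n (Suc l) \<omega> \<partial>Cn (Suc n))" using Suc[of "Suc l"] by simp
    also have "\<dots> \<le> (\<integral>\<^sup>+\<omega>. (\<integral>\<^sup>+z. U (Suc n) l (fun_upd \<omega> (Suc n) z) \<partial>ker (Suc n) \<omega>) \<partial>Cn (Suc n))"
    proof (rule nn_integral_mono)
      fix \<omega> assume "\<omega> \<in> space (Cn (Suc n))"
      then have \<omega>: "\<omega> \<in> space (PiM {0..<Suc n} (\<lambda>_. N))" by (simp only: IT.space_C[OF undefined_in_empty_product] add_0)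
      have zn: "\<omega> n \<in> space N" by (rule measurable_space[OF comp \<omega>]) simp
      have p: "prob_space (\<kappa> (\<omega> n))" using measurable_space[OF kernel zn] by (simp add: space_prob_algebra)
      show "U n (Suc l) \<omega> \<le> (\<integral>\<^sup>+z. U (Suc n) l (fun_upd \<omega> (Suc n) z) \<partial>ker (Suc n) \<omega>)"
      proof (cases "\<exists>i<Suc n. \<omega> i \<in> B")
        case True
        then obtain i where "i < Suc n" "\<omega> i \<in> B" by blast
        then have "\<exists>i<Suc n. (fun_upd \<omega> (Suc n) z) i \<in> B" for z by (intro exI[of _ i]) simp
        then have "U (Suc n) l (fun_upd \<omega> (Suc n) z) = 1" for z unfolding U_def by (simp only: if_True)
        then have "(\<integral>\<^sup>+z. U (Suc n) l (fun_upd \<omega> (Suc n) z) \<partial>ker (Suc n) \<omega>) = 1"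
          using prob_space.emeasure_space_1[OF p] by (simp add: ker_def)
        moreover have "U n (Suc l) \<omega> \<le> 1" using v1[OF zn] by (simp add: U_def)
        ultimately show ?thesis by simp
      next
        case False
        then have "\<not> (\<exists>i<Suc n. (fun_upd \<omega> (Suc n) z) i \<in> B)" for z by auto
        then have "U (Suc n) l (fun_upd \<omega> (Suc n) z) = v l z" for z unfolding U_def by (simp only: if_False fun_upd_same)
        moreover have "\<not> (\<exists>i<n. \<omega> i \<in> B)" "\<omega> n \<notin> B" using False by (auto simp: less_Suc_eq)
        moreover from this have "U n (Suc l) \<omega> = v (Suc l) (\<omega> n)" unfolding U_def by (simp only: if_False)
        ultimately show ?thesis using vS[OF zn, of l] by (simp add: ker_def)
      qed
    qed
    also have "\<dots> = (\<integral>\<^sup>+\<omega>. U (Suc n) l \<omega> \<partial>Cn (Suc (Suc n)))"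
      by (rule nn_integral_Cn_Suc[OF Um, symmetric])
    finally show ?case .
  qed
  let ?X = "{\<omega> \<in> space (PiM {0..<Suc n} (\<lambda>_. N)). \<exists>i<Suc n. \<omega> i \<in> B}"
  have X: "?X \<in> sets (PiM {0..<Suc n} (\<lambda>_. N))" by (rule hit) simp
  have "v n z0 \<le> (\<integral>\<^sup>+\<omega>. U n 0 \<omega> \<partial>Cn (Suc n))" using main[of n 0] by simp
  also have "\<dots> \<le> (\<integral>\<^sup>+\<omega>. indicator ?X \<omega> \<partial>Cn (Suc n))"
  proof (rule nn_integral_mono)
    fix \<omega> assume "\<omega> \<in> space (Cn (Suc n))"
    then have \<omega>: "\<omega> \<in> space (PiM {0..<Suc n} (\<lambda>_. N))" by (simp only: IT.space_C[OF undefined_in_empty_product] add_0)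
    have zn: "\<omega> n \<in> space N" by (rule measurable_space[OF comp \<omega>]) simp
    show "U n 0 \<omega> \<le> indicator ?X \<omega>"
    proof (cases "\<exists>i<Suc n. \<omega> i \<in> B")
      case True
      then have "indicator ?X \<omega> = (1::ennreal)" using \<omega> by (simp only: indicator_simps mem_Collect_eq simp_thms)
      moreover have "U n 0 \<omega> \<le> 1" using v1[OF zn] by (simp add: U_def)
      ultimately show ?thesis by (simp only:)
    next
      case False
      then have n: "\<omega> n \<notin> B" "\<not> (\<exists>i<n. \<omega> i \<in> B)" by (auto simp: less_Suc_eq)
      then have "U n 0 \<omega> = v 0 (\<omega> n)" unfolding U_def by (simp only: if_False)
      also have "\<dots> \<le> 0" using v0[OF zn] n(1) by simp
      finally show ?thesis by simp
    qed
  qed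
  also have "\<dots> = emeasure (Cn (Suc n)) ?X"
    using X by (intro nn_integral_indicator) (simp only: IT.sets_C[OF undefined_in_empty_product] add_0)
  also have "\<dots> = emeasure IT.PF.lim {\<omega>\<in>space (PiM UNIV (\<lambda>_. N)). restrict \<omega> {0..<Suc n} \<in> ?X}"
    by (rule emeasure_lim_cylinder[OF X, symmetric])
  also have "{\<omega>\<in>space (PiM UNIV (\<lambda>_. N)). restrict \<omega> {0..<Suc n} \<in> ?X} = {\<omega>\<in>space (PiM UNIV (\<lambda>_. N)). \<exists>i\<le>n. \<omega> i \<in> B}"
  proof (intro Collect_cong conj_cong refl)
    fix \<omega> :: "nat \<Rightarrow> 'z" assume "\<omega> \<in> space (PiM UNIV (\<lambda>_. N))"
    then have "restrict \<omega> {0..<Suc n} \<in> space (PiM {0..<Suc n} (\<lambda>_. N))"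
      by (simp add: space_PiM PiE_iff)
    moreover have "restrict \<omega> {0..<Suc n} i = \<omega> i" if "i \<le> n" for i using that by simp
    ultimately show "restrict \<omega> {0..<Suc n} \<in> ?X \<longleftrightarrow> (\<exists>i\<le>n. \<omega> i \<in> B)"
      by (simp add: less_Suc_eq_le cong: conj_cong)
  qed
  finally show ?thesis .
qed

text \<open>Each index concerns only the law of finitely many coordinates, where the exceptional set
  is null by the one-step assumption; countably many null sets are then combined.\<close>

lemma AE_transitions:
  assumes R: "Measurable.pred (N \<Otimes>\<^sub>M N) (\<lambda>(z, z'). Rel z z')"
    and step: "\<And>z. z \<in> space N \<Longrightarrow> AE z' in \<kappa> z. Rel z z'"
  shows "AE \<omega> in IT.PF.lim. \<forall>i. Rel (\<omega> i) (\<omega> (Suc i))"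
  unfolding AE_all_countable
proof
  fix n
  have comp: "(\<lambda>\<omega>. \<omega> i) \<in> measurable (PiM {0..<m} (\<lambda>_. N)) N" if "i < m" for i m :: nat
    using that by (intro measurable_component_singleton) auto
  let ?P = "PiM {0..<Suc (Suc n)} (\<lambda>_. N)"
  let ?X = "{\<omega> \<in> space ?P. \<not> Rel (\<omega> n) (\<omega> (Suc n))}"
  have "(\<lambda>\<omega>. (\<omega> n, \<omega> (Suc n))) \<in> measurable ?P (N \<Otimes>\<^sub>M N)" by (intro measurable_Pair comp) auto
  from measurable_compose[OF this R] have "Measurable.pred ?P (\<lambda>\<omega>. Rel (\<omega> n) (\<omega> (Suc n)))" by simp
  then have X: "?X \<in> sets ?P" by measurable
  have "emeasure (Cn (Suc (Suc n))) ?X = (\<integral>\<^sup>+\<omega>. indicator ?X \<omega> \<partial>Cn (Suc (Suc n)))"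
    using X by (intro nn_integral_indicator[symmetric]) (simp only: IT.sets_C[OF undefined_in_empty_product] add_0)
  also have "\<dots> = (\<integral>\<^sup>+\<omega>. (\<integral>\<^sup>+z. indicator ?X (fun_upd \<omega> (Suc n) z) \<partial>ker (Suc n) \<omega>) \<partial>Cn (Suc n))"
    using X by (intro nn_integral_Cn_Suc) simp
  also have "\<dots> = (\<integral>\<^sup>+\<omega>. 0 \<partial>Cn (Suc n))"
  proof (rule nn_integral_cong)
    fix \<omega> assume "\<omega> \<in> space (Cn (Suc n))"
    then have \<omega>: "\<omega> \<in> space (PiM {0..<Suc n} (\<lambda>_. N))" by (simp only: IT.space_C[OF undefined_in_empty_product] add_0)
    have zn: "\<omega> n \<in> space N" by (rule measurable_space[OF comp \<omega>]) simp
    have "AE z in ker (Suc n) \<omega>. indicator ?X (fun_upd \<omega> (Suc n) z) = (0::ennreal)"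
    proof -
      have k: "ker (Suc n) \<omega> = \<kappa> (\<omega> n)" by (simp add: ker_def)
      have "AE z in \<kappa> (\<omega> n). indicator ?X (fun_upd \<omega> (Suc n) z) = (0::ennreal)"
        using step[OF zn] by eventually_elim (simp add: indicator_def)
      then show ?thesis unfolding k .
    qed
    then have "(\<integral>\<^sup>+z. indicator ?X (fun_upd \<omega> (Suc n) z) \<partial>ker (Suc n) \<omega>) = (\<integral>\<^sup>+z. 0 \<partial>ker (Suc n) \<omega>)"
      by (rule nn_integral_cong_AE)
    then show "(\<integral>\<^sup>+z. indicator ?X (fun_upd \<omega> (Suc n) z) \<partial>ker (Suc n) \<omega>) = 0" by simp
  qed
  finally have "emeasure IT.PF.lim {\<omega>\<in>space (PiM UNIV (\<lambda>_. N)). restrict \<omega> {0..<Suc (Suc n)} \<in> ?X} = 0"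
    unfolding emeasure_lim_cylinder[OF X] by simp
  moreover have "{\<omega>\<in>space (PiM UNIV (\<lambda>_. N)). restrict \<omega> {0..<Suc (Suc n)} \<in> ?X}
      = {\<omega>\<in>space (PiM UNIV (\<lambda>_. N)). \<not> Rel (\<omega> n) (\<omega> (Suc n))}"
  proof (intro Collect_cong conj_cong refl)
    fix \<omega> :: "nat \<Rightarrow> 'z" assume "\<omega> \<in> space (PiM UNIV (\<lambda>_. N))"
    then have "restrict \<omega> {0..<Suc (Suc n)} \<in> space ?P" by (simp add: space_PiM PiE_iff)
    then show "restrict \<omega> {0..<Suc (Suc n)} \<in> ?X \<longleftrightarrow> \<not> Rel (\<omega> n) (\<omega> (Suc n))" by simp
  qed
  moreover have "{\<omega>\<in>space (PiM UNIV (\<lambda>_. N)). \<not> Rel (\<omega> n) (\<omega> (Suc n))} \<in> sets IT.PF.lim"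
  proof -
    have "(\<lambda>\<omega>. (\<omega> n, \<omega> (Suc n))) \<in> measurable (PiM UNIV (\<lambda>_. N)) (N \<Otimes>\<^sub>M N)"
      by (intro measurable_Pair measurable_component_singleton) auto
    from measurable_compose[OF this R] have "Measurable.pred (PiM UNIV (\<lambda>_. N)) (\<lambda>\<omega>. Rel (\<omega> n) (\<omega> (Suc n)))" by simp
    then have "{\<omega>\<in>space (PiM UNIV (\<lambda>_. N)). \<not> Rel (\<omega> n) (\<omega> (Suc n))} \<in> sets (PiM UNIV (\<lambda>_. N))" by measurable
    then show ?thesis by (simp only: IT.PF.sets_lim)
  qed
  ultimately show "AE \<omega> in IT.PF.lim. Rel (\<omega> n) (\<omega> (Suc n))"
    by (intro AE_I[of _ _ "{\<omega>\<in>space (PiM UNIV (\<lambda>_. N)). \<not> Rel (\<omega> n) (\<omega> (Suc n))}"])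
       (simp_all only: IT.PF.space_lim order_refl)
qed

lemma AE_start:
  assumes Q: "Measurable.pred N Q" and z0: "Q z0"
  shows "AE \<omega> in IT.PF.lim. Q (\<omega> 0)"
proof -
  let ?X = "{\<omega> \<in> space (PiM {0..<Suc 0} (\<lambda>_. N)). \<not> Q (\<omega> 0)}"
  let ?Y = "{\<omega>\<in>space (PiM UNIV (\<lambda>_::nat. N)). \<not> Q (\<omega> 0)}"
  have c1: "(\<lambda>\<omega>. \<omega> 0) \<in> measurable (PiM {0..<Suc 0} (\<lambda>_. N)) N" by (rule measurable_component_singleton) simp
  have c2: "(\<lambda>\<omega>. \<omega> 0) \<in> measurable (PiM UNIV (\<lambda>_::nat. N)) N" by (rule measurable_component_singleton) simp
  have X: "?X \<in> sets (PiM {0..<Suc 0} (\<lambda>_. N))" using measurable_compose[OF c1 Q] by measurable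
  have Y: "?Y \<in> sets (PiM UNIV (\<lambda>_. N))" using measurable_compose[OF c2 Q] by measurable
  have "emeasure (Cn (Suc 0)) ?X = (\<integral>\<^sup>+\<omega>. indicator ?X \<omega> \<partial>Cn (Suc 0))"
    using X by (intro nn_integral_indicator[symmetric]) (simp only: IT.sets_C[OF undefined_in_empty_product] add_0)
  also have "\<dots> = (\<integral>\<^sup>+\<omega>. (\<integral>\<^sup>+z. indicator ?X (fun_upd \<omega> 0 z) \<partial>ker 0 \<omega>) \<partial>Cn 0)"
    using X by (intro nn_integral_Cn_Suc) simp
  also have "\<dots> = (\<integral>\<^sup>+\<omega>. 0 \<partial>Cn 0)"
  proof (rule nn_integral_cong)
    fix \<omega>
    have "{z\<in>space N. Q z} \<in> sets N" using Q by measurable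
    then have "AE z in return N z0. Q z" using z0 start by (subst AE_return) (simp_all add: Q)
    then have "AE z in ker 0 \<omega>. indicator ?X (fun_upd \<omega> 0 z) = (0::ennreal)"
      unfolding ker_def if_True simp_thms by eventually_elim (simp add: indicator_def)
    then have "(\<integral>\<^sup>+z. indicator ?X (fun_upd \<omega> 0 z) \<partial>ker 0 \<omega>) = (\<integral>\<^sup>+z. 0 \<partial>ker 0 \<omega>)"
      by (rule nn_integral_cong_AE)
    then show "(\<integral>\<^sup>+z. indicator ?X (fun_upd \<omega> 0 z) \<partial>ker 0 \<omega>) = 0" by simp
  qed
  finally have "emeasure IT.PF.lim {\<omega>\<in>space (PiM UNIV (\<lambda>_. N)). restrict \<omega> {0..<Suc 0} \<in> ?X} = 0"
    unfolding emeasure_lim_cylinder[OF X] by simp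
  also have "{\<omega>\<in>space (PiM UNIV (\<lambda>_. N)). restrict \<omega> {0..<Suc 0} \<in> ?X} = ?Y"
  proof (intro Collect_cong conj_cong refl)
    fix \<omega> :: "nat \<Rightarrow> 'z" assume "\<omega> \<in> space (PiM UNIV (\<lambda>_. N))"
    then have "restrict \<omega> {0..<Suc 0} \<in> space (PiM {0..<Suc 0} (\<lambda>_. N))" by (simp add: space_PiM PiE_iff)
    then show "restrict \<omega> {0..<Suc 0} \<in> ?X \<longleftrightarrow> \<not> Q (\<omega> 0)" by simp
  qed
  finally have "emeasure IT.PF.lim ?Y = 0" .
  moreover have "?Y \<in> sets IT.PF.lim" using Y by (simp only: IT.PF.sets_lim)
  ultimately show ?thesis
    by (intro AE_I[of _ _ ?Y]) (simp_all only: IT.PF.space_lim order_refl)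
qed

lemma prob_space_lim: "prob_space IT.PF.lim"
proof (rule prob_spaceI)
  have "emeasure IT.PF.lim {\<omega>\<in>space (PiM UNIV (\<lambda>_. N)). restrict \<omega> {0..<0} \<in> space (PiM {0..<0} (\<lambda>_. N))}
      = emeasure (Cn 0) (space (PiM {0..<0} (\<lambda>_. N)))"
    by (rule emeasure_lim_cylinder) simp
  also have "\<dots> = 1" using prob_space.emeasure_space_1[OF IT.prob_space_C[OF undefined_in_empty_product, of 0]] by (simp add: IT.space_C)
  also have "{\<omega>\<in>space (PiM UNIV (\<lambda>_. N)). restrict \<omega> {0..<0::nat} \<in> space (PiM {0..<0} (\<lambda>_. N))} = space IT.PF.lim"
    by (simp add: IT.PF.space_lim space_PiM restrict_def)
  finally show "emeasure IT.PF.lim (space IT.PF.lim) = 1" .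
qed

end

section \<open>Value iteration\<close>

lemma measurable_finite_apply:
  fixes \<tau> :: "'q::finite \<Rightarrow> 's \<Rightarrow> 'r"
  assumes f: "f \<in> measurable M (count_space UNIV)" and g: "g \<in> measurable M (count_space UNIV)"
  shows "(\<lambda>x. \<tau> (f x) (g x)) \<in> measurable M (count_space UNIV)"
proof (rule measurable_compose_countable[OF _ f])
  show "(\<lambda>x. \<tau> q (g x)) \<in> measurable M (count_space UNIV)" for q
    by (rule measurable_compose[OF g]) simp
qed

lemma gmdp_trans_measurable:
  assumes "is_gmdp M" "f \<in> measurable N borel" "g \<in> measurable N borel"
  shows "(\<lambda>x. trans M (f x) (g x)) \<in> measurable N (prob_algebra borel)"
proof -
  have "(\<lambda>x. (f x, g x)) \<in> measurable N borel"
    using assms by (auto simp flip: borel_prod)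
  moreover have "(\<lambda>(x, u). trans M x u) \<in> measurable borel (prob_algebra borel)"
    using assms(1) by (simp add: is_gmdp_def)
  ultimately show ?thesis by (rule measurable_compose[THEN measurable_cong[THEN iffD1, rotated]]) simp
qed

lemma prob_algebra_bind:
  assumes "P \<in> space (prob_algebra S)" "k \<in> measurable S (prob_algebra T)"
  shows "P \<bind> k \<in> space (prob_algebra T)"
  using prob_space_bind'[OF assms] sets_bind'[OF assms] by (simp add: space_prob_algebra)

lemma prob_algebra_distr:
  assumes "P \<in> space (prob_algebra S)" "f \<in> measurable S T"
  shows "distr P T f \<in> space (prob_algebra T)"
  by (rule measurable_space[OF measurable_distr_prob_space[OF assms(2)] assms(1)])

locale abstraction =
  fixes Mh :: "('x::polish_space, 'u::polish_space, 'y::metric_space) gmdp"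
    and L :: "'y \<Rightarrow> 'ap::finite set" and F :: "'q::finite set" and \<tau> :: "'q \<Rightarrow> 'ap set \<Rightarrow> 'q"
    and \<mu> :: "'x \<times> 'q \<Rightarrow> 'u measure" and \<delta> :: real
  assumes Mh: "is_gmdp Mh" and L: "L \<in> measurable borel (count_space UNIV)"
    and \<mu>: "is_policy \<mu>" and \<delta>: "0 \<le> \<delta>"
begin

lemma label_measurable: "(\<lambda>x. L (out Mh x)) \<in> measurable borel (count_space UNIV)"
  using Mh by (intro measurable_compose[OF _ L]) (simp add: is_gmdp_def)

lemma policy_measurable: "\<mu> \<in> measurable (univ_alg XQ) (prob_algebra borel)"
  using \<mu> by (simp add: is_policy_def)

lemma policy_space: "\<mu> s \<in> space (prob_algebra borel)"
  using measurable_space[OF policy_measurable, of s] by (simp add: space_pair_measure)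

definition succ :: "'q \<Rightarrow> 'x \<Rightarrow> 'x \<times> 'q" where
  "succ q x' = (x', \<tau> q (L (out Mh x')))"

lemma succ_measurable: "succ q \<in> measurable borel XQ"
  unfolding succ_def[abs_def]
  by (rule measurable_Pair[OF measurable_ident_sets[OF refl] measurable_finite_apply[OF measurable_const label_measurable]]) simp

definition PK :: "'x \<times> 'q \<Rightarrow> ('x \<times> 'q) measure" where
  "PK s = prod_kernel Mh L \<tau> s (\<mu> s)"

lemma trans_measurable1: "trans Mh x \<in> measurable borel (prob_algebra borel)"
  using gmdp_trans_measurable[OF Mh, of "\<lambda>_. x" borel "\<lambda>u. u"] by simp

lemma PK_eq: "PK s = distr (\<mu> s \<bind> trans Mh (fst s)) XQ (succ (snd s))"
proof -
  have "space (\<mu> s) \<noteq> {}" using policy_space[of s] prob_space.not_empty by (auto simp: space_prob_algebra)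
  moreover have "trans Mh (fst s) \<in> measurable (\<mu> s) (subprob_algebra borel)"
    using measurable_prob_algebraD[OF trans_measurable1] policy_space[of s]
    by (simp add: space_prob_algebra cong: measurable_cong_sets)
  ultimately show ?thesis
    unfolding PK_def prod_kernel_def kmix_def succ_def[abs_def, symmetric]
    by (subst distr_bind[OF _ _ succ_measurable]) (simp_all add: succ_def[abs_def])
qed

lemma PK_measurable: "PK \<in> measurable (univ_alg XQ) (prob_algebra XQ)"
proof -
  have f: "fst \<in> measurable (univ_alg XQ) borel" "snd \<in> measurable (univ_alg XQ) (count_space UNIV)"
    by (auto intro: measurable_univ_alg_finer)
  have "(\<lambda>s. \<mu> s \<bind> trans Mh (fst s)) \<in> measurable (univ_alg XQ) (prob_algebra borel)"
  proof (rule measurable_bind_prob_space2[OF policy_measurable])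
    show "(\<lambda>(s, u). trans Mh (fst s) u) \<in> measurable (univ_alg XQ \<Otimes>\<^sub>M borel) (prob_algebra borel)"
      unfolding split_beta'
      by (rule gmdp_trans_measurable[OF Mh measurable_compose[OF measurable_fst f(1)] measurable_snd])
  qed
  then have "(\<lambda>s. distr (\<mu> s \<bind> trans Mh (fst s)) XQ (succ (snd s))) \<in> measurable (univ_alg XQ) (prob_algebra XQ)"
  proof (rule measurable_distr_prob_space2)
    have "(\<lambda>x. \<tau> (snd (fst x)) (L (out Mh (snd x)))) \<in> measurable (univ_alg XQ \<Otimes>\<^sub>M borel) (count_space UNIV)"
      by (rule measurable_finite_apply[OF measurable_compose[OF measurable_fst f(2)] measurable_compose[OF measurable_snd label_measurable]])
    from measurable_Pair[OF measurable_snd this]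
    have "(\<lambda>x. (snd x, \<tau> (snd (fst x)) (L (out Mh (snd x))))) \<in> measurable (univ_alg XQ \<Otimes>\<^sub>M borel) XQ" .
    then show "(\<lambda>(s, x'). succ (snd s) x') \<in> measurable (univ_alg XQ \<Otimes>\<^sub>M borel) XQ"
      by (simp add: succ_def split_beta')
  qed
  then show ?thesis by (simp add: PK_eq[abs_def])
qed

lemma PK_space: "PK s \<in> space (prob_algebra XQ)"
  using measurable_space[OF PK_measurable, of s] by (simp add: space_pair_measure)

definition pay :: "('x \<times> 'q \<Rightarrow> real) \<Rightarrow> 'x \<times> 'q \<Rightarrow> real" where
  "pay V s = max (indicator F (snd s)) (V s)"

definition admissible :: "('x \<times> 'q \<Rightarrow> real) \<Rightarrow> bool" where
  "admissible V \<longleftrightarrow> V \<in> borel_measurable (univ_alg XQ) \<and> (\<forall>s. 0 \<le> V s \<and> V s \<le> 1)"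

lemma pay_bounds: "admissible V \<Longrightarrow> 0 \<le> pay V s" "admissible V \<Longrightarrow> pay V s \<le> 1"
  by (cases s; simp add: pay_def admissible_def le_max_iff_disj)+

lemma pay_measurable:
  assumes "admissible V" shows "pay V \<in> borel_measurable (univ_alg XQ)"
proof -
  have "(\<lambda>s. indicat_real F (snd s)) \<in> borel_measurable (univ_alg XQ)"
    by (rule measurable_compose[OF measurable_univ_alg_finer[OF measurable_snd]]) simp
  then show ?thesis using assms unfolding pay_def[abs_def] admissible_def
    by (intro borel_measurable_max) auto
qed

text \<open>The completion of \<open>PK s\<close> has a sigma-algebra that varies with
  \<open>s\<close>, whereas that of \<open>uext (PK s)\<close> is the same for all \<open>s\<close>.
  The change of measure makes the operator an integral against a kernel.\<close>

lemma Tmu_eq: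
  assumes V: "admissible V"
  shows "ennreal (Tmu Mh L F \<tau> \<mu> V s) = (\<integral>\<^sup>+s'. ennreal (pay V s') \<partial>uext (PK s))"
    and "integrable (uext (PK s)) (pay V)"
    and "Tmu Mh L F \<tau> \<mu> V s = (\<integral>s'. pay V s' \<partial>uext (PK s))"
proof -
  have P: "prob_space (PK s)" "sets (PK s) = sets XQ" using PK_space[of s] by (auto simp: space_prob_algebra)
  interpret U: prob_space "uext (PK s)" by (rule prob_space_uext[OF P(1)])
  have m: "pay V \<in> borel_measurable (univ_alg (PK s))"
    using pay_measurable[OF V] by (simp add: univ_alg_cong[OF P(2)])
  have m': "pay V \<in> borel_measurable (uext (PK s))"
    using m by (subst measurable_cong_sets[OF sets_uext refl])
  show i: "integrable (uext (PK s)) (pay V)"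
    by (rule U.integrable_const_bound[where B=1]) (use pay_bounds[OF V] m' in auto)
  show e: "Tmu Mh L F \<tau> \<mu> V s = (\<integral>s'. pay V s' \<partial>uext (PK s))"
    unfolding integral_uext[OF P(1) m] by (simp add: Tmu_def pay_def[abs_def] PK_def)
  show "ennreal (Tmu Mh L F \<tau> \<mu> V s) = (\<integral>\<^sup>+s'. ennreal (pay V s') \<partial>uext (PK s))"
    unfolding e using pay_bounds[OF V] by (intro nn_integral_eq_integral[symmetric] i) auto
qed

lemma Tmu_bounds:
  assumes V: "admissible V"
  shows "0 \<le> Tmu Mh L F \<tau> \<mu> V s" "Tmu Mh L F \<tau> \<mu> V s \<le> 1"
proof -
  have P: "prob_space (PK s)" using PK_space[of s] by (auto simp: space_prob_algebra)
  interpret U: prob_space "uext (PK s)" by (rule prob_space_uext[OF P(1)])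
  show "0 \<le> Tmu Mh L F \<tau> \<mu> V s" unfolding Tmu_eq(3)[OF V] using pay_bounds[OF V] by (intro integral_nonneg_AE) auto
  have "(\<integral>s'. pay V s' \<partial>uext (PK s)) \<le> (\<integral>s'. 1 \<partial>uext (PK s))"
    using pay_bounds[OF V] by (intro integral_mono Tmu_eq(2)[OF V]) auto
  then show "Tmu Mh L F \<tau> \<mu> V s \<le> 1" unfolding Tmu_eq(3)[OF V] using U.prob_space by simp
qed

lemma admissible_step:
  assumes V: "admissible V" shows "admissible (Tmu_delta Mh L F \<tau> \<mu> \<delta> V)"
proof -
  have "(\<lambda>s. \<integral>\<^sup>+s'. ennreal (pay V s') \<partial>uext (PK s)) \<in> borel_measurable (univ_alg XQ)"
    using pay_measurable[OF V]
    by (intro measurable_compose[OF measurable_prob_algebraD[OF measurable_uext_univ_kernel[OF PK_measurable]]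
      nn_integral_measurable_subprob_algebra]) auto
  then have "(\<lambda>s. enn2real (\<integral>\<^sup>+s'. ennreal (pay V s') \<partial>uext (PK s))) \<in> borel_measurable (univ_alg XQ)"
    by simp
  then have "Tmu Mh L F \<tau> \<mu> V \<in> borel_measurable (univ_alg XQ)"
    unfolding Tmu_eq(1)[OF V, symmetric] by (simp add: Tmu_bounds[OF V])
  then show ?thesis unfolding admissible_def Tmu_delta_def[abs_def] clip01_def by auto
qed

definition V :: "nat \<Rightarrow> 'x \<times> 'q \<Rightarrow> real" where
  "V l = (Tmu_delta Mh L F \<tau> \<mu> \<delta> ^^ l) (\<lambda>_. 0)"

lemma V_0: "V 0 s = 0" by (simp add: V_def)

lemma V_Suc: "V (Suc l) = Tmu_delta Mh L F \<tau> \<mu> \<delta> (V l)" by (simp add: V_def)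

lemma V_admissible: "admissible (V l)"
proof (induction l)
  case 0 then show ?case by (simp add: admissible_def V_0[abs_def] cong: measurable_cong)
next
  case (Suc l) then show ?case unfolding V_Suc by (rule admissible_step)
qed

lemma V_bounds: "0 \<le> V l s" "V l s \<le> 1"
  using V_admissible[of l] unfolding admissible_def by blast+

lemma V_mono: "V l s \<le> V (Suc l) s"
proof (induction l arbitrary: s)
  case 0 then show ?case by (simp add: V_0 V_bounds)
next
  case (Suc l)
  have "pay (V l) s' \<le> pay (V (Suc l)) s'" for s' unfolding pay_def by (intro max.mono order_refl Suc)
  then have "Tmu Mh L F \<tau> \<mu> (V l) s \<le> Tmu Mh L F \<tau> \<mu> (V (Suc l)) s"
    unfolding Tmu_eq(3)[OF V_admissible] by (intro integral_mono Tmu_eq(2)[OF V_admissible])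
  then show ?case unfolding V_Suc[of l] V_Suc[of "Suc l"] Tmu_delta_def clip01_def
    by (intro min.mono max.mono order_refl diff_right_mono)
qed

text \<open>The iterates increase and are bounded, so \<open>lim\<close> denotes an actual limit and
  uniform bounds pass to it.\<close>

lemma V_inf_le:
  assumes "\<And>l. V l s \<le> c" shows "V_inf Mh L F \<tau> \<mu> \<delta> s \<le> c"
proof -
  have inc: "incseq (\<lambda>l. V l s)" by (intro incseq_SucI V_mono)
  have "\<forall>k. V k s \<le> 1" by (simp add: V_bounds)
  then obtain l where l: "(\<lambda>k. V k s) \<longlonglongrightarrow> l" by (rule incseq_convergent[OF inc])
  then have "V_inf Mh L F \<tau> \<mu> \<delta> s = l" unfolding V_inf_def V_def[symmetric] by (rule limI)
  then show ?thesis using LIMSEQ_le_const2[OF l, of c] assms by auto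
qed

text \<open>The subtraction in the operator absorbs the loss \<open>\<delta>\<close>. Clipping
  preserves the bound: \<open>J\<close> is nonnegative, and the cut at 1 only lowers the
  value.\<close>

lemma V_Suc_le:
  assumes "ennreal (Tmu Mh L F \<tau> \<mu> (V l) s) \<le> J + ennreal \<delta>"
  shows "ennreal (V (Suc l) s) \<le> J"
proof (cases "J = \<top>")
  case False
  then obtain j where j: "J = ennreal j" "0 \<le> j" by (cases J) auto
  have "Tmu Mh L F \<tau> \<mu> (V l) s \<le> j + \<delta>"
    using assms j \<delta> by (simp add: ennreal_plus[symmetric] del: ennreal_plus)
  then have "V (Suc l) s \<le> j" unfolding V_Suc Tmu_delta_def clip01_def using j by simp
  then show ?thesis using j by (simp add: ennreal_leI)
qed simp

end

section \<open>Closed loops\<close>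

lemma nn_integral_bind_uext:
  assumes P: "P \<in> space (prob_algebra T)" and g: "g \<in> measurable (univ_alg T) (prob_algebra N)"
    and f: "f \<in> borel_measurable N"
  shows "(\<integral>\<^sup>+x. f x \<partial>(uext P \<bind> g)) = (\<integral>\<^sup>+t. (\<integral>\<^sup>+x. f x \<partial>g t) \<partial>uext P)"
  by (rule nn_integral_bind[OF f]) (simp add: measurable_uext_cong[OF P] measurable_prob_algebraD[OF g])

lemma uext_return:
  assumes "x \<in> space S" shows "uext (return S x) = return (univ_alg S) x"
proof (rule uext_unique[symmetric])
  show "prob_space (return S x)" by (rule prob_space_return[OF assms])
  show "sets (return (univ_alg S) x) = sets (univ_alg (return S x))"
    using sets_univ_alg_cong[OF sets_return, of S x] by simp
qed (simp add: sets_univ_alg sets_le_univ_sets)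

text \<open>A step draws the memory, the input and the next state in turn. Measurability is
  established from the innermost draw outwards, over the spaces \<open>?S0\<close>,
  \<open>?S1\<close> and \<open>?S2\<close> of everything drawn so far.\<close>

lemma
  fixes C :: "('m, 'xc::polish_space, 'uc::polish_space) strategy" and M :: "('xc, 'uc, 'y::metric_space) gmdp"
  assumes C: "is_strategy Mm C" and M: "is_gmdp M"
  shows cl_step_measurable:
      "cl_step Mm C M \<in> measurable (univ_alg (Mm \<Otimes>\<^sub>M borel)) (prob_algebra (univ_alg (Mm \<Otimes>\<^sub>M borel)))"
    and nn_integral_cl_step:
      "z \<in> space (Mm \<Otimes>\<^sub>M borel) \<Longrightarrow> f \<in> borel_measurable (univ_alg (Mm \<Otimes>\<^sub>M borel)) \<Longrightarrow>
        (\<integral>\<^sup>+z'. f z' \<partial>cl_step Mm C M z) = (\<integral>\<^sup>+m'. \<integral>\<^sup>+u. \<integral>\<^sup>+x'. f (m', x')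
          \<partial>uext (trans M (snd z) u) \<partial>uext (cout C m') \<partial>uext (ctrans C (fst z) (snd z)))"
proof -
  let ?X = "borel :: 'xc measure" and ?U = "borel :: 'uc measure"
  let ?N = "univ_alg (Mm \<Otimes>\<^sub>M ?X)"
  let ?S0 = "Mm \<Otimes>\<^sub>M ?X"
  let ?S1 = "?S0 \<Otimes>\<^sub>M Mm"
  let ?S2 = "?S1 \<Otimes>\<^sub>M ?U"
  have k3: "(\<lambda>s. trans M (snd (fst (fst s))) (snd s)) \<in> measurable (univ_alg ?S2) (prob_algebra ?X)"
    by (intro measurable_univ_alg_finer gmdp_trans_measurable[OF M]) measurable
  have f3: "(\<lambda>(s, x'). return ?N (snd (fst s), x')) \<in> measurable (univ_alg (?S2 \<Otimes>\<^sub>M ?X)) (prob_algebra ?N)"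
  proof -
    have "(\<lambda>x. (snd (fst (fst x)), snd x)) \<in> measurable (?S2 \<Otimes>\<^sub>M ?X) (Mm \<Otimes>\<^sub>M ?X)" by measurable
    from measurable_compose[OF measurable_univ_alg_lift[OF this] measurable_return_prob_space]
    show ?thesis by (simp add: split_beta')
  qed
  note b3 = measurable_bind_uext[OF k3 f3]
  have cout: "cout C \<in> measurable (univ_alg Mm) (prob_algebra ?U)" using C by (simp add: is_strategy_def)
  have k2: "(\<lambda>s. cout C (snd s)) \<in> measurable (univ_alg ?S1) (prob_algebra ?U)"
    by (rule measurable_compose[OF measurable_univ_alg_lift[OF measurable_snd] cout])
  have f2: "(\<lambda>(s, u). uext (trans M (snd (fst s)) u) \<bind> (\<lambda>x'. return ?N (snd s, x')))
      \<in> measurable (univ_alg ?S2) (prob_algebra ?N)"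
    using b3 by (simp add: split_beta')
  note b2 = measurable_bind_uext[OF k2 f2]
  have k1: "(\<lambda>z. ctrans C (fst z) (snd z)) \<in> measurable (univ_alg ?S0) (prob_algebra Mm)"
    using C by (simp add: is_strategy_def split_beta')
  have f1: "(\<lambda>(z, m'). uext (cout C m') \<bind> (\<lambda>u. uext (trans M (snd z) u) \<bind> (\<lambda>x'. return ?N (m', x'))))
      \<in> measurable (univ_alg ?S1) (prob_algebra ?N)"
    using b2 by (simp add: split_beta')
  note b1 = measurable_bind_uext[OF k1 f1]
  then show "cl_step Mm C M \<in> measurable ?N (prob_algebra ?N)"
    by (simp add: cl_step_def[abs_def])
  assume z: "z \<in> space ?S0" and f: "f \<in> borel_measurable ?N"
  have tr: "trans M x u \<in> space (prob_algebra ?X)" for x u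
    using measurable_space[OF gmdp_trans_measurable[OF M measurable_const measurable_const, of x u "borel :: 'xc measure"]] by simp
  have ct: "ctrans C (fst z) (snd z) \<in> space (prob_algebra Mm)"
    using measurable_space[OF k1] z by auto
  have ctsp: "space (ctrans C (fst z) (snd z)) = space Mm"
    using ct by (auto simp: space_prob_algebra dest: sets_eq_imp_space_eq)
  have g1: "(\<lambda>m'. uext (cout C m') \<bind> (\<lambda>u. uext (trans M (snd z) u) \<bind> (\<lambda>x'. return ?N (m', x'))))
      \<in> measurable (univ_alg Mm) (prob_algebra ?N)"
    using measurable_compose[OF measurable_Pair_univ[OF z] f1] by simp
  have "(\<integral>\<^sup>+z'. f z' \<partial>cl_step Mm C M z) = (\<integral>\<^sup>+m'. (\<integral>\<^sup>+z'. f z' \<partial>(uext (cout C m') \<bind>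
      (\<lambda>u. uext (trans M (snd z) u) \<bind> (\<lambda>x'. return ?N (m', x'))))) \<partial>uext (ctrans C (fst z) (snd z)))"
    unfolding cl_step_def by (rule nn_integral_bind_uext[OF ct g1 f])
  also have "\<dots> = (\<integral>\<^sup>+m'. \<integral>\<^sup>+u. \<integral>\<^sup>+x'. f (m', x')
          \<partial>uext (trans M (snd z) u) \<partial>uext (cout C m') \<partial>uext (ctrans C (fst z) (snd z)))"
  proof (rule nn_integral_cong)
    fix m' assume "m' \<in> space (uext (ctrans C (fst z) (snd z)))"
    then have m': "m' \<in> space Mm" by (simp add: ctsp)
    then have zm: "(z, m') \<in> space ?S1" using z by (simp add: space_pair_measure)
    have co: "cout C m' \<in> space (prob_algebra ?U)" using measurable_space[OF cout] m' by auto
    have g2: "(\<lambda>u. uext (trans M (snd z) u) \<bind> (\<lambda>x'. return ?N (m', x'))) \<in> measurable (univ_alg ?U) (prob_algebra ?N)"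
      using measurable_compose[OF measurable_Pair_univ[OF zm] f2] by simp
    have g3: "(\<lambda>x'. return ?N (m', x')) \<in> measurable (univ_alg ?X) (prob_algebra ?N)"
      by (rule measurable_compose[OF measurable_Pair_univ[OF m'] measurable_return_prob_space])
    have "(\<integral>\<^sup>+z'. f z' \<partial>(uext (cout C m') \<bind> (\<lambda>u. uext (trans M (snd z) u) \<bind> (\<lambda>x'. return ?N (m', x')))))
        = (\<integral>\<^sup>+u. (\<integral>\<^sup>+z'. f z' \<partial>(uext (trans M (snd z) u) \<bind> (\<lambda>x'. return ?N (m', x')))) \<partial>uext (cout C m'))"
      by (rule nn_integral_bind_uext[OF co g2 f])
    also have "\<dots> = (\<integral>\<^sup>+u. (\<integral>\<^sup>+x'. (\<integral>\<^sup>+z'. f z' \<partial>return ?N (m', x')) \<partial>uext (trans M (snd z) u)) \<partial>uext (cout C m'))"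
      by (intro nn_integral_cong nn_integral_bind_uext[OF tr g3 f])
    also have "\<dots> = (\<integral>\<^sup>+u. (\<integral>\<^sup>+x'. f (m', x') \<partial>uext (trans M (snd z) u)) \<partial>uext (cout C m'))"
      by (intro nn_integral_cong nn_integral_return f) (simp add: m' space_pair_measure)
    finally show "(\<integral>\<^sup>+z'. f z' \<partial>(uext (cout C m') \<bind> (\<lambda>u. uext (trans M (snd z) u) \<bind> (\<lambda>x'. return ?N (m', x')))))
      = (\<integral>\<^sup>+u. (\<integral>\<^sup>+x'. f (m', x') \<partial>uext (trans M (snd z) u)) \<partial>uext (cout C m'))" .
  qed
  finally show "(\<integral>\<^sup>+z'. f z' \<partial>cl_step Mm C M z) = (\<integral>\<^sup>+m'. \<integral>\<^sup>+u. \<integral>\<^sup>+x'. f (m', x')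
          \<partial>uext (trans M (snd z) u) \<partial>uext (cout C m') \<partial>uext (ctrans C (fst z) (snd z)))" .
qed

section \<open>Automaton runs and a measurable interface\<close>

lemma dfa_run_measurable:
  fixes \<tau> :: "'q::finite \<Rightarrow> 'ap::finite set \<Rightarrow> 'q"
  assumes "\<And>i. (\<lambda>\<omega>. w \<omega> i) \<in> measurable S (count_space UNIV)"
  shows "(\<lambda>\<omega>. dfa_run \<tau> q0 (w \<omega>) n) \<in> measurable S (count_space UNIV)"
proof (induction n)
  case (Suc n) then show ?case unfolding dfa_run.simps by (rule measurable_finite_apply[OF _ assms])
qed simp

text \<open>The automaton kept in memory restarts from \<open>q0\<close> whenever its state is
  accepting. Starting accepting, it restarts at once, and up to the first later visit to
  \<open>F\<close> no further restart occurs; until then it agrees with the genuine run.\<close>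

lemma run_accepts:
  assumes init: "q 0 \<in> F" and step: "\<And>i. q (Suc i) = \<tau> (if q i \<in> F then q0 else q i) (w i)"
    and hit: "\<tau> (if q i \<in> F then q0 else q i) (w i) \<in> F"
  shows "dfa_accepts q0 F \<tau> w"
proof -
  define k where "k = (LEAST i. q (Suc i) \<in> F)"
  have k: "q (Suc k) \<in> F" unfolding k_def by (rule LeastI[of _ i]) (simp add: step hit)
  have nk: "q (Suc j) \<notin> F" if "j < k" for j using not_less_Least[OF that[unfolded k_def]] .
  have "q (Suc j) = dfa_run \<tau> q0 w (Suc j)" if "j \<le> k" for j
    using that
  proof (induction j)
    case 0 then show ?case using init by (simp add: step[of 0])
  next
    case (Suc j) then show ?case using nk[of j] by (simp add: step[of "Suc j"])
  qed
  then show ?thesis using k unfolding dfa_accepts_def by (metis order_refl)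
qed

text \<open>Turns an equation between two laws into countably many real equations, so that its
  solution set is Borel.\<close>

lemma separating_sets:
  obtains S :: "rat \<Rightarrow> 'a::polish_space set" where "\<And>r. S r \<in> sets borel"
    "\<And>P Q. P \<in> space (prob_algebra borel) \<Longrightarrow> Q \<in> space (prob_algebra borel) \<Longrightarrow>
      (\<And>r. measure P (S r) = measure Q (S r)) \<Longrightarrow> P = Q"
proof -
  obtain f :: "'a \<Rightarrow> real" and g where fg: "f \<in> borel_measurable borel" "g \<in> borel_measurable borel"
    "\<And>x. g (f x) = x" "\<And>x. 0 \<le> f x" "\<And>x. f x < 1"
    using polish_embedding_real by blast
  have D: "P = distr (distr P borel f) borel g" if P: "P \<in> space (prob_algebra borel)" for P :: "'a measure"
  proof -
    have p: "sets P = sets borel" using P by (auto simp: space_prob_algebra)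
    have f: "f \<in> borel_measurable P" using fg(1) p by (simp cong: measurable_cong_sets)
    have "distr (distr P borel f) borel g = distr P borel (\<lambda>x. x)"
      using fg f by (subst distr_distr) (auto simp: o_def)
    also have "\<dots> = distr P P (\<lambda>x. x)" using p by (intro distr_cong) auto
    finally show ?thesis by simp
  qed
  show thesis
  proof (rule that[of "\<lambda>r. f -` {..real_of_rat r}"])
    show "f -` {..real_of_rat r} \<in> sets borel" for r using measurable_sets[OF fg(1), of "{..real_of_rat r}"] by simp
    fix P Q :: "'a measure"
    assume P: "P \<in> space (prob_algebra borel)" and Q: "Q \<in> space (prob_algebra borel)"
      and eq: "\<And>r. measure P (f -` {..real_of_rat r}) = measure Q (f -` {..real_of_rat r})"
    have e: "emeasure (distr M borel f) {..real_of_rat r} = ennreal (measure M (f -` {..real_of_rat r}))"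
      if M: "M \<in> space (prob_algebra borel)" for M r
    proof -
      have p: "prob_space M" "sets M = sets borel" using M by (auto simp: space_prob_algebra)
      have sp: "space M = UNIV" using sets_eq_imp_space_eq[OF p(2)] by simp
      have f: "f \<in> borel_measurable M" using fg(1) p by (simp cong: measurable_cong_sets)
      show ?thesis using f
        by (simp add: emeasure_distr sp finite_measure.emeasure_eq_measure[OF prob_space.finite_measure[OF p(1)]])
    qed
    have "distr P borel f = distr Q borel f"
    proof (rule real_measure_eqI_rat)
      have "distr P borel f \<in> space (prob_algebra borel)" by (rule prob_algebra_distr[OF P fg(1)])
      then show "finite_measure (distr P borel f)" by (simp add: space_prob_algebra prob_space_def)
    qed (simp_all add: e P Q eq)
    then show "P = Q" using D[OF P] D[OF Q] by simp
  qed
qed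

text \<open>The interface function need not be measurable; a universally measurable replacement is selected.\<close>

lemma measurable_interface:
  fixes t :: "'xc::polish_space \<Rightarrow> 'uc::polish_space \<Rightarrow> 'xc measure"
    and \<rho> :: "'z::polish_space \<Rightarrow> 'xc measure" and p :: "'z \<Rightarrow> 'xc"
  assumes t: "(\<lambda>(x, u). t x u) \<in> measurable borel (prob_algebra borel)"
    and \<rho>: "\<rho> \<in> measurable borel (prob_algebra borel)" and p: "p \<in> measurable borel borel"
  obtains \<sigma> where "\<sigma> \<in> measurable (univ_alg borel) (prob_algebra borel)"
    "\<And>z \<nu>. \<nu> \<in> space (prob_algebra borel) \<Longrightarrow> \<nu> \<bind> t (p z) = \<rho> z \<Longrightarrow> \<sigma> z \<bind> t (p z) = \<rho> z"
proof -
  obtain enc :: "(rat \<Rightarrow> real) \<Rightarrow> 'uc measure" where enc: "enc \<in> measurable borel (prob_algebra borel)"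
    "\<And>\<nu>. \<nu> \<in> space (prob_algebra borel) \<Longrightarrow> \<exists>e. enc e = \<nu>"
    using polish_prob_code by blast
  obtain S :: "rat \<Rightarrow> 'xc set" where S: "\<And>r. S r \<in> sets borel"
    "\<And>P Q. P \<in> space (prob_algebra borel) \<Longrightarrow> Q \<in> space (prob_algebra borel) \<Longrightarrow>
      (\<And>r. measure P (S r) = measure Q (S r)) \<Longrightarrow> P = Q"
    using separating_sets by blast
  let ?A = "\<lambda>y. enc (snd y) \<bind> t (p (fst y))"
  have fs: "fst \<in> measurable (borel :: ('z \<times> (rat \<Rightarrow> real)) measure) borel"
    "snd \<in> measurable (borel :: ('z \<times> (rat \<Rightarrow> real)) measure) borel"
    by (intro borel_measurable_continuous_onI continuous_intros)+
  have A: "?A \<in> measurable borel (prob_algebra borel)"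
  proof (rule measurable_bind_prob_space2[OF measurable_compose[OF fs(2) enc(1)]])
    have "(\<lambda>x. (p (fst (fst x)), snd x)) \<in> measurable ((borel :: ('z \<times> (rat \<Rightarrow> real)) measure) \<Otimes>\<^sub>M (borel :: 'uc measure)) (borel \<Otimes>\<^sub>M borel)"
      by (intro measurable_Pair measurable_snd measurable_compose[OF measurable_compose[OF measurable_fst fs(1)] p])
    then have "(\<lambda>x. (p (fst (fst x)), snd x)) \<in> measurable ((borel :: ('z \<times> (rat \<Rightarrow> real)) measure) \<Otimes>\<^sub>M (borel :: 'uc measure)) borel"
      by (simp only: borel_prod)
    from measurable_compose[OF this t] show "(\<lambda>(y, u). t (p (fst y)) u) \<in> measurable ((borel :: ('z \<times> (rat \<Rightarrow> real)) measure) \<Otimes>\<^sub>M borel) (prob_algebra borel)"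
      by (simp add: split_beta')
  qed
  have B: "(\<lambda>y. \<rho> (fst y)) \<in> measurable (borel :: ('z \<times> (rat \<Rightarrow> real)) measure) (prob_algebra borel)"
    by (rule measurable_compose[OF fs(1) \<rho>])
  \<comment> \<open>Pairs of a situation and a code whose input law induces the prescribed law of
    the next state. A Borel set, to which the selection theorem applies.\<close>
  define G where "G = {y. ?A y = \<rho> (fst y)}"
  have "G = (\<Inter>r. {y \<in> space borel. measure (?A y) (S r) = measure (\<rho> (fst y)) (S r)})"
  proof (intro set_eqI iffI)
    fix y assume "y \<in> (\<Inter>r. {y \<in> space borel. measure (?A y) (S r) = measure (\<rho> (fst y)) (S r)})"
    then show "y \<in> G" unfolding G_def
      using S(2)[of "?A y" "\<rho> (fst y)"] measurable_space[OF A, of y] measurable_space[OF B, of y] by simp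
  qed (auto simp: G_def)
  also have "\<dots> \<in> sets borel"
  proof (intro sets.countable_INT'' borel_measurable_eq)
    show "(\<lambda>y. measure (?A y) (S r)) \<in> borel_measurable borel" for r
      by (rule measurable_compose[OF A measurable_measure_prob_algebra[OF S(1)]])
    show "(\<lambda>y. measure (\<rho> (fst y)) (S r)) \<in> borel_measurable (borel :: ('z \<times> (rat \<Rightarrow> real)) measure)" for r
      by (rule measurable_compose[OF B measurable_measure_prob_algebra[OF S(1)]])
  qed auto
  finally obtain s where s: "s \<in> measurable (univ_alg borel) borel" "\<And>z e. (z, e) \<in> G \<Longrightarrow> (z, s z) \<in> G"
    using Jankov_von_Neumann by blast
  show thesis
  proof (rule that[of "\<lambda>z. enc (s z)"])
    show "(\<lambda>z. enc (s z)) \<in> measurable (univ_alg borel) (prob_algebra borel)"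
      by (rule measurable_compose[OF s(1) enc(1)])
    fix z and \<nu> :: "'uc measure" assume \<nu>: "\<nu> \<in> space (prob_algebra borel)" "\<nu> \<bind> t (p z) = \<rho> z"
    then obtain e where "enc e = \<nu>" using enc(2) by blast
    then have "(z, e) \<in> G" using \<nu> by (simp add: G_def)
    then show "enc (s z) \<bind> t (p z) = \<rho> z" using s(2) by (fastforce simp: G_def)
  qed
qed


lemma measurable_univ_alg_pair: "(\<lambda>z. (fst z, snd z)) \<in> measurable (univ_alg (S \<Otimes>\<^sub>M T)) (univ_alg S \<Otimes>\<^sub>M T)"
  by (rule measurable_Pair[OF measurable_univ_alg_lift[OF measurable_fst] measurable_univ_alg_finer[OF measurable_snd]])

lemma nn_integral_uext_le_1:
  assumes "P \<in> space (prob_algebra S)" "\<And>x. f x \<le> 1"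
  shows "(\<integral>\<^sup>+x. f x \<partial>uext P) \<le> 1"
proof -
  have "(\<integral>\<^sup>+x. f x \<partial>uext P) \<le> (\<integral>\<^sup>+x. 1 \<partial>uext P)" by (intro nn_integral_mono assms)
  also have "\<dots> = 1" using assms(1) prob_space.emeasure_space_1[OF prob_space_uext[of P]] by (simp add: space_prob_algebra)
  finally show ?thesis .
qed

section \<open>The coupled strategy\<close>

text \<open>The parameter of \<open>K\<close> ranges over a completed space, since it enters through
  the universally measurable policy; in the observed concrete state the kernel is Borel measurable,
  which lets \<open>uext_bind\<close> apply to the disintegration.\<close>

locale coupling = abstraction Mh L F \<tau> \<mu> \<delta>
  for Mh :: "('x::polish_space, 'u::polish_space, 'y::metric_space) gmdp"
    and L :: "'y \<Rightarrow> 'ap::finite set" and F :: "'q::finite set" and \<tau> :: "'q \<Rightarrow> 'ap set \<Rightarrow> 'q"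
    and \<mu> :: "'x \<times> 'q \<Rightarrow> 'u measure" and \<delta> :: real +
  fixes q0 qF :: 'q and M :: "('xc::polish_space, 'uc::polish_space, 'y) gmdp"
    and R :: "('x \<times> 'xc) set" and W :: "'u \<Rightarrow> 'x \<Rightarrow> 'xc \<Rightarrow> ('x \<times> 'xc) measure"
    and \<sigma> :: "'u \<times> 'x \<times> 'xc \<Rightarrow> 'uc measure" and K :: "'x \<times> 'q \<times> 'xc \<Rightarrow> 'xc \<Rightarrow> 'x measure"
  assumes M: "is_gmdp M" and qF: "qF \<in> F" and R: "R \<in> sets borel"
    and W: "(\<lambda>(u, x, xc). W u x xc) \<in> measurable borel (prob_algebra borel)"
    and init_R: "(init Mh, init M) \<in> R"
    and out_eq: "(x, xc) \<in> R \<Longrightarrow> out Mh x = out M xc"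
    and marg: "(x, xc) \<in> R \<Longrightarrow> A \<in> sets borel \<Longrightarrow> emeasure (W u x xc) (A \<times> UNIV) = emeasure (trans Mh x u) A"
    and W_R: "(x, xc) \<in> R \<Longrightarrow> 1 - \<delta> \<le> measure (W u x xc) R"
    and \<sigma>: "\<sigma> \<in> measurable (univ_alg borel) (prob_algebra borel)"
    and \<sigma>_interface: "(x, xc) \<in> R \<Longrightarrow> \<sigma> (u, x, xc) \<bind> trans M xc = distr (W u x xc) borel snd"
    and K: "(\<lambda>(m, xc). K m xc) \<in> measurable (univ_alg (borel \<Otimes>\<^sub>M (count_space UNIV \<Otimes>\<^sub>M borel)) \<Otimes>\<^sub>M borel) (prob_algebra borel)"
    and K_disint: "\<mu> (x, q) \<bind> (\<lambda>u. W u x xc) =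
      distr (\<mu> (x, q) \<bind> (\<lambda>u. W u x xc)) borel snd \<bind>
        (\<lambda>y. distr (K (x, q, xc) y) (borel \<Otimes>\<^sub>M borel) (\<lambda>x'. (x', y)))"
begin

abbreviation "MM \<equiv> (borel :: 'x measure) \<Otimes>\<^sub>M ((count_space UNIV :: 'q measure) \<Otimes>\<^sub>M (borel :: 'xc measure))"
abbreviation "N \<equiv> univ_alg (MM \<Otimes>\<^sub>M (borel :: 'xc measure))"

lemma space_MM: "space MM = UNIV" by (simp add: space_pair_measure)

lemma M_label_measurable: "(\<lambda>x. L (out M x)) \<in> measurable borel (count_space UNIV)"
  using M by (intro measurable_compose[OF _ L]) (simp add: is_gmdp_def)

lemma M_trans_measurable: "trans M x \<in> measurable borel (prob_algebra borel)"
  using gmdp_trans_measurable[OF M, of "\<lambda>_. x" borel "\<lambda>u. u"] by simp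

lemma M_trans_space: "trans M x u \<in> space (prob_algebra borel)"
  using measurable_space[OF M_trans_measurable, of u x] by simp

lemma W_space: "W u x xc \<in> space (prob_algebra (borel \<Otimes>\<^sub>M borel))"
  using measurable_space[OF W, of "(u, x, xc)"] by (simp add: borel_prod)

lemma compl_R: "- R \<in> sets (borel \<Otimes>\<^sub>M borel)"
  unfolding borel_prod using sets.compl_sets[OF R] by (simp add: Compl_eq_Diff_UNIV)

lemma W_measurable: "(\<lambda>u. W u x xc) \<in> measurable borel (prob_algebra (borel \<Otimes>\<^sub>M borel))"
proof -
  have "(\<lambda>u. (u, x, xc)) \<in> measurable borel borel"
    by (intro borel_measurable_continuous_onI continuous_intros)
  from measurable_compose[OF this W] show ?thesis by (simp add: borel_prod)
qed

text \<open>An accepting state acts as a start signal. The initial memory is updated by reading the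
  initial concrete state before any input is drawn, and this first update has to yield the automaton
  state reached from \<open>q0\<close>.\<close>

definition nextq :: "'q \<Rightarrow> 'xc \<Rightarrow> 'q" where
  "nextq q xc = \<tau> (if q \<in> F then q0 else q) (L (out M xc))"

text \<open>After acceptance the memory is irrelevant, so memory states with accepting automaton component
  are free to serve as initial memory: from there the abstract state is reset to its initial value.\<close>

definition Kr :: "'x \<times> 'q \<times> 'xc \<Rightarrow> 'xc \<Rightarrow> 'x measure" where
  "Kr m xc = (if fst (snd m) \<in> F then return borel (init Mh) else K m xc)"

text \<open>The output depends on the memory alone, hence the concrete state just read is stored as
  third component for the interface. The next abstract state is drawn one step later, when the
  resulting concrete state has been observed.\<close>

definition C :: "('x \<times> 'q \<times> 'xc, 'xc, 'uc) strategy" where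
  "C = \<lparr>cinit = (init Mh, qF, init M),
    ctrans = \<lambda>m xc. distr (Kr m xc) MM (\<lambda>x. (x, nextq (fst (snd m)) xc, xc)),
    cout = \<lambda>m. uext (\<mu> (fst m, fst (snd m))) \<bind> (\<lambda>u. \<sigma> (u, fst m, snd (snd m)))\<rparr>"

lemma Kr_measurable: "(\<lambda>z. Kr (fst z) (snd z)) \<in> measurable (univ_alg MM \<Otimes>\<^sub>M borel) (prob_algebra borel)"
proof -
  have "(\<lambda>z. fst (snd (fst z))) \<in> measurable (univ_alg MM \<Otimes>\<^sub>M (borel :: 'xc measure)) (count_space UNIV)"
    by (rule measurable_compose[OF measurable_fst measurable_univ_alg_finer]) measurable
  then have "{z \<in> space (univ_alg MM \<Otimes>\<^sub>M (borel :: 'xc measure)). fst (snd (fst z)) \<in> F} \<in> sets (univ_alg MM \<Otimes>\<^sub>M borel)"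
    by measurable
  moreover have "return borel (init Mh) \<in> space (prob_algebra borel)"
    using measurable_space[OF measurable_return_prob_space, of "init Mh" borel] by simp
  moreover have "(\<lambda>z. K (fst z) (snd z)) \<in> measurable (univ_alg MM \<Otimes>\<^sub>M borel) (prob_algebra borel)"
    using K by (simp add: split_beta')
  ultimately show ?thesis unfolding Kr_def by (intro measurable_If measurable_const)
qed

lemma nextq_measurable:
  assumes "f \<in> measurable S (count_space UNIV)" "g \<in> measurable S borel"
  shows "(\<lambda>x. nextq (f x) (g x)) \<in> measurable S (count_space UNIV)"
proof -
  have 1: "(\<lambda>x. if f x \<in> F then q0 else f x) \<in> measurable S (count_space UNIV)"
    by (rule measurable_compose[OF assms(1)]) simp
  have 2: "(\<lambda>x. L (out M (g x))) \<in> measurable S (count_space UNIV)"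
    by (rule measurable_compose[OF assms(2) M_label_measurable])
  show ?thesis unfolding nextq_def by (rule measurable_finite_apply[OF 1 2])
qed

lemma ctrans_measurable: "(\<lambda>(m, x). ctrans C m x) \<in> measurable N (prob_algebra MM)"
proof -
  have q: "(\<lambda>z. nextq (fst (snd (fst (fst z)))) (snd (fst z))) \<in> measurable ((univ_alg MM \<Otimes>\<^sub>M (borel :: 'xc measure)) \<Otimes>\<^sub>M (borel :: 'x measure)) (count_space UNIV)"
  proof (rule nextq_measurable)
    have "(\<lambda>m. fst (snd m)) \<in> measurable (univ_alg MM) (count_space UNIV)"
      by (rule measurable_univ_alg_finer) measurable
    from measurable_compose[OF measurable_compose[OF measurable_fst measurable_fst] this]
    show "(\<lambda>z. fst (snd (fst (fst z)))) \<in> measurable ((univ_alg MM \<Otimes>\<^sub>M (borel :: 'xc measure)) \<Otimes>\<^sub>M (borel :: 'x measure)) (count_space UNIV)" .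
  qed (rule measurable_compose[OF measurable_fst measurable_snd])
  have "(\<lambda>z. distr (Kr (fst z) (snd z)) MM (\<lambda>x. (x, nextq (fst (snd (fst z))) (snd z), snd z)))
      \<in> measurable (univ_alg MM \<Otimes>\<^sub>M borel) (prob_algebra MM)"
  proof (rule measurable_distr_prob_space2[OF Kr_measurable])
    from measurable_Pair[OF measurable_snd measurable_Pair[OF q measurable_compose[OF measurable_fst measurable_snd]]]
    show "(\<lambda>(z, x). (x, nextq (fst (snd (fst z))) (snd z), snd z))
      \<in> measurable ((univ_alg MM \<Otimes>\<^sub>M borel) \<Otimes>\<^sub>M borel) MM" by (simp add: split_beta')
  qed
  from measurable_compose[OF measurable_univ_alg_pair this] show ?thesis by (simp add: C_def split_beta')
qed

lemma policy_mem_measurable: "(\<lambda>m. \<mu> (fst m, fst (snd m))) \<in> measurable (univ_alg MM) (prob_algebra borel)"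
proof -
  have "(\<lambda>m. (fst m, fst (snd m))) \<in> measurable MM XQ" by measurable
  from measurable_compose[OF measurable_univ_alg_lift[OF this] policy_measurable] show ?thesis .
qed

lemma cout_measurable: "cout C \<in> measurable (univ_alg MM) (prob_algebra borel)"
proof -
  have "(\<lambda>x. (snd x, fst (fst x), snd (snd (fst x)))) \<in> measurable (MM \<Otimes>\<^sub>M (borel :: 'u measure)) (borel \<Otimes>\<^sub>M (borel \<Otimes>\<^sub>M borel))"
    by measurable
  then have "(\<lambda>x. (snd x, fst (fst x), snd (snd (fst x)))) \<in> measurable (MM \<Otimes>\<^sub>M (borel :: 'u measure)) borel"
    by (simp add: borel_prod)
  from measurable_compose[OF measurable_univ_alg_lift[OF this] \<sigma>]
  have "(\<lambda>(m, u). \<sigma> (u, fst m, snd (snd m))) \<in> measurable (univ_alg (MM \<Otimes>\<^sub>M borel)) (prob_algebra borel)"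
    by (simp add: split_beta')
  from measurable_bind_uext[OF policy_mem_measurable this] show ?thesis by (simp add: C_def)
qed

lemma strategy: "is_strategy MM C"
  using ctrans_measurable cout_measurable by (simp add: is_strategy_def)

text \<open>The abstract input drawn inside \<open>cout\<close> is forgotten, so conditioning on the
  observed concrete state refers to the coupling averaged over that input.\<close>

definition Wb :: "'x \<Rightarrow> 'q \<Rightarrow> 'xc \<Rightarrow> ('x \<times> 'xc) measure" where
  "Wb x q xc = \<mu> (x, q) \<bind> (\<lambda>u. W u x xc)"

lemma Wb_space: "Wb x q xc \<in> space (prob_algebra (borel \<Otimes>\<^sub>M borel))"
  unfolding Wb_def by (rule prob_algebra_bind[OF policy_space W_measurable])

lemma distr_Wb:
  assumes f: "f \<in> measurable (borel \<Otimes>\<^sub>M borel) T"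
  shows "distr (Wb x q xc) T f = \<mu> (x, q) \<bind> (\<lambda>u. distr (W u x xc) T f)"
proof -
  have "space (\<mu> (x, q)) \<noteq> {}" using policy_space[of "(x, q)"] prob_space.not_empty by (auto simp: space_prob_algebra)
  moreover have "(\<lambda>u. W u x xc) \<in> measurable (\<mu> (x, q)) (subprob_algebra (borel \<Otimes>\<^sub>M borel))"
    using measurable_prob_algebraD[OF W_measurable] policy_space[of "(x, q)"]
    by (simp add: space_prob_algebra cong: measurable_cong_sets)
  ultimately show ?thesis unfolding Wb_def by (subst distr_bind[OF _ _ f]) simp_all
qed

lemma Wb_fst:
  assumes "(x, xc) \<in> R"
  shows "distr (Wb x q xc) borel fst = \<mu> (x, q) \<bind> trans Mh x"
proof -
  have "distr (W u x xc) borel fst = trans Mh x u" for u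
  proof (rule measure_eqI)
    have t: "trans Mh x u \<in> space (prob_algebra borel)" using measurable_space[OF trans_measurable1, of u x] by simp
    then show "sets (distr (W u x xc) borel fst) = sets (trans Mh x u)" by (simp add: space_prob_algebra)
    fix A assume "A \<in> sets (distr (W u x xc) borel fst)"
    then have A: "A \<in> sets borel" by simp
    have w: "sets (W u x xc) = sets (borel \<Otimes>\<^sub>M borel)" using W_space by (simp add: space_prob_algebra)
    have f: "fst \<in> measurable (W u x xc) borel" using w by (simp cong: measurable_cong_sets)
    have "fst -` A \<inter> space (W u x xc) = A \<times> UNIV" using sets_eq_imp_space_eq[OF w] by (auto simp: space_pair_measure)
    then show "emeasure (distr (W u x xc) borel fst) A = emeasure (trans Mh x u) A"
      using marg[OF assms A, of u] by (simp add: emeasure_distr[OF f A])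
  qed
  then show ?thesis by (subst distr_Wb[OF measurable_fst]) simp
qed

lemma cout_trans:
  assumes r: "(x, xc) \<in> R"
  shows "cout C (x, q, xc) \<bind> trans M xc = distr (Wb x q xc) borel snd"
proof -
  let ?\<mu> = "\<mu> (x, q)"
  have \<sigma>1: "(\<lambda>u. \<sigma> (u, x, xc)) \<in> measurable (univ_alg borel) (prob_algebra borel)"
  proof -
    have "(\<lambda>u. (u, x, xc)) \<in> measurable borel borel"
      by (intro borel_measurable_continuous_onI continuous_intros)
    from measurable_compose[OF measurable_univ_alg_lift[OF this] \<sigma>] show ?thesis .
  qed
  have \<sigma>2: "(\<lambda>u. \<sigma> (u, x, xc)) \<in> measurable (uext ?\<mu>) (subprob_algebra borel)"
    using measurable_prob_algebraD[OF \<sigma>1] by (simp add: measurable_uext_cong[OF policy_space])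
  have D: "(\<lambda>u. distr (W u x xc) borel snd) \<in> measurable borel (prob_algebra borel)"
    by (rule measurable_compose[OF W_measurable measurable_distr_prob_space[OF measurable_snd]])
  have "cout C (x, q, xc) \<bind> trans M xc = uext ?\<mu> \<bind> (\<lambda>u. \<sigma> (u, x, xc) \<bind> trans M xc)"
    unfolding C_def by (simp add: bind_assoc[OF \<sigma>2 measurable_prob_algebraD[OF M_trans_measurable]])
  also have "\<dots> = uext ?\<mu> \<bind> (\<lambda>u. distr (W u x xc) borel snd)" by (simp add: \<sigma>_interface[OF r])
  also have "\<dots> = ?\<mu> \<bind> (\<lambda>u. distr (W u x xc) borel snd)"
  proof (rule measure_eqI)
    note U = uext_in_prob_algebra[OF policy_space[of "(x, q)"]]
    have sU: "sets (uext ?\<mu> \<bind> (\<lambda>u. distr (W u x xc) borel snd)) = sets borel"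
      by (rule sets_bind'[OF U measurable_univ_alg_finer[OF D]])
    then show "sets (uext ?\<mu> \<bind> (\<lambda>u. distr (W u x xc) borel snd)) = sets (?\<mu> \<bind> (\<lambda>u. distr (W u x xc) borel snd))"
      using sets_bind'[OF policy_space[of "(x, q)"] D] by simp
    fix A assume "A \<in> sets (uext ?\<mu> \<bind> (\<lambda>u. distr (W u x xc) borel snd))"
    then have A: "A \<in> sets borel" by (simp add: sU)
    have "(\<lambda>u. emeasure (distr (W u x xc) borel snd) A) \<in> borel_measurable borel"
      by (rule measurable_emeasure_kernel[OF measurable_prob_algebraD[OF D] A])
    then show "emeasure (uext ?\<mu> \<bind> (\<lambda>u. distr (W u x xc) borel snd)) A = emeasure (?\<mu> \<bind> (\<lambda>u. distr (W u x xc) borel snd)) A"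
      unfolding emeasure_bind_prob_algebra[OF U measurable_univ_alg_finer[OF D] A] emeasure_bind_prob_algebra[OF policy_space D A]
      by (rule nn_integral_uext_sets[OF policy_space])
  qed
  also have "\<dots> = distr (Wb x q xc) borel snd" by (rule distr_Wb[OF measurable_snd, symmetric])
  finally show ?thesis .
qed

lemma Wb_compl_R:
  assumes r: "(x, xc) \<in> R"
  shows "emeasure (Wb x q xc) (- R) \<le> ennreal \<delta>"
proof -
  have le: "emeasure (W u x xc) (- R) \<le> ennreal \<delta>" for u
  proof -
    have w: "prob_space (W u x xc)" "sets (W u x xc) = sets borel" using W_space[of u x xc] by (auto simp: space_prob_algebra borel_prod)
    interpret w: prob_space "W u x xc" by fact
    have sp: "space (W u x xc) = UNIV" using sets_eq_imp_space_eq[OF w(2)] by simp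
    have "measure (W u x xc) (- R) = 1 - measure (W u x xc) R"
      using w.prob_compl[of R] R w(2) sp by (simp add: Compl_eq_Diff_UNIV)
    then have "measure (W u x xc) (- R) \<le> \<delta>" using W_R[OF r, of u] by simp
    then show ?thesis by (simp add: w.emeasure_eq_measure ennreal_leI)
  qed
  have "emeasure (Wb x q xc) (- R) = (\<integral>\<^sup>+u. emeasure (W u x xc) (- R) \<partial>\<mu> (x, q))"
    unfolding Wb_def by (rule emeasure_bind_prob_algebra[OF policy_space W_measurable compl_R])
  also have "\<dots> \<le> (\<integral>\<^sup>+u. ennreal \<delta> \<partial>\<mu> (x, q))" by (intro nn_integral_mono le)
  also have "\<dots> = ennreal \<delta>"
    using policy_space[of "(x, q)"] prob_space.emeasure_space_1[of "\<mu> (x, q)"] by (simp add: space_prob_algebra)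
  finally show ?thesis .
qed

text \<open>A pair outside the relation is credited with 0. All later behaviour there is given up,
  so leaving \<open>R\<close> costs its probability and nothing has to be known about the strategy
  afterwards.\<close>

definition g :: "nat \<Rightarrow> 'x \<times> 'q \<times> 'xc \<Rightarrow> ennreal" where
  "g l m = indicator R (fst m, snd (snd m)) * ennreal (pay (V l) (fst m, fst (snd m)))"

lemma g_measurable: "g l \<in> borel_measurable (univ_alg MM)"
proof -
  have "(\<lambda>m. (fst m, snd (snd m))) \<in> measurable MM (borel \<Otimes>\<^sub>M borel)" by measurable
  then have "(\<lambda>m. (fst m, snd (snd m))) \<in> measurable MM borel" by (simp add: borel_prod)
  from measurable_compose[OF measurable_univ_alg_finer[OF this] borel_measurable_indicator[OF R]]
  have 1: "(\<lambda>m. indicator R (fst m, snd (snd m)) :: ennreal) \<in> borel_measurable (univ_alg MM)" .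
  have "(\<lambda>m. (fst m, fst (snd m))) \<in> measurable MM XQ" by measurable
  from measurable_compose[OF measurable_univ_alg_lift[OF this] pay_measurable[OF V_admissible]]
  have "(\<lambda>m. pay (V l) (fst m, fst (snd m))) \<in> borel_measurable (univ_alg MM)" .
  then have 2: "(\<lambda>m. ennreal (pay (V l) (fst m, fst (snd m)))) \<in> borel_measurable (univ_alg MM)"
    by (rule measurable_compose[OF _ measurable_ennreal])
  show ?thesis unfolding g_def[abs_def] using 1 2 by measurable
qed

lemma pay_le_1: "ennreal (pay (V l) s) \<le> 1"
  using ennreal_leI[OF pay_bounds(2)[OF V_admissible, of l s]] by simp

lemma g_le_1: "g l m \<le> 1"
  using pay_le_1 by (simp add: g_def indicator_def)

text \<open>Chain states hold the memory before it has read the current concrete state, so the value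
  is averaged over the pending update.\<close>

definition v :: "nat \<Rightarrow> ('x \<times> 'q \<times> 'xc) \<times> 'xc \<Rightarrow> ennreal" where
  "v l z = (\<integral>\<^sup>+m'. g l m' \<partial>uext (ctrans C (fst z) (snd z)))"

lemma v_measurable: "v l \<in> borel_measurable N"
proof -
  have "(\<lambda>z. ctrans C (fst z) (snd z)) \<in> measurable N (prob_algebra MM)"
    using ctrans_measurable by (simp add: split_beta')
  from measurable_compose[OF measurable_prob_algebraD[OF measurable_uext_univ_kernel[OF this]] nn_integral_measurable_subprob_algebra[OF g_measurable]]
  show ?thesis by (simp add: v_def[abs_def])
qed

lemma Kr_space: "Kr m xc \<in> space (prob_algebra borel)"
  using measurable_space[OF Kr_measurable, of "(m, xc)"] by (simp add: space_pair_measure)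

lemma ctrans_distr_measurable: "(\<lambda>x. (x, q, xc)) \<in> measurable borel MM" by simp

lemma nn_integral_ctrans:
  assumes f: "f \<in> borel_measurable (univ_alg MM)"
  shows "(\<integral>\<^sup>+m'. f m' \<partial>uext (ctrans C m xc)) = (\<integral>\<^sup>+x. f (x, nextq (fst (snd m)) xc, xc) \<partial>uext (Kr m xc))"
proof -
  have u: "uext (ctrans C m xc) = distr (uext (Kr m xc)) (univ_alg MM) (\<lambda>x. (x, nextq (fst (snd m)) xc, xc))"
    unfolding C_def using distr_uext[OF Kr_space ctrans_distr_measurable] by simp
  have "(\<lambda>x. (x, nextq (fst (snd m)) xc, xc)) \<in> measurable (uext (Kr m xc)) (univ_alg MM)"
    unfolding measurable_uext_cong[OF Kr_space] by (rule measurable_univ_alg_lift[OF ctrans_distr_measurable])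
  then show ?thesis unfolding u using f by (subst nn_integral_distr) simp_all
qed

lemma v_eq: "v l (m, xc) = (\<integral>\<^sup>+x. g l (x, nextq (fst (snd m)) xc, xc) \<partial>uext (Kr m xc))"
  unfolding v_def by (simp add: nn_integral_ctrans[OF g_measurable])

lemma v_le_1: "v l z \<le> 1"
  by (cases z) (simp add: v_eq nn_integral_uext_le_1[OF Kr_space g_le_1])

text \<open>The disintegration is an identity of Borel laws; extending both sides by
  \<open>uext_bind\<close> makes it available for universally measurable integrands.\<close>

lemma disintegrated_integral:
  assumes G: "G \<in> borel_measurable (univ_alg (borel \<Otimes>\<^sub>M borel))"
  shows "(\<integral>\<^sup>+w. G w \<partial>uext (Wb x q xc)) =
    (\<integral>\<^sup>+y. (\<integral>\<^sup>+x'. G (x', y) \<partial>uext (K (x, q, xc) y)) \<partial>uext (distr (Wb x q xc) borel snd))"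
proof -
  let ?k = "\<lambda>y. distr (K (x, q, xc) y) (borel \<Otimes>\<^sub>M borel) (\<lambda>x'. (x', y))"
  let ?P = "distr (Wb x q xc) borel snd"
  have P: "?P \<in> space (prob_algebra borel)" by (rule prob_algebra_distr[OF Wb_space measurable_snd])
  have Km: "K (x, q, xc) \<in> measurable borel (prob_algebra borel)"
    using measurable_compose[OF measurable_Pair1' K, of "(x, q, xc)"] by (simp add: space_pair_measure)
  have Ks: "K (x, q, xc) y \<in> space (prob_algebra borel)" for y using measurable_space[OF Km, of y] by simp
  have pm: "(\<lambda>x'. (x', y)) \<in> measurable borel (borel \<Otimes>\<^sub>M borel)" for y :: 'xc by simp
  have km: "?k \<in> measurable borel (prob_algebra (borel \<Otimes>\<^sub>M borel))"
    by (rule measurable_distr_prob_space2[OF Km]) simp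
  have "Wb x q xc = ?P \<bind> ?k" unfolding Wb_def by (rule K_disint)
  then have "uext (Wb x q xc) = uext ?P \<bind> (\<lambda>y. uext (?k y))"
    using uext_bind[OF P km] by simp
  then have "(\<integral>\<^sup>+w. G w \<partial>uext (Wb x q xc)) = (\<integral>\<^sup>+y. (\<integral>\<^sup>+w. G w \<partial>uext (?k y)) \<partial>uext ?P)"
    using nn_integral_bind_uext[OF P measurable_uext_kernel[OF km] G] by simp
  also have "\<dots> = (\<integral>\<^sup>+y. (\<integral>\<^sup>+x'. G (x', y) \<partial>uext (K (x, q, xc) y)) \<partial>uext ?P)"
  proof (rule nn_integral_cong)
    fix y
    have m: "(\<lambda>x'. (x', y)) \<in> measurable (uext (K (x, q, xc) y)) (univ_alg (borel \<Otimes>\<^sub>M borel))"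
      unfolding measurable_uext_cong[OF Ks] by (rule measurable_univ_alg_lift[OF pm])
    show "(\<integral>\<^sup>+w. G w \<partial>uext (?k y)) = (\<integral>\<^sup>+x'. G (x', y) \<partial>uext (K (x, q, xc) y))"
      unfolding distr_uext[OF Ks pm, symmetric] using m G by (subst nn_integral_distr) simp_all
  qed
  finally show ?thesis .
qed

text \<open>The closed-loop side is an integral over the coupling with the automaton moved by the
  concrete label; the operator is the integral over its abstract marginal with the abstract label.
  On \<open>R\<close> the labels agree, and off \<open>R\<close> the payoff is at most 1 on a set of
  mass at most \<open>\<delta>\<close>.\<close>

lemma coupled_step:
  assumes r: "(x, xc) \<in> R" and q: "q \<notin> F"
  shows "ennreal (V (Suc l) (x, q)) \<le>
    (\<integral>\<^sup>+u. (\<integral>\<^sup>+xc'. v l ((x, q, xc), xc') \<partial>uext (trans M xc u)) \<partial>uext (cout C (x, q, xc)))" (is "_ \<le> ?J")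
proof -
  let ?m = "(x, q, xc)"
  let ?G = "\<lambda>w. g l (fst w, \<tau> q (L (out M (snd w))), snd w)"
  let ?c = "\<lambda>x'. ennreal (pay (V l) (succ q x'))"
  have Gm: "?G \<in> borel_measurable (univ_alg (borel \<Otimes>\<^sub>M borel))"
  proof -
    have "(\<lambda>w. \<tau> q (L (out M (snd w)))) \<in> measurable ((borel :: 'x measure) \<Otimes>\<^sub>M borel) (count_space UNIV)"
      by (rule measurable_finite_apply[OF measurable_const measurable_compose[OF measurable_snd M_label_measurable]]) simp
    from measurable_Pair[OF measurable_fst measurable_Pair[OF this measurable_snd]]
    have "(\<lambda>w. (fst w, \<tau> q (L (out M (snd w))), snd w)) \<in> measurable (borel \<Otimes>\<^sub>M borel) MM" .
    from measurable_compose[OF measurable_univ_alg_lift[OF this] g_measurable] show ?thesis .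
  qed
  have vm: "(\<lambda>xc'. v l (?m, xc')) \<in> borel_measurable (univ_alg borel)"
    by (rule measurable_compose[OF measurable_Pair_univ v_measurable]) (simp add: space_MM)
  have co: "cout C ?m \<in> space (prob_algebra borel)"
    using measurable_space[OF cout_measurable, of ?m] by (simp add: space_pair_measure)
  have "?J = (\<integral>\<^sup>+xc'. v l (?m, xc') \<partial>(uext (cout C ?m) \<bind> (\<lambda>u. uext (trans M xc u))))"
    by (rule nn_integral_bind_uext[OF co measurable_uext_kernel[OF M_trans_measurable] vm, symmetric])
  also have "\<dots> = (\<integral>\<^sup>+xc'. v l (?m, xc') \<partial>uext (distr (Wb x q xc) borel snd))"
    unfolding uext_bind[OF co M_trans_measurable] cout_trans[OF r] ..
  \<comment> \<open>Since \<open>q\<close> is not accepting, the reset is inactive: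
    \<open>Kr\<close> is \<open>K\<close>, and \<open>nextq\<close> continues from
    \<open>q\<close>.\<close>
  also have "\<dots> = (\<integral>\<^sup>+y. (\<integral>\<^sup>+x'. ?G (x', y) \<partial>uext (K ?m y)) \<partial>uext (distr (Wb x q xc) borel snd))"
    using q by (simp add: v_eq Kr_def nextq_def)
  also have "\<dots> = (\<integral>\<^sup>+w. ?G w \<partial>uext (Wb x q xc))"
    by (rule disintegrated_integral[OF Gm, symmetric])
  finally have J: "?J = (\<integral>\<^sup>+w. ?G w \<partial>uext (Wb x q xc))" .
  have cm: "?c \<in> borel_measurable (univ_alg borel)"
    by (rule measurable_compose[OF measurable_compose[OF measurable_univ_alg_lift[OF succ_measurable] pay_measurable[OF V_admissible]] measurable_ennreal])
  have T: "\<mu> (x, q) \<bind> trans Mh x \<in> space (prob_algebra borel)"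
    by (rule prob_algebra_bind[OF policy_space trans_measurable1])
  have pm: "(\<lambda>s. ennreal (pay (V l) s)) \<in> borel_measurable (univ_alg XQ)"
    by (rule measurable_compose[OF pay_measurable[OF V_admissible] measurable_ennreal])
  have "ennreal (Tmu Mh L F \<tau> \<mu> (V l) (x, q)) = (\<integral>\<^sup>+s'. ennreal (pay (V l) s') \<partial>uext (PK (x, q)))"
    by (rule Tmu_eq(1)[OF V_admissible])
  also have "\<dots> = (\<integral>\<^sup>+x'. ?c x' \<partial>uext (\<mu> (x, q) \<bind> trans Mh x))"
  proof -
    have "succ q \<in> measurable (uext (\<mu> (x, q) \<bind> trans Mh x)) (univ_alg XQ)"
      unfolding measurable_uext_cong[OF T] by (rule measurable_univ_alg_lift[OF succ_measurable])
    then show ?thesis unfolding PK_eq fst_conv snd_conv distr_uext[OF T succ_measurable, symmetric]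
      using pm by (subst nn_integral_distr) simp_all
  qed
  also have "\<dots> = (\<integral>\<^sup>+w. ?c (fst w) \<partial>uext (Wb x q xc))"
  proof -
    have "fst \<in> measurable (uext (Wb x q xc)) (univ_alg borel)"
      unfolding measurable_uext_cong[OF Wb_space] by (rule measurable_univ_alg_lift[OF measurable_fst])
    then show ?thesis unfolding Wb_fst[OF r, of q, symmetric] distr_uext[OF Wb_space measurable_fst, symmetric]
      using cm by (subst nn_integral_distr) simp_all
  qed
  also have "\<dots> \<le> (\<integral>\<^sup>+w. ?G w + indicator (- R) w \<partial>uext (Wb x q xc))"
  proof (rule nn_integral_mono)
    fix w :: "'x \<times> 'xc"
    obtain a b where w: "w = (a, b)" by (cases w)
    show "?c (fst w) \<le> ?G w + indicator (- R) w"
    proof (cases "w \<in> R")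
      case True
      then have "out Mh a = out M b" using out_eq w by simp
      then have "?c (fst w) = ?G w" using True by (simp add: w g_def succ_def)
      then show ?thesis by simp
    next
      case False
      then show ?thesis using pay_le_1[of l "succ q (fst w)"] by (simp add: add_increasing)
    qed
  qed
  also have "\<dots> = (\<integral>\<^sup>+w. ?G w \<partial>uext (Wb x q xc)) + emeasure (uext (Wb x q xc)) (- R)"
  proof -
    have "?G \<in> borel_measurable (uext (Wb x q xc))" unfolding measurable_uext_cong[OF Wb_space] by (rule Gm)
    moreover have "- R \<in> sets (uext (Wb x q xc))"
      using compl_R Wb_space[of x q xc] sets_univ_alg_cong[of "Wb x q xc" "borel \<Otimes>\<^sub>M borel"]
      by (simp add: sets_uext space_prob_algebra sets_univ_alg sets_le_univ_sets)
    ultimately show ?thesis by (subst nn_integral_add) simp_all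
  qed
  also have "emeasure (uext (Wb x q xc)) (- R) = emeasure (Wb x q xc) (- R)"
    using Wb_space[of x q xc] compl_R by (intro emeasure_uext_sets) (simp_all add: space_prob_algebra)
  also have "(\<integral>\<^sup>+w. ?G w \<partial>uext (Wb x q xc)) + emeasure (Wb x q xc) (- R) \<le> ?J + ennreal \<delta>"
    unfolding J by (intro add_left_mono Wb_compl_R[OF r])
  finally show ?thesis by (rule V_Suc_le)
qed

text \<open>Acceptance is recorded one update ahead, in step with \<open>v\<close>: the label of the
  concrete state in the pair counts although the memory has not read it yet.\<close>

definition B :: "(('x \<times> 'q \<times> 'xc) \<times> 'xc) set" where
  "B = {z. nextq (fst (snd (fst z))) (snd z) \<in> F}"

lemma memq_measurable: "(\<lambda>z. fst (snd (fst z))) \<in> measurable N (count_space UNIV)"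
  by (rule measurable_univ_alg_finer) measurable

lemma newq_measurable: "(\<lambda>z. nextq (fst (snd (fst z))) (snd z)) \<in> measurable N (count_space UNIV)"
  by (rule nextq_measurable[OF memq_measurable measurable_univ_alg_finer[OF measurable_snd]])

lemma B_sets: "B \<in> sets N"
  using measurable_sets[OF newq_measurable, of F] by (simp add: B_def vimage_def space_pair_measure)

lemma v_0: "v 0 z \<le> indicator B z"
proof (cases "z \<in> B")
  case True then show ?thesis using v_le_1[of 0 z] by simp
next
  case False
  obtain m xc where z: "z = (m, xc)" by (cases z)
  have "nextq (fst (snd m)) xc \<notin> F" using False by (simp add: B_def z)
  then have "g 0 (x, nextq (fst (snd m)) xc, xc) = 0" for x by (simp add: g_def pay_def V_0)
  then show ?thesis by (simp add: z v_eq)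
qed

text \<open>Off \<open>B\<close> the pending update ends in a non-accepting state, where the payoff
  is the iterate itself. The inequality of \<open>coupled_step\<close> then holds for every abstract
  state that the update may draw, and outside \<open>R\<close> the left side is 0.\<close>

lemma v_Suc:
  assumes z: "z \<notin> B"
  shows "v (Suc l) z \<le> (\<integral>\<^sup>+z'. v l z' \<partial>cl_step MM C M z)"
proof -
  obtain m xc where zm: "z = (m, xc)" by (cases z)
  let ?q = "nextq (fst (snd m)) xc"
  let ?H = "\<lambda>m'. \<integral>\<^sup>+u. \<integral>\<^sup>+xc'. v l (m', xc') \<partial>uext (trans M xc u) \<partial>uext (cout C m')"
  have q: "?q \<notin> F" using z by (simp add: B_def zm)
  have "(\<integral>\<^sup>+z'. v l z' \<partial>cl_step MM C M z) = (\<integral>\<^sup>+m'. ?H m' \<partial>uext (ctrans C m xc))"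
    using nn_integral_cl_step[OF strategy M _ v_measurable, of z l] by (simp add: zm space_pair_measure)
  moreover have "v (Suc l) z \<le> (\<integral>\<^sup>+m'. ?H m' \<partial>uext (ctrans C m xc))"
  proof -
    have Hm: "?H \<in> borel_measurable (univ_alg MM)"
    proof (rule measurable_nn_integral_uext[OF cout_measurable])
      have "(\<lambda>s. \<integral>\<^sup>+xc'. v l (fst s, xc') \<partial>uext (trans M xc (snd s))) \<in> borel_measurable (univ_alg (MM \<Otimes>\<^sub>M (borel :: 'uc measure)))"
      proof (rule measurable_nn_integral_uext)
        show "(\<lambda>s. trans M xc (snd s)) \<in> measurable (univ_alg (MM \<Otimes>\<^sub>M borel)) (prob_algebra borel)"
          by (rule measurable_compose[OF measurable_univ_alg_finer[OF measurable_snd] M_trans_measurable])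
        have "(\<lambda>x. (fst (fst x), snd x)) \<in> measurable ((MM \<Otimes>\<^sub>M (borel :: 'uc measure)) \<Otimes>\<^sub>M (borel :: 'xc measure)) (MM \<Otimes>\<^sub>M borel)"
          by measurable
        from measurable_compose[OF measurable_univ_alg_lift[OF this] v_measurable]
        show "(\<lambda>(s, xc'). v l (fst s, xc')) \<in> borel_measurable (univ_alg ((MM \<Otimes>\<^sub>M (borel :: 'uc measure)) \<Otimes>\<^sub>M borel))"
          by (simp add: split_beta')
      qed
      then show "(\<lambda>(m', u). \<integral>\<^sup>+xc'. v l (m', xc') \<partial>uext (trans M xc u)) \<in> borel_measurable (univ_alg (MM \<Otimes>\<^sub>M borel))"
        by (simp add: split_beta')
    qed
    have "g (Suc l) (x, ?q, xc) \<le> ?H (x, ?q, xc)" for x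
    proof (cases "(x, xc) \<in> R")
      case True
      then have "g (Suc l) (x, ?q, xc) = ennreal (V (Suc l) (x, ?q))" using q V_bounds[of "Suc l"] by (simp add: g_def pay_def max_absorb2)
      also have "\<dots> \<le> ?H (x, ?q, xc)" by (rule coupled_step[OF True q])
      finally show ?thesis .
    next
      case False then show ?thesis by (simp add: g_def)
    qed
    then have "v (Suc l) z \<le> (\<integral>\<^sup>+x. ?H (x, ?q, xc) \<partial>uext (Kr m xc))"
      unfolding zm v_eq[of "Suc l"] by (intro nn_integral_mono)
    then show ?thesis unfolding nn_integral_ctrans[OF Hm] .
  qed
  ultimately show ?thesis by simp
qed

lemma AE_cl_step: "AE z' in cl_step MM C M z. fst (snd (fst z')) = nextq (fst (snd (fst z))) (snd z)"
proof -
  obtain m xc where zm: "z = (m, xc)" by (cases z)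
  let ?q = "nextq (fst (snd m)) xc"
  let ?A = "{z'. fst (snd (fst z')) \<noteq> ?q} :: (('x \<times> 'q \<times> 'xc) \<times> 'xc) set"
  have A: "?A \<in> sets N"
    using measurable_sets[OF memq_measurable, of "- {?q}"] by (simp add: vimage_def space_pair_measure)
  have sp: "cl_step MM C M z \<in> space (prob_algebra N)"
    using measurable_space[OF cl_step_measurable[OF strategy M], of z] by (simp add: space_pair_measure)
  then have st: "sets (cl_step MM C M z) = sets N" by (simp add: space_prob_algebra)
  have spc: "space (cl_step MM C M z) = UNIV" using sets_eq_imp_space_eq[OF st] by (simp add: space_pair_measure)
  have A1: "{m'. fst (snd m') \<noteq> ?q} \<in> sets (univ_alg MM)"
  proof -
    have "(\<lambda>m. fst (snd m)) \<in> measurable (univ_alg MM) (count_space UNIV)" by (rule measurable_univ_alg_finer) measurable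
    from measurable_sets[OF this, of "- {?q}"] show ?thesis by (simp add: vimage_def space_pair_measure)
  qed
  have "emeasure (cl_step MM C M z) ?A = (\<integral>\<^sup>+z'. indicator ?A z' \<partial>cl_step MM C M z)"
    using A st by (intro nn_integral_indicator[symmetric]) simp
  also have "\<dots> = (\<integral>\<^sup>+m'. \<integral>\<^sup>+u. \<integral>\<^sup>+x'. indicator ?A (m', x') \<partial>uext (trans M xc u) \<partial>uext (cout C m') \<partial>uext (ctrans C m xc))"
    using nn_integral_cl_step[OF strategy M _ borel_measurable_indicator[OF A], of z] by (simp add: zm space_pair_measure)
  also have "\<dots> \<le> (\<integral>\<^sup>+m'. indicator {m'. fst (snd m') \<noteq> ?q} m' \<partial>uext (ctrans C m xc))"
  proof (rule nn_integral_mono)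
    fix m' :: "'x \<times> 'q \<times> 'xc"
    show "(\<integral>\<^sup>+u. \<integral>\<^sup>+x'. indicator ?A (m', x') \<partial>uext (trans M xc u) \<partial>uext (cout C m')) \<le> indicator {m'. fst (snd m') \<noteq> ?q} m'"
    proof (cases "fst (snd m') = ?q")
      case True then show ?thesis by simp
    next
      case False
      have co: "cout C m' \<in> space (prob_algebra borel)"
        using measurable_space[OF cout_measurable, of m'] by (simp add: space_pair_measure)
      have "(\<integral>\<^sup>+u. \<integral>\<^sup>+x'. indicator ?A (m', x') \<partial>uext (trans M xc u) \<partial>uext (cout C m')) \<le> 1"
        by (intro nn_integral_uext_le_1[OF co] nn_integral_uext_le_1[OF M_trans_space]) (simp add: indicator_def)
      then show ?thesis using False by simp
    qed
  qed
  also have "\<dots> = 0"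
    unfolding nn_integral_ctrans[OF borel_measurable_indicator[OF A1]] by simp
  finally have "emeasure (cl_step MM C M z) ?A = 0" by simp
  then show ?thesis using A st by (intro AE_I[of _ _ ?A]) (auto simp: zm)
qed

section \<open>The closed loop as a Markov chain and its satisfaction probability\<close>

sublocale chain: markov_chain N "cl_step MM C M" "(cinit C, init M)"
  by (rule markov_chain.intro[OF cl_step_measurable[OF strategy M]]) (simp add: space_pair_measure)

lemma path_measure_eq: "cl_path_measure MM C M = chain.IT.PF.lim"
proof -
  have "chain.ker = cl_kernels MM C M"
    by (intro ext) (simp add: chain.ker_def cl_kernels_def)
  then show ?thesis by (simp add: cl_path_measure_def)
qed

text \<open>For every horizon, the value at the start bounds the probability of visiting
  \<open>B\<close> from below, and such a visit almost surely means acceptance. The bound is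
  independent of the horizon and passes to the limit.\<close>

lemma satisfaction_lower_bound:
  assumes acc: "\<And>w. dfa_accepts q0 F \<tau> w \<longleftrightarrow> scsat w 0 \<psi>"
  shows "robust_sat_prob Mh L q0 F \<tau> \<mu> \<delta> \<le> sat_prob MM C M L \<psi>"
proof -
  interpret P: prob_space chain.IT.PF.lim by (rule chain.prob_space_lim)
  let ?PN = "PiM UNIV (\<lambda>_::nat. N)"
  let ?w = "\<lambda>\<omega> i. L (out M (snd (\<omega> i)))"
  let ?out = "\<lambda>\<omega> i. out M (snd (\<omega> i))"
  let ?Acc = "{ys \<in> space (PiM UNIV (\<lambda>_::nat. borel)). scsat (\<lambda>i. L (ys i)) 0 \<psi>}"
  let ?E = "{\<omega> \<in> space ?PN. dfa_accepts q0 F \<tau> (?w \<omega>)}"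
  \<comment> \<open>Satisfaction is measurable through the automaton: acceptance is a countable
    union over run lengths.\<close>
  have AccS: "?Acc \<in> sets (PiM UNIV (\<lambda>_::nat. borel))"
  proof -
    have c: "(\<lambda>ys. L (ys i)) \<in> measurable (PiM UNIV (\<lambda>_::nat. borel)) (count_space UNIV)" for i
    proof -
      have "(\<lambda>ys. ys i) \<in> measurable (PiM UNIV (\<lambda>_::nat. borel)) borel" by (rule measurable_component_singleton) simp
      from measurable_compose[OF this L] show ?thesis .
    qed
    have "(\<lambda>ys. dfa_run \<tau> q0 (\<lambda>i. L (ys i)) n) -` F \<inter> space (PiM UNIV (\<lambda>_::nat. borel)) \<in> sets (PiM UNIV (\<lambda>_::nat. borel))" for n
      by (rule measurable_sets[OF dfa_run_measurable[OF c]]) simp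
    then have "(\<Union>n. (\<lambda>ys. dfa_run \<tau> q0 (\<lambda>i. L (ys i)) n) -` F \<inter> space (PiM UNIV (\<lambda>_::nat. borel))) \<in> sets (PiM UNIV (\<lambda>_::nat. borel))"
      by blast
    also have "(\<Union>n. (\<lambda>ys. dfa_run \<tau> q0 (\<lambda>i. L (ys i)) n) -` F \<inter> space (PiM UNIV (\<lambda>_::nat. borel))) = ?Acc"
      unfolding acc[symmetric] dfa_accepts_def by blast
    finally show ?thesis .
  qed
  have outm: "?out \<in> measurable ?PN (PiM UNIV (\<lambda>_::nat. borel))"
  proof (rule measurable_PiM_single')
    fix i :: nat
    have "out M \<in> measurable borel borel" using M by (simp add: is_gmdp_def)
    moreover have "(\<lambda>\<omega>. \<omega> i) \<in> measurable ?PN N" by (rule measurable_component_singleton) simp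
    ultimately show "(\<lambda>\<omega>. out M (snd (\<omega> i))) \<in> measurable ?PN borel"
      using measurable_compose[OF measurable_compose[OF _ measurable_univ_alg_finer[OF measurable_snd]]] by blast
  qed simp
  have outm': "?out \<in> measurable chain.IT.PF.lim (PiM UNIV (\<lambda>_::nat. borel))"
    using outm by (subst measurable_cong_sets[OF chain.IT.PF.sets_lim refl])
  have pre: "?out -` ?Acc \<inter> space ?PN = ?E"
    using measurable_space[OF outm] by (auto simp: acc)
  have Es: "?E \<in> sets chain.IT.PF.lim"
    unfolding pre[symmetric] chain.IT.PF.sets_lim by (rule measurable_sets[OF outm AccS])
  have sat: "sat_prob MM C M L \<psi> = measure chain.IT.PF.lim ?E"
    unfolding sat_prob_def cl_trace_measure_def path_measure_eq
    using measure_distr[OF outm' AccS] pre by (simp add: chain.IT.PF.space_lim)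
  have Rel: "Measurable.pred (N \<Otimes>\<^sub>M N) (\<lambda>(z, z'). fst (snd (fst z')) = nextq (fst (snd (fst z))) (snd z))"
  proof -
    have "Measurable.pred (N \<Otimes>\<^sub>M N) (\<lambda>x. fst (snd (fst (snd x))) = q)" for q
      by (rule measurable_compose[OF measurable_compose[OF measurable_snd memq_measurable]]) simp
    from measurable_compose_countable[OF this measurable_compose[OF measurable_fst newq_measurable]]
    show ?thesis by (simp add: split_beta')
  qed
  have AEt: "AE \<omega> in chain.IT.PF.lim. \<forall>i. fst (snd (fst (\<omega> (Suc i)))) = nextq (fst (snd (fst (\<omega> i)))) (snd (\<omega> i))"
    by (rule chain.AE_transitions[OF Rel AE_cl_step])
  have AE0: "AE \<omega> in chain.IT.PF.lim. fst (snd (fst (\<omega> 0))) \<in> F"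
  proof (rule chain.AE_start)
    show "Measurable.pred N (\<lambda>z. fst (snd (fst z)) \<in> F)"
      by (rule measurable_compose[OF memq_measurable]) simp
  qed (simp add: C_def qF)
  have hit: "v n (cinit C, init M) \<le> ennreal (measure chain.IT.PF.lim ?E)" for n
  proof -
    have "v n (cinit C, init M) \<le> emeasure chain.IT.PF.lim {\<omega>\<in>space ?PN. \<exists>i\<le>n. \<omega> i \<in> B}"
      by (rule chain.hitting_lower_bound[OF B_sets v_measurable v_0 v_le_1 v_Suc])
    also have "\<dots> \<le> emeasure chain.IT.PF.lim ?E"
    proof (rule emeasure_mono_AE[OF _ Es])
      \<comment> \<open>The path space also contains paths on which the memory violates its own
        update rule, so a visit to \<open>B\<close> implies acceptance only up to a null
        set.\<close>
      show "AE \<omega> in chain.IT.PF.lim. \<omega> \<in> {\<omega>\<in>space ?PN. \<exists>i\<le>n. \<omega> i \<in> B} \<longrightarrow> \<omega> \<in> ?E"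
        using AEt AE0
      proof eventually_elim
        case (elim \<omega>)
        show ?case
        proof
          assume "\<omega> \<in> {\<omega>\<in>space ?PN. \<exists>i\<le>n. \<omega> i \<in> B}"
          then obtain i where sp: "\<omega> \<in> space ?PN" and i: "\<omega> i \<in> B" by blast
          have "dfa_accepts q0 F \<tau> (?w \<omega>)"
          proof (rule run_accepts[where q="\<lambda>i. fst (snd (fst (\<omega> i)))" and i=i])
            show "fst (snd (fst (\<omega> 0))) \<in> F" by (rule elim(2))
            show "fst (snd (fst (\<omega> (Suc i)))) = \<tau> (if fst (snd (fst (\<omega> i))) \<in> F then q0 else fst (snd (fst (\<omega> i)))) (?w \<omega> i)" for i
              using elim(1) by (simp add: nextq_def)
            show "\<tau> (if fst (snd (fst (\<omega> i))) \<in> F then q0 else fst (snd (fst (\<omega> i)))) (?w \<omega> i) \<in> F"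
              using i by (simp add: B_def nextq_def)
          qed
          then show "\<omega> \<in> ?E" using sp by simp
        qed
      qed
    qed
    finally show ?thesis by (simp add: P.emeasure_eq_measure)
  qed
  let ?q = "\<tau> q0 (L (out Mh (init Mh)))"
  \<comment> \<open>From the marked initial memory the first update is deterministic: it restores
    the initial abstract state and reads the first label, which is common to both systems because
    the initial pair is in \<open>R\<close>.\<close>
  have vq: "v n (cinit C, init M) = ennreal (pay (V n) (init Mh, ?q))" for n
  proof -
    have nq: "nextq qF (init M) = ?q" using qF out_eq[OF init_R] by (simp add: nextq_def)
    have rs: "return borel (init Mh) \<in> space (prob_algebra borel)"
      using measurable_space[OF measurable_return_prob_space, of "init Mh" borel] by simp
    have ur: "uext (return borel (init Mh)) = return (univ_alg borel) (init Mh)"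
      by (rule uext_return) simp
    have gm: "(\<lambda>x. g n (x, ?q, init M)) \<in> borel_measurable (univ_alg borel)"
      by (rule measurable_compose[OF measurable_univ_alg_lift[OF ctrans_distr_measurable] g_measurable])
    have "v n (cinit C, init M) = (\<integral>\<^sup>+x. g n (x, ?q, init M) \<partial>uext (return borel (init Mh)))"
      using qF nq by (simp add: v_eq C_def Kr_def)
    also have "\<dots> = g n (init Mh, ?q, init M)"
      unfolding ur by (rule nn_integral_return[OF _ gm]) simp
    also have "\<dots> = ennreal (pay (V n) (init Mh, ?q))" using init_R by (simp add: g_def)
    finally show ?thesis .
  qed
  have pl: "pay (V n) (init Mh, ?q) \<le> sat_prob MM C M L \<psi>" for n
    using hit[of n] unfolding vq sat by (simp add: ennreal_le_iff)
  have "V_inf Mh L F \<tau> \<mu> \<delta> (init Mh, ?q) \<le> sat_prob MM C M L \<psi>"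
    by (rule V_inf_le) (use pl in \<open>simp add: pay_def\<close>)
  moreover have "indicator F ?q \<le> sat_prob MM C M L \<psi>" using pl[of 0] by (simp add: pay_def)
  ultimately show ?thesis by (simp add: robust_sat_prob_def Let_def)
qed

end

theorem theorem2:
  fixes Mh :: "('x::polish_space, 'u::polish_space, 'y::metric_space) gmdp"
    and L :: "'y \<Rightarrow> 'ap::finite set"
    and \<psi> :: "'ap scltl"
    and q0 :: "'q::finite" and F :: "'q set" and \<tau> :: "'q \<Rightarrow> 'ap set \<Rightarrow> 'q"
    and \<mu> :: "'x \<times> 'q \<Rightarrow> 'u measure"
    and \<delta> :: real
  assumes "is_gmdp Mh"
    and "L \<in> measurable borel (count_space UNIV)"
    and "\<forall>w. dfa_accepts q0 F \<tau> w \<longleftrightarrow> scsat w 0 \<psi>"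
    and "\<delta> \<ge> 0"
    and "is_policy \<mu>"
  shows "\<forall>M :: ('xc::polish_space, 'uc::polish_space, 'y) gmdp.
           is_gmdp M \<and> approx_sim \<delta> 0 Mh M \<longrightarrow>
           (\<exists>C :: ('x \<times> 'q \<times> 'xc, 'xc, 'uc) strategy.
              is_strategy (borel \<Otimes>\<^sub>M (count_space UNIV \<Otimes>\<^sub>M borel)) C \<and>
              sat_prob (borel \<Otimes>\<^sub>M (count_space UNIV \<Otimes>\<^sub>M borel)) C M L \<psi>
                \<ge> robust_sat_prob Mh L q0 F \<tau> \<mu> \<delta>)"
proof (intro allI impI)
  fix M :: "('xc, 'uc, 'y) gmdp"
  assume "is_gmdp M \<and> approx_sim \<delta> 0 Mh M"
  then have M: "is_gmdp M" and sim: "approx_sim \<delta> 0 Mh M" by auto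
  interpret A: abstraction Mh L F \<tau> \<mu> \<delta>
    by (rule abstraction.intro[OF assms(1,2,5,4)])
  let ?MM = "(borel :: 'x measure) \<Otimes>\<^sub>M ((count_space UNIV :: 'q measure) \<Otimes>\<^sub>M (borel :: 'xc measure))"
  show "\<exists>C :: ('x \<times> 'q \<times> 'xc, 'xc, 'uc) strategy. is_strategy ?MM C \<and>
      sat_prob ?MM C M L \<psi> \<ge> robust_sat_prob Mh L q0 F \<tau> \<mu> \<delta>"
  proof (cases "F = {}")
    \<comment> \<open>No state can mark the initial memory here. All iterates vanish, so a constant
      strategy meets the bound 0.\<close>
    case True
    define C :: "('x \<times> 'q \<times> 'xc, 'xc, 'uc) strategy" where
      "C = \<lparr>cinit = undefined, ctrans = \<lambda>_ _. return ?MM undefined, cout = \<lambda>_. return borel undefined\<rparr>"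
    have "return ?MM undefined \<in> space (prob_algebra ?MM)"
      by (rule measurable_space[OF measurable_return_prob_space]) (simp add: space_pair_measure)
    moreover have "return borel undefined \<in> space (prob_algebra (borel :: 'uc measure))"
      by (rule measurable_space[OF measurable_return_prob_space]) simp
    ultimately have "is_strategy ?MM C"
      by (simp add: is_strategy_def C_def split_beta' measurable_const)
    moreover have "A.V l s = 0" for l s
    proof (induction l arbitrary: s)
      case (Suc l)
      have "A.pay (A.V l) s' = 0" for s' unfolding A.pay_def Suc by (simp add: True)
      then have "Tmu Mh L F \<tau> \<mu> (A.V l) s = 0" by (simp add: A.Tmu_eq(3)[OF A.V_admissible])
      then show ?case using assms(4) by (simp add: A.V_Suc Tmu_delta_def clip01_def)
    qed (simp add: A.V_0)
    then have "V_inf Mh L F \<tau> \<mu> \<delta> s \<le> 0" for s by (intro A.V_inf_le) simp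
    then have "robust_sat_prob Mh L q0 F \<tau> \<mu> \<delta> \<le> 0"
      by (simp add: robust_sat_prob_def Let_def True)
    then have "robust_sat_prob Mh L q0 F \<tau> \<mu> \<delta> \<le> sat_prob ?MM C M L \<psi>"
      using order_trans[OF _ measure_nonneg] unfolding sat_prob_def by blast
    ultimately show ?thesis by blast
  next
    case False
    then obtain qF where qF: "qF \<in> F" by blast
    obtain Uv :: "'u \<Rightarrow> 'x \<Rightarrow> 'xc \<Rightarrow> 'uc measure" and R :: "('x \<times> 'xc) set"
      and W :: "'u \<Rightarrow> 'x \<Rightarrow> 'xc \<Rightarrow> ('x \<times> 'xc) measure"
      where Uv: "\<And>u x xc. Uv u x xc \<in> space (prob_algebra borel)" and R: "R \<in> sets borel"
      and W: "(\<lambda>(u, x, xc). W u x xc) \<in> measurable borel (prob_algebra borel)"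
      and init: "(init Mh, init M) \<in> R"
      and RR: "\<forall>(x, xc) \<in> R. dist (out Mh x) (out M xc) \<le> 0 \<and>
         (\<forall>u. (\<forall>A \<in> sets borel. emeasure (W u x xc) (A \<times> UNIV) = emeasure (trans Mh x u) A) \<and>
              (\<forall>A \<in> sets borel. emeasure (W u x xc) (UNIV \<times> A)
                                 = emeasure (kmix (trans M) xc (Uv u x xc)) A) \<and>
              measure (W u x xc) R \<ge> 1 - \<delta>)"
      using sim unfolding approx_sim_def by blast
    have W_sp: "W u x xc \<in> space (prob_algebra (borel \<Otimes>\<^sub>M borel))" for u x xc
      using measurable_space[OF W, of "(u, x, xc)"] by (simp add: borel_prod)
    have t: "(\<lambda>(x, u). trans M x u) \<in> measurable borel (prob_algebra borel)"
      using M by (simp add: is_gmdp_def)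
    have tx: "trans M x \<in> measurable borel (prob_algebra borel)" for x
      using gmdp_trans_measurable[OF M, of "\<lambda>_. x" borel "\<lambda>u. u"] by simp
    let ?\<rho> = "\<lambda>z. distr (W (fst z) (fst (snd z)) (snd (snd z))) borel snd"
    have "(\<lambda>z. W (fst z) (fst (snd z)) (snd (snd z))) \<in> measurable borel (prob_algebra (borel \<Otimes>\<^sub>M borel))"
      using W by (simp add: split_beta' borel_prod)
    from measurable_compose[OF this measurable_distr_prob_space[OF measurable_snd]]
    have \<rho>: "?\<rho> \<in> measurable borel (prob_algebra borel)" .
    have p: "(\<lambda>z. snd (snd z)) \<in> measurable (borel :: ('u \<times> 'x \<times> 'xc) measure) borel"
      by (intro borel_measurable_continuous_onI continuous_intros)
    obtain \<sigma> where \<sigma>: "\<sigma> \<in> measurable (univ_alg borel) (prob_algebra borel)"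
      and \<sigma>_sel: "\<And>z \<nu>. \<nu> \<in> space (prob_algebra borel) \<Longrightarrow> \<nu> \<bind> trans M (snd (snd z)) = ?\<rho> z \<Longrightarrow>
        \<sigma> z \<bind> trans M (snd (snd z)) = ?\<rho> z"
      using measurable_interface[OF t \<rho> p] by blast
    have sel: "\<sigma> (u, x, xc) \<bind> trans M xc = distr (W u x xc) borel snd" if r: "(x, xc) \<in> R" for u x xc
    proof -
      \<comment> \<open>The given interface only witnesses that the equation is solvable at this
        point; the selection then returns its own solution.\<close>
      have "Uv u x xc \<bind> trans M xc = distr (W u x xc) borel snd"
      proof (rule measure_eqI)
        have s: "sets (Uv u x xc \<bind> trans M xc) = sets borel" by (rule sets_bind'[OF Uv tx])
        then show "sets (Uv u x xc \<bind> trans M xc) = sets (distr (W u x xc) borel snd)" by simp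
        fix A assume "A \<in> sets (Uv u x xc \<bind> trans M xc)"
        then have A: "A \<in> sets borel" by (simp add: s)
        have w: "sets (W u x xc) = sets (borel \<Otimes>\<^sub>M borel)" using W_sp by (simp add: space_prob_algebra)
        have m: "snd \<in> measurable (W u x xc) borel" using w by (simp cong: measurable_cong_sets)
        have "snd -` A \<inter> space (W u x xc) = UNIV \<times> A"
          using sets_eq_imp_space_eq[OF w] by (auto simp: space_pair_measure)
        then have "emeasure (distr (W u x xc) borel snd) A = emeasure (W u x xc) (UNIV \<times> A)"
          by (simp add: emeasure_distr[OF m A])
        also have "\<dots> = emeasure (kmix (trans M) xc (Uv u x xc)) A" using RR r A by blast
        finally show "emeasure (Uv u x xc \<bind> trans M xc) A = emeasure (distr (W u x xc) borel snd) A"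
          by (simp add: kmix_def)
      qed
      then show ?thesis using \<sigma>_sel[OF Uv[of u x xc], of "(u, x, xc)"] by simp
    qed
    \<comment> \<open>The whole memory, completed, is the parameter space of the disintegration;
      this is where its validity for an arbitrary measurable parameter space is used.\<close>
    let ?Wb = "\<lambda>m. \<mu> (fst m, fst (snd m)) \<bind> (\<lambda>u. W u (fst m) (snd (snd m)))"
    have Wb: "?Wb \<in> measurable (univ_alg ?MM) (prob_algebra (borel \<Otimes>\<^sub>M borel))"
    proof (rule measurable_bind_prob_space2)
      have "(\<lambda>m. (fst m, fst (snd m))) \<in> measurable ?MM XQ" by measurable
      from measurable_compose[OF measurable_univ_alg_lift[OF this] A.policy_measurable]
      show "(\<lambda>m. \<mu> (fst m, fst (snd m))) \<in> measurable (univ_alg ?MM) (prob_algebra borel)" .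
      have 1: "(\<lambda>m. fst m) \<in> measurable (univ_alg ?MM) borel" "(\<lambda>m. snd (snd m)) \<in> measurable (univ_alg ?MM) borel"
        by (rule measurable_univ_alg_finer, measurable)+
      have "(\<lambda>x. (snd x, fst (fst x), snd (snd (fst x)))) \<in> measurable (univ_alg ?MM \<Otimes>\<^sub>M (borel :: 'u measure)) (borel \<Otimes>\<^sub>M (borel \<Otimes>\<^sub>M borel))"
        by (rule measurable_Pair[OF measurable_snd measurable_Pair[OF measurable_compose[OF measurable_fst 1(1)] measurable_compose[OF measurable_fst 1(2)]]])
      then have "(\<lambda>x. (snd x, fst (fst x), snd (snd (fst x)))) \<in> measurable (univ_alg ?MM \<Otimes>\<^sub>M (borel :: 'u measure)) borel"
        by (simp add: borel_prod)
      from measurable_compose[OF this W]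
      show "(\<lambda>(m, u). W u (fst m) (snd (snd m))) \<in> measurable (univ_alg ?MM \<Otimes>\<^sub>M borel) (prob_algebra (borel \<Otimes>\<^sub>M borel))"
        by (simp add: split_beta' borel_prod)
    qed
    obtain K :: "'x \<times> 'q \<times> 'xc \<Rightarrow> 'xc \<Rightarrow> 'x measure" where
      K: "(\<lambda>(m, y). K m y) \<in> measurable (univ_alg ?MM \<Otimes>\<^sub>M borel) (prob_algebra borel)" and
      K_dis: "\<And>m. m \<in> space (univ_alg ?MM) \<Longrightarrow>
        ?Wb m = distr (?Wb m) borel snd \<bind> (\<lambda>y. distr (K m y) (borel \<Otimes>\<^sub>M borel) (\<lambda>x. (x, y)))"
      using kernel_disintegration[OF Wb] by blast
    interpret c: coupling Mh L F \<tau> \<mu> \<delta> q0 qF M R W \<sigma> K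
    proof (unfold_locales)
      \<comment> \<open>With precision 0 the distance bound forces equal outputs, and hence equal
        labels.\<close>
      show "out Mh x = out M xc" if "(x, xc) \<in> R" for x xc
        using RR that by fastforce
      show "emeasure (W u x xc) (A \<times> UNIV) = emeasure (trans Mh x u) A"
        if "(x, xc) \<in> R" "A \<in> sets borel" for x xc A u
        using RR that by blast
      show "1 - \<delta> \<le> measure (W u x xc) R" if "(x, xc) \<in> R" for x xc u
        using RR that by blast
      show "\<mu> (x, q) \<bind> (\<lambda>u. W u x xc) = distr (\<mu> (x, q) \<bind> (\<lambda>u. W u x xc)) borel snd \<bind>
        (\<lambda>y. distr (K (x, q, xc) y) (borel \<Otimes>\<^sub>M borel) (\<lambda>x'. (x', y)))" for x q xc
        using K_dis[of "(x, q, xc)"] by (simp add: space_pair_measure)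
    qed (fact M qF R W init \<sigma> sel K)+
    have "robust_sat_prob Mh L q0 F \<tau> \<mu> \<delta> \<le> sat_prob ?MM c.C M L \<psi>"
      using assms(3) by (intro c.satisfaction_lower_bound) blast
    then show ?thesis using c.strategy by blast
  qed
qed

end
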